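(* Let $\kappa\in\mathbb{R}$ and let $(X,d)$ be an Alexandrov space with curvature $\ge\kappa$. Suppose that there exist a quadruple $T:=\{x,y,z,w\}$ in $X$ with $w\in(y,z)$, and with $\mathrm{peri}(x,y,z)<2\pi/\sqrt\kappa$ if $\kappa>0$, and an isometric embedding of $T$ into $M^2_\kappa$ (in particular $d(x,w)=d(\tilde x,\tilde w)$). In addition, assume that there is a point $p\in(x,w)$. Then the triangle $\Delta xyz$ spans the unique closed triangular region $D\subset X$ which contains $p$ and is isometric to the triangular region in $M^2_\kappa$ with vertices $\tilde x,\tilde y$ and $\tilde z$.
   Context: Comparison angle: $\mathrm{peri}(x,y,z):=d(x,y)+d(y,z)+d(z,x)$. For $\kappa>0$ let $S_\kappa(r)=\sin(\sqrt\kappa r)/\sqrt\kappa$, for $\kappa<0$ let $S_\kappa(r)=\sinh(\sqrt{-\kappa}r)/\sqrt{-\kappa}$, and $C_\kappa:=S_\kappa'$. For points $x,y,z$ of a metric space (with $x\ne y$, $x\neq z$, and $\mathrm{peri}(x,y,z)<2\pi/\sqrt\kappa$ if $\kappa>0$), $\tilde\angle_\kappa(x;y,z)\in[0,\pi]$ is defined by $\cos\tilde\angle_\kappa(x;y,z)=\frac{d(x,y)^2+d(x,z)^2-d(y,z)^2}{2d(x,y)d(x,z)}$ if $\kappa=0$, and $\cos\tilde\angle_\kappa(x;y,z)=\frac{C_\kappa(d(y,z))-C_\kappa(d(x,y))C_\kappa(d(x,z))}{\kappa S_\kappa(d(x,y))S_\kappa(d(x,z))}$ if $\kappa\ne0$.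 A quadruple consists of four distinct points; its size is the maximum of the perimeters of all triangles formed by the four points. A metric space has curvature $\ge\kappa$ if $\tilde\angle_\kappa(x;y,z)+\tilde\angle_\kappa(x;z,w)+\tilde\angle_\kappa(x;w,y)\le2\pi$ for every quadruple $(x;y,z,w)$, of size less than $2\pi/\sqrt\kappa$ if $\kappa>0$. An Alexandrov space with curvature $\ge\kappa$ is a complete length space (distance = infimum of lengths of connecting curves; not necessarily geodesic, locally compact or finite dimensional) with curvature $\ge\kappa$. For points $a,b$ of a metric space, $[a,b]:=\{u: d(a,b)=d(a,u)+d(u,b)\}$ and $(a,b):=[a,b]\setminus\{a,b\}$. $\Delta xyz$ denotes the three point set $\{x,y,z\}$. $M^2_\kappa$ is the simply connected complete surface of constant curvature $\kappa$; $\tilde x,\tilde y,\tilde z,\tilde w\in M^2_\kappa$ denote the points corresponding to $x,y,z,w$ under the isometric embedding. The triangular region with given vertices in $M^2_\kappa$ is the closed region bounded by the geodesic triangle with these vertices. The region $D$ spanned by $\Delta xyz$ has $x,y,z$ as its vertices, i.e. they correspond to $\tilde x,\tilde y,\tilde z$ under the isometry; subsets of metric spaces carry the restricted metric. *)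

theory Defs
  imports "HOL-Analysis.Analysis"
begin

section \<open>Betweenness, perimeters and isometric embeddings\<close>

text \<open>
  The surfaces \<open>M\<^sub>\<kappa>\<close> below share the type \<^typ>\<open>real^3\<close>, but each carries its own
  distance function. Notions needed both there and in a metric space of class
  \<^class>\<open>metric_space\<close> therefore take the carrier and the distance as arguments.
\<close>

definition between_closed :: "'a set \<Rightarrow> ('a \<Rightarrow> 'a \<Rightarrow> real) \<Rightarrow> 'a \<Rightarrow> 'a \<Rightarrow> 'a set" where
  "between_closed M d a b = {u \<in> M. d a b = d a u + d u b}"

definition between_open :: "'a set \<Rightarrow> ('a \<Rightarrow> 'a \<Rightarrow> real) \<Rightarrow> 'a \<Rightarrow> 'a \<Rightarrow> 'a set" where
  "between_open M d a b = between_closed M d a b - {a, b}"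

definition isometric_embedding ::
  "'a set \<Rightarrow> ('a \<Rightarrow> 'a \<Rightarrow> real) \<Rightarrow> 'b set \<Rightarrow> ('b \<Rightarrow> 'b \<Rightarrow> real) \<Rightarrow> ('a \<Rightarrow> 'b) \<Rightarrow> bool" where
  "isometric_embedding A d B e f \<longleftrightarrow>
     f ` A \<subseteq> B \<and> (\<forall>a\<in>A. \<forall>b\<in>A. e (f a) (f b) = d a b)"

definition peri :: "'a::metric_space \<Rightarrow> 'a \<Rightarrow> 'a \<Rightarrow> real" where
  "peri x y z = dist x y + dist y z + dist z x"

definition quad_size :: "'a::metric_space \<Rightarrow> 'a \<Rightarrow> 'a \<Rightarrow> 'a \<Rightarrow> real" where
  "quad_size x y z w = Max {peri x y z, peri x y w, peri x z w, peri y z w}"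

section \<open>Comparison angles and Alexandrov spaces\<close>

text \<open>The value for \<open>\<kappa> = 0\<close> is only a filler; that case of the angle does not use it.\<close>

definition snk :: "real \<Rightarrow> real \<Rightarrow> real" where
  "snk \<kappa> r = (if \<kappa> > 0 then sin (sqrt \<kappa> * r) / sqrt \<kappa>
             else if \<kappa> < 0 then sinh (sqrt (-\<kappa>) * r) / sqrt (-\<kappa>)
             else r)"

definition csk :: "real \<Rightarrow> real \<Rightarrow> real" where
  "csk \<kappa> = deriv (snk \<kappa>)"

lemma csk_pos: "\<kappa> > 0 \<Longrightarrow> csk \<kappa> r = cos (sqrt \<kappa> * r)"
  unfolding csk_def snk_def
  by (rule DERIV_imp_deriv) (auto intro!: derivative_eq_intros simp: mult.assoc)

lemma csk_neg: "\<kappa> < 0 \<Longrightarrow> csk \<kappa> r = cosh (sqrt (-\<kappa>) * r)"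
  unfolding csk_def snk_def
  by (rule DERIV_imp_deriv) (auto intro!: derivative_eq_intros simp: mult.assoc)

text \<open>
  For \<open>x \<noteq> y\<close>, \<open>x \<noteq> z\<close> and, if \<open>\<kappa> > 0\<close>, perimeter below \<open>2 * pi / sqrt \<kappa>\<close>, the argument of
  \<^const>\<open>arccos\<close> lies in \<open>[-1, 1]\<close> by the triangle inequality, so that the value is the angle
  in \<open>[0, pi]\<close> with that cosine. Outside this range the value is meaningless.
\<close>

definition comparison_angle :: "real \<Rightarrow> 'a::metric_space \<Rightarrow> 'a \<Rightarrow> 'a \<Rightarrow> real" where
  "comparison_angle \<kappa> x y z = arccos
     (if \<kappa> = 0 then ((dist x y)\<^sup>2 + (dist x z)\<^sup>2 - (dist y z)\<^sup>2) / (2 * dist x y * dist x z)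
      else (csk \<kappa> (dist y z) - csk \<kappa> (dist x y) * csk \<kappa> (dist x z))
             / (\<kappa> * snk \<kappa> (dist x y) * snk \<kappa> (dist x z)))"

definition curvature_ge :: "real \<Rightarrow> 'a::metric_space set \<Rightarrow> bool" where
  "curvature_ge \<kappa> X \<longleftrightarrow>
     (\<forall>x\<in>X. \<forall>y\<in>X. \<forall>z\<in>X. \<forall>w\<in>X.
        distinct [x, y, z, w] \<longrightarrow>
        (\<kappa> > 0 \<longrightarrow> quad_size x y z w < 2 * pi / sqrt \<kappa>) \<longrightarrow>
        comparison_angle \<kappa> x y z + comparison_angle \<kappa> x z w + comparison_angle \<kappa> x w y \<le> 2 * pi)"

definition curve_length :: "(real \<Rightarrow> 'a::metric_space) \<Rightarrow> ereal" where
  "curve_length g =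
     (SUP (n, t) \<in> {(n::nat, t::nat \<Rightarrow> real). mono_on {..n} t \<and> t ` {..n} \<subseteq> {0..1}}.
        ereal (\<Sum>i<n. dist (g (t i)) (g (t (Suc i)))))"

text \<open>
  The infimum over the empty set is \<open>\<infinity>\<close> in \<^typ>\<open>ereal\<close>, so a length space is path connected
  by rectifiable curves.
\<close>

definition length_space :: "'a::metric_space set \<Rightarrow> bool" where
  "length_space X \<longleftrightarrow>
     (\<forall>x\<in>X. \<forall>y\<in>X. ereal (dist x y) =
        (INF g \<in> {g. path g \<and> path_image g \<subseteq> X \<and> pathstart g = x \<and> pathfinish g = y}.
           curve_length g))"

definition alexandrov_space :: "real \<Rightarrow> 'a::metric_space set \<Rightarrow> bool" where
  "alexandrov_space \<kappa> X \<longleftrightarrow> complete X \<and> length_space X \<and> curvature_ge \<kappa> X"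

section \<open>The model surface and its triangular regions\<close>

text \<open>
  The sphere of radius \<open>1 / sqrt \<kappa>\<close> with its angular metric for \<open>\<kappa> > 0\<close>, an affine Euclidean
  plane for \<open>\<kappa> = 0\<close>, and the upper sheet of a hyperboloid for \<open>\<kappa> < 0\<close>. In all cases the metric
  topology is the subspace topology of \<^typ>\<open>real^3\<close>.
\<close>

definition lorentz :: "real^3 \<Rightarrow> real^3 \<Rightarrow> real" where
  "lorentz u v = u$1 * v$1 + u$2 * v$2 - u$3 * v$3"

definition model_plane :: "real \<Rightarrow> (real^3) set" where
  "model_plane \<kappa> =
     (if \<kappa> > 0 then {v. v \<bullet> v = 1 / \<kappa>}
      else if \<kappa> < 0 then {v. lorentz v v = 1 / \<kappa> \<and> v$3 > 0}
      else {v. v$3 = 1})"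

definition model_dist :: "real \<Rightarrow> real^3 \<Rightarrow> real^3 \<Rightarrow> real" where
  "model_dist \<kappa> u v =
     (if \<kappa> > 0 then arccos (\<kappa> * (u \<bullet> v)) / sqrt \<kappa>
      else if \<kappa> < 0 then arcosh (\<kappa> * lorentz u v) / sqrt (-\<kappa>)
      else dist u v)"

text \<open>
  A geodesic triangle is only used when its perimeter is below \<open>2 * pi / sqrt \<kappa>\<close> if \<open>\<kappa> > 0\<close>.
  Then any two vertices are at distance below \<open>pi / sqrt \<kappa>\<close>, and \<^const>\<open>between_closed\<close> is the
  unique shortest geodesic joining them.
\<close>

definition geodesic_triangle :: "real \<Rightarrow> real^3 \<Rightarrow> real^3 \<Rightarrow> real^3 \<Rightarrow> (real^3) set" where
  "geodesic_triangle \<kappa> a b c =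
     between_closed (model_plane \<kappa>) (model_dist \<kappa>) a b \<union>
     between_closed (model_plane \<kappa>) (model_dist \<kappa>) b c \<union>
     between_closed (model_plane \<kappa>) (model_dist \<kappa>) c a"

text \<open>
  The region consists of the triangle and the part of the surface that it encloses: the bounded
  components of the complement if \<open>\<kappa> \<le> 0\<close>. On the sphere every component is bounded, and the
  enclosed one is the component contained in an open hemisphere (the other component contains a
  closed hemisphere). A degenerate triangle encloses nothing and its region is a geodesic segment.
\<close>

definition triangular_region :: "real \<Rightarrow> real^3 \<Rightarrow> real^3 \<Rightarrow> real^3 \<Rightarrow> (real^3) set" where
  "triangular_region \<kappa> a b c =
     geodesic_triangle \<kappa> a b c \<union>
     \<Union> {C \<in> components (model_plane \<kappa> - geodesic_triangle \<kappa> a b c).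
           if \<kappa> > 0 then \<exists>e. \<forall>v\<in>C. e \<bullet> v > 0 else bounded C}"

definition spans_region ::
  "real \<Rightarrow> 'a::metric_space \<Rightarrow> 'a \<Rightarrow> 'a \<Rightarrow> real^3 \<Rightarrow> real^3 \<Rightarrow> real^3 \<Rightarrow> 'a set \<Rightarrow> bool" where
  "spans_region \<kappa> x y z a b c D \<longleftrightarrow>
     closed D \<and>
     (\<exists>f. isometric_embedding (triangular_region \<kappa> a b c) (model_dist \<kappa>) D dist f \<and>
          f ` triangular_region \<kappa> a b c = D \<and> f a = x \<and> f b = y \<and> f c = z)"

end

theory Submission
  imports Defs
begin

text \<open>
  Let \<open>\<sigma>(r) = 2 * S\<^sub>\<kappa>(r/2)\<^sup>2\<close>, so that \<open>C\<^sub>\<kappa> = 1 - \<kappa> * \<sigma>\<close>. If \<open>u\<close> lies between \<open>a\<close> and \<open>b\<close>, one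
  comparison angle at \<open>u\<close> is \<open>pi\<close>, and the quadruple condition for \<open>(u; a, b, c)\<close> becomes
  Stewart's inequality, which is linear in \<open>\<sigma>\<close>:
  \<open>S(\<alpha> + \<beta>) * \<sigma>(d(u, c)) \<ge> S(\<beta>) * (\<sigma>(d(a, c)) - \<sigma>(\<alpha>)) + S(\<alpha>) * (\<sigma>(d(b, c)) - \<sigma>(\<beta>))\<close>
  with \<open>\<alpha> = d(a, u)\<close> and \<open>\<beta> = d(u, b)\<close>; on the model surface equality holds. Read forwards it bounds
  \<open>d(u, c)\<close> from below by the model value. Read backwards, if \<open>d(u, c)\<close> is the model value and
  \<open>d(b, c)\<close> is at least the model value, it bounds \<open>d(a, c)\<close> from above. Every distance below is
  determined by applying both readings.

  Geodesics need not exist in \<open>X\<close>, but they do in an ultrapower of \<open>X\<close>, and a point of the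
  ultrapower that is determined by its distances to two points of \<open>X\<close> already lies in \<open>X\<close> because
  \<open>X\<close> is complete. Since \<open>p\<close> extends both halves of \<open>[x, w]\<close>, the geodesic from \<open>x\<close> to \<open>w\<close>
  through \<open>p\<close> exists and is unique, and its points have model distances to \<open>y\<close> and \<open>z\<close>. A point
  between \<open>y\<close> and an interior point \<open>u\<close> of \<open>[x, w]\<close> has model distances to \<open>z\<close> and to \<open>[x, w]\<close>.
  The geodesic from \<open>y\<close> to \<open>u\<close> can be prolonged beyond \<open>u\<close> into the other half of the triangle, so
  this point is unique, and any two such points are at model distance. They fill the interior of
  the triangle, and completeness yields the closed region.
\<close>

section \<open>Generalized trigonometric functions\<close>

text \<open>The function \<open>sig\<close> is (1 - C) / \<kappa> continued to \<kappa> = 0, where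
  it is r^2/2. On the model surface it is half the squared chord in an ambient quadratic form on
  real^3. Working with chords turns geodesics, triangles and half-planes into linear algebra and
  lets the three signs of the curvature share one proof. The obstacle is the size bound for \<kappa>
  > 0. Each use of Stewart's inequality needs a perimeter below twice the diameter, even when one of
  the sides is the distance still to be bounded. Such perimeters are compared with those of model
  triangles in one open half-space, or the inequality is applied close to the point u, or in many
  short steps. The ultrapower is kept as a set of sequences with a pseudometric, so equality of its
  points is replaced by distance zero. Collinear vertices are treated apart. The region is then a
  segment without interior, and a competing region is pinned by the middle vertex, which divides the
  segment into two halves that prolong each other.\<close>

definition sig :: "real \<Rightarrow> real \<Rightarrow> real" where
  "sig \<kappa> r = 2 * (snk \<kappa> (r / 2))\<^sup>2"

definition dia :: "real \<Rightarrow> real" where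
  "dia \<kappa> = pi / sqrt \<kappa>"

text \<open>Three ranges for \<kappa> > 0, vacuous otherwise. Strictly below the diameter
  \<open>snk\<close> is positive and geodesics are unique. Up to the diameter (\<open>fits\<close>)
  \<open>sig\<close> is still strictly increasing, which covers antipodal points. Below twice the
  diameter (\<open>small\<close>) is the bound for perimeters.\<close>

definition short :: "real \<Rightarrow> real \<Rightarrow> bool" where
  "short \<kappa> r \<longleftrightarrow> (\<kappa> > 0 \<longrightarrow> r < dia \<kappa>)"

definition fits :: "real \<Rightarrow> real \<Rightarrow> bool" where
  "fits \<kappa> r \<longleftrightarrow> (\<kappa> > 0 \<longrightarrow> r \<le> dia \<kappa>)"

definition small :: "real \<Rightarrow> real \<Rightarrow> bool" where
  "small \<kappa> r \<longleftrightarrow> (\<kappa> > 0 \<longrightarrow> r < 2 * dia \<kappa>)"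

lemma dia_pos: "\<kappa> > 0 \<Longrightarrow> dia \<kappa> > 0"
  by (simp add: dia_def)

lemma smallD: "small \<kappa> r \<Longrightarrow> s \<le> r \<Longrightarrow> small \<kappa> s"
  by (auto simp: small_def)

lemma small_short: "small \<kappa> r \<Longrightarrow> 2 * s \<le> r \<Longrightarrow> short \<kappa> s"
  by (auto simp: small_def short_def)

lemma shortD: "short \<kappa> r \<Longrightarrow> s \<le> r \<Longrightarrow> short \<kappa> s"
  by (auto simp: short_def)

lemma fitsD: "fits \<kappa> r \<Longrightarrow> s \<le> r \<Longrightarrow> fits \<kappa> s"
  by (auto simp: fits_def)

lemma short_fits: "short \<kappa> r \<Longrightarrow> s \<le> r \<Longrightarrow> fits \<kappa> s"
  by (auto simp: fits_def short_def)

lemma csk_zero: "csk 0 r = 1"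
proof -
  have "snk 0 = (\<lambda>r. r)" by (auto simp: snk_def)
  then show ?thesis by (simp add: csk_def)
qed

lemma snk_pos_def: "\<kappa> > 0 \<Longrightarrow> snk \<kappa> r = sin (sqrt \<kappa> * r) / sqrt \<kappa>"
  and snk_neg_def: "\<kappa> < 0 \<Longrightarrow> snk \<kappa> r = sinh (sqrt (-\<kappa>) * r) / sqrt (-\<kappa>)"
  and snk_zero_def: "snk 0 r = r"
  by (auto simp: snk_def)

lemma kappa_cases:
  fixes \<kappa> :: real
  obtains (pos) k where "k > 0" "\<kappa> = k\<^sup>2" "\<kappa> > 0" "sqrt \<kappa> = k"
  | (neg) k where "k > 0" "\<kappa> = - k\<^sup>2" "\<kappa> < 0" "sqrt (-\<kappa>) = k"
  | (zero) "\<kappa> = 0"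
proof -
  consider "\<kappa> > 0" | "\<kappa> < 0" | "\<kappa> = 0" by linarith
  then show ?thesis
  proof cases
    case 1 then show ?thesis by (intro pos[of "sqrt \<kappa>"]) auto
  next
    case 2 then show ?thesis by (intro neg[of "sqrt (-\<kappa>)"]) auto
  next
    case 3 then show ?thesis by (rule zero)
  qed
qed

lemma snk_0 [simp]: "snk \<kappa> 0 = 0" by (simp add: snk_def)

lemma csk_0 [simp]: "csk \<kappa> 0 = 1"
  by (cases \<kappa> rule: kappa_cases) (simp_all add: csk_pos csk_neg csk_zero)

lemma snk_minus [simp]: "snk \<kappa> (- r) = - snk \<kappa> r"
  by (simp add: snk_def)

lemma csk_minus [simp]: "csk \<kappa> (- r) = csk \<kappa> r"
  by (cases \<kappa> rule: kappa_cases) (simp_all add: csk_pos csk_neg csk_zero)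

lemma snk_add: "snk \<kappa> (a + b) = snk \<kappa> a * csk \<kappa> b + csk \<kappa> a * snk \<kappa> b"
  by (cases \<kappa> rule: kappa_cases)
    (simp_all add: csk_pos csk_neg csk_zero snk_pos_def snk_neg_def snk_zero_def
      ring_distribs sin_add sinh_add add_divide_distrib)

lemma csk_add: "csk \<kappa> (a + b) = csk \<kappa> a * csk \<kappa> b - \<kappa> * snk \<kappa> a * snk \<kappa> b"
proof (cases \<kappa> rule: kappa_cases)
  case (pos k)
  show ?thesis unfolding csk_pos[OF pos(3)] snk_pos_def[OF pos(3)] pos(4) unfolding pos(2)
    using pos(1) by (simp add: ring_distribs cos_add power2_eq_square)
next
  case (neg k)
  show ?thesis unfolding csk_neg[OF neg(3)] snk_neg_def[OF neg(3)] neg(4) unfolding neg(2)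
    using neg(1) by (simp add: ring_distribs cosh_add power2_eq_square)
qed (simp add: csk_zero)

lemma csk_sig: "csk \<kappa> r = 1 - \<kappa> * sig \<kappa> r"
proof -
  have "csk \<kappa> (r/2 + - (r/2)) = (csk \<kappa> (r/2))\<^sup>2 + \<kappa> * (snk \<kappa> (r/2))\<^sup>2"
    unfolding csk_add by (simp add: power2_eq_square)
  then have 1: "(csk \<kappa> (r/2))\<^sup>2 = 1 - \<kappa> * (snk \<kappa> (r/2))\<^sup>2" by simp
  have "csk \<kappa> (r/2 + r/2) = (csk \<kappa> (r/2))\<^sup>2 - \<kappa> * (snk \<kappa> (r/2))\<^sup>2"
    unfolding csk_add by (simp add: power2_eq_square)
  then show ?thesis using 1 by (simp add: sig_def)
qed

lemma sig_minus [simp]: "sig \<kappa> (- r) = sig \<kappa> r"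
  by (simp add: sig_def)

lemma sig_abs [simp]: "sig \<kappa> \<bar>r\<bar> = sig \<kappa> r"
  by (cases "r \<ge> 0") auto

lemma sig_0 [simp]: "sig \<kappa> 0 = 0" by (simp add: sig_def)

lemma sig_nonneg [simp]: "sig \<kappa> r \<ge> 0" by (simp add: sig_def)

lemma sig_zero_curv: "sig 0 r = r\<^sup>2 / 2"
  by (simp add: sig_def snk_def power_divide)

lemma sig_add: "sig \<kappa> (a + b) =
    sig \<kappa> a + sig \<kappa> b - \<kappa> * sig \<kappa> a * sig \<kappa> b + snk \<kappa> a * snk \<kappa> b"
proof (cases "\<kappa> = 0")
  case True
  then show ?thesis by (simp add: sig_zero_curv snk_zero_def power2_eq_square field_simps)
next
  case False
  have "\<kappa> * sig \<kappa> (a + b) =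
    \<kappa> * (sig \<kappa> a + sig \<kappa> b - \<kappa> * sig \<kappa> a * sig \<kappa> b + snk \<kappa> a * snk \<kappa> b)"
    using csk_add[of \<kappa> a b] by (simp add: csk_sig algebra_simps)
  then show ?thesis using False by simp
qed

lemma snk_square: "(snk \<kappa> a)\<^sup>2 = 2 * sig \<kappa> a - \<kappa> * (sig \<kappa> a)\<^sup>2"
  using sig_add[of \<kappa> a "-a"] by (simp add: power2_eq_square)

text \<open>Stewart's equality with an endpoint as third point, whose distances are 0, a and a + b.
  It yields the distances along \<open>geod\<close> and settles degenerate positions of the third
  point.\<close>

lemma snk_sig_add:
  "snk \<kappa> a * sig \<kappa> (a + b) =
   snk \<kappa> (a + b) * sig \<kappa> a + snk \<kappa> b * sig \<kappa> a + snk \<kappa> a * sig \<kappa> b"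
  unfolding sig_add snk_add csk_sig using snk_square[of \<kappa> a] by algebra

lemma snk_pos: "0 < r \<Longrightarrow> short \<kappa> r \<Longrightarrow> 0 < snk \<kappa> r"
  by (cases \<kappa> rule: kappa_cases)
    (auto simp: snk_pos_def snk_neg_def snk_zero_def short_def dia_def field_simps intro!: sin_gt_zero)

lemma snk_nonneg: "0 \<le> r \<Longrightarrow> fits \<kappa> r \<Longrightarrow> 0 \<le> snk \<kappa> r"
  by (cases \<kappa> rule: kappa_cases)
    (auto simp: snk_pos_def snk_neg_def snk_zero_def fits_def dia_def field_simps intro!: sin_ge_zero)

lemma sig_strict_mono:
  assumes "0 \<le> r" "r < s" "fits \<kappa> s"
  shows "sig \<kappa> r < sig \<kappa> s"
proof -
  have "snk \<kappa> (r/2) < snk \<kappa> (s/2)"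
  proof (cases \<kappa> rule: kappa_cases)
    case (pos k)
    have "k * s \<le> pi" using assms pos by (auto simp: fits_def dia_def field_simps)
    moreover have "k * r \<ge> 0" "k * r < k * s" using assms pos by auto
    ultimately have "sin (k * r / 2) < sin (k * s / 2)"
      by (intro sin_monotone_2pi) auto
    then show ?thesis using pos by (simp add: snk_pos_def divide_strict_right_mono)
  next
    case (neg k)
    then show ?thesis using assms by (simp add: snk_neg_def divide_strict_right_mono)
  qed (use assms in \<open>simp add: snk_zero_def\<close>)
  moreover have "0 \<le> snk \<kappa> (r/2)"
    by (rule snk_nonneg) (use assms fitsD[of \<kappa> s "r / 2"] in auto)
  ultimately show ?thesis by (simp add: sig_def power_strict_mono)
qed

lemma sig_le_iff:
  assumes "0 \<le> r" "0 \<le> s" "fits \<kappa> r" "fits \<kappa> s"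
  shows "sig \<kappa> r \<le> sig \<kappa> s \<longleftrightarrow> r \<le> s"
  using assms sig_strict_mono[of r s \<kappa>] sig_strict_mono[of s r \<kappa>] by fastforce

lemma sig_eq_iff:
  assumes "0 \<le> r" "0 \<le> s" "fits \<kappa> r" "fits \<kappa> s"
  shows "sig \<kappa> r = sig \<kappa> s \<longleftrightarrow> r = s"
  using sig_le_iff[of r s \<kappa>] sig_le_iff[of s r \<kappa>] assms by fastforce

lemma sig_pos: "0 < r \<Longrightarrow> fits \<kappa> r \<Longrightarrow> 0 < sig \<kappa> r"
  using sig_strict_mono[of 0 r \<kappa>] by simp

lemma continuous_snk [continuous_intros]:
  fixes f :: "'a::t2_space \<Rightarrow> real"
  shows
  "continuous_on A f \<Longrightarrow> continuous_on A (\<lambda>x. snk \<kappa> (f x))"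
  by (cases \<kappa> rule: kappa_cases)
    (auto simp: snk_pos_def snk_neg_def snk_zero_def intro!: continuous_intros)

lemma tendsto_snk [tendsto_intros]:
  assumes "(f \<longlongrightarrow> l) F" shows "((\<lambda>x. snk \<kappa> (f x)) \<longlongrightarrow> snk \<kappa> l) F"
proof -
  have "isCont (snk \<kappa>) l"
    using continuous_snk[OF continuous_on_id, of UNIV \<kappa>] by (simp add: continuous_on_eq_continuous_at)
  then show ?thesis using assms by (rule isCont_tendsto_compose)
qed

lemma tendsto_sig [tendsto_intros]:
  "(f \<longlongrightarrow> l) F \<Longrightarrow> ((\<lambda>x. sig \<kappa> (f x)) \<longlongrightarrow> sig \<kappa> l) F"
  unfolding sig_def by (intro tendsto_intros) simp_all

lemma sig_reflect: "\<kappa> > 0 \<Longrightarrow> sig \<kappa> (2 * dia \<kappa> - r) = sig \<kappa> r"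
proof -
  assume "\<kappa> > 0"
  then have "sqrt \<kappa> * ((2 * dia \<kappa> - r) / 2) = pi - sqrt \<kappa> * (r / 2)"
    by (simp add: dia_def field_simps)
  then show ?thesis using \<open>\<kappa> > 0\<close> unfolding sig_def by (simp only: snk_pos_def if_True sin_pi_minus)
qed

text \<open>If r + s exceeds the diameter, the reflected value 2 * \<open>dia\<close> \<kappa> - (r
  + s) has the same \<open>sig\<close>, and the perimeter bound places t below it.\<close>

lemma sig_le_of_triangle:
  assumes "0 \<le> r" "0 \<le> s" "0 \<le> t" "t \<le> r + s" "small \<kappa> (r + s + t)"
  shows "sig \<kappa> t \<le> sig \<kappa> (r + s)"
proof (cases "fits \<kappa> (r + s)")
  case True
  then show ?thesis using assms sig_le_iff[of t "r + s" \<kappa>] fitsD[OF True, of t] by auto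
next
  case False
  then have k: "\<kappa> > 0" and "r + s > dia \<kappa>" by (auto simp: fits_def)
  let ?q = "2 * dia \<kappa> - (r + s)"
  have "t \<le> ?q" using assms(5) k by (simp add: small_def)
  moreover have "fits \<kappa> ?q" using \<open>r + s > dia \<kappa>\<close> by (simp add: fits_def)
  ultimately have "sig \<kappa> t \<le> sig \<kappa> ?q"
    using sig_le_iff[of t ?q \<kappa>] assms(3) fitsD[of \<kappa> ?q t] by auto
  then show ?thesis using sig_reflect[OF k] by simp
qed

lemma comparison_angle_sig:
  "comparison_angle \<kappa> x y z = arccos
     ((sig \<kappa> (dist x y) + sig \<kappa> (dist x z) - \<kappa> * sig \<kappa> (dist x y) * sig \<kappa> (dist x z)
       - sig \<kappa> (dist y z)) / (snk \<kappa> (dist x y) * snk \<kappa> (dist x z)))"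
proof (cases "\<kappa> = 0")
  case True
  have "(a / 2 + b / 2 - c / 2) / e = (a + b - c) / (2 * e)" for a b c e :: real
    by (simp add: add_divide_distrib diff_divide_distrib)
  then show ?thesis using True
    by (simp add: comparison_angle_def sig_zero_curv snk_zero_def mult.assoc)
next
  case False
  have "csk \<kappa> (dist y z) - csk \<kappa> (dist x y) * csk \<kappa> (dist x z) =
    \<kappa> * (sig \<kappa> (dist x y) + sig \<kappa> (dist x z) - \<kappa> * sig \<kappa> (dist x y) * sig \<kappa> (dist x z)
       - sig \<kappa> (dist y z))"
    by (simp add: csk_sig algebra_simps)
  then show ?thesis using False by (simp add: comparison_angle_def mult.assoc)
qed

section \<open>The model surface\<close>

text \<open>The Euclidean form for \<kappa> > 0 and the Lorentz form for \<kappa> < 0. For \<kappa>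
  = 0 the factor \<open>sgn\<close> removes the third coordinate, which is constant on the plane, so
  the form of a difference is the squared Euclidean distance.\<close>

definition mform :: "real \<Rightarrow> real^3 \<Rightarrow> real^3 \<Rightarrow> real" where
  "mform \<kappa> u v = u$1 * v$1 + u$2 * v$2 + sgn \<kappa> * (u$3 * v$3)"

lemma mform_sym: "mform \<kappa> u v = mform \<kappa> v u"
  by (simp add: mform_def mult.commute)

lemma mform_add: "mform \<kappa> (u + v) w = mform \<kappa> u w + mform \<kappa> v w"
    "mform \<kappa> w (u + v) = mform \<kappa> w u + mform \<kappa> w v"
  and mform_diff: "mform \<kappa> (u - v) w = mform \<kappa> u w - mform \<kappa> v w"
    "mform \<kappa> w (u - v) = mform \<kappa> w u - mform \<kappa> w v"
  and mform_scale: "mform \<kappa> (r *\<^sub>R u) w = r * mform \<kappa> u w"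
    "mform \<kappa> w (r *\<^sub>R u) = r * mform \<kappa> w u"
  by (simp_all add: mform_def algebra_simps)

lemma model_plane_iff:
  "v \<in> model_plane \<kappa> \<longleftrightarrow>
     (if \<kappa> = 0 then v$3 = 1 else \<kappa> * mform \<kappa> v v = 1 \<and> (\<kappa> < 0 \<longrightarrow> v$3 > 0))"
  by (auto simp: model_plane_def mform_def lorentz_def inner_vec_def sum_3 field_simps)

lemma model_plane_form: "v \<in> model_plane \<kappa> \<Longrightarrow> \<kappa> \<noteq> 0 \<Longrightarrow> mform \<kappa> v v = 1 / \<kappa>"
  by (simp add: model_plane_iff field_simps)

text \<open>Reversed Cauchy-Schwarz inequality on the upper sheet. A Lagrange identity writes the
  defect as a sum of nonnegative terms, which also settles the case of equality.\<close>

lemma hyperbolic_form: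
  assumes "\<kappa> < 0" "u \<in> model_plane \<kappa>" "v \<in> model_plane \<kappa>"
  shows "\<kappa> * mform \<kappa> u v \<ge> 1" "\<kappa> * mform \<kappa> u v = 1 \<Longrightarrow> u = v"
proof -
  define c where "c = - 1 / \<kappa>"
  have c: "c > 0" using assms(1) by (simp add: c_def field_simps)
  have u: "(u$3)\<^sup>2 = c + (u$1)\<^sup>2 + (u$2)\<^sup>2" "u$3 > 0"
    and v: "(v$3)\<^sup>2 = c + (v$1)\<^sup>2 + (v$2)\<^sup>2" "v$3 > 0"
    using assms by (auto simp: model_plane_iff mform_def c_def power2_eq_square field_simps)
  let ?i = "u$1 * v$1 + u$2 * v$2"
  have id: "(u$3 * v$3)\<^sup>2 - (?i + c)\<^sup>2 =
    (u$1 * v$2 - u$2 * v$1)\<^sup>2 + c * ((u$1 - v$1)\<^sup>2 + (u$2 - v$2)\<^sup>2)"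
    unfolding power_mult_distrib u(1) v(1) by (simp add: power2_eq_square algebra_simps)
  have nn: "0 \<le> c * ((u$1 - v$1)\<^sup>2 + (u$2 - v$2)\<^sup>2)" using c by simp
  have "(?i + c)\<^sup>2 \<le> (u$3 * v$3)\<^sup>2" using id nn by (smt (verit) zero_le_power2)
  then have "?i + c \<le> u$3 * v$3"
    by (rule power2_le_imp_le) (use u v in simp)
  moreover have f: "\<kappa> * mform \<kappa> u v = (u$3 * v$3 - ?i) / c"
    using assms(1) by (simp add: mform_def c_def field_simps)
  moreover have "(u$3 * v$3 - ?i) / c \<ge> 1 \<longleftrightarrow> ?i + c \<le> u$3 * v$3" using c by (simp add: field_simps)
  ultimately show "\<kappa> * mform \<kappa> u v \<ge> 1" using c by simp
  assume "\<kappa> * mform \<kappa> u v = 1"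
  then have "u$3 * v$3 = ?i + c" using f c by (simp add: field_simps)
  then have "(u$1 * v$2 - u$2 * v$1)\<^sup>2 + c * ((u$1 - v$1)\<^sup>2 + (u$2 - v$2)\<^sup>2) = 0"
    using id by simp
  then have "c * ((u$1 - v$1)\<^sup>2 + (u$2 - v$2)\<^sup>2) = 0"
    using nn by (smt (verit) zero_le_power2)
  then have e: "u$1 = v$1" "u$2 = v$2" using c by (auto simp: sum_power2_eq_zero_iff)
  then have "u$3 = v$3" using u v by (metis less_imp_le power2_eq_iff_nonneg)
  then show "u = v" using e by (simp add: vec_eq_iff forall_3)
qed

lemma
  assumes "u \<in> model_plane \<kappa>" "v \<in> model_plane \<kappa>"
  shows model_dist_nonneg: "model_dist \<kappa> u v \<ge> 0"
    and model_dist_fits: "fits \<kappa> (model_dist \<kappa> u v)"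
    and sig_model_dist: "sig \<kappa> (model_dist \<kappa> u v) = mform \<kappa> (u - v) (u - v) / 2"
proof -
  have *: "model_dist \<kappa> u v \<ge> 0 \<and> fits \<kappa> (model_dist \<kappa> u v) \<and>
    sig \<kappa> (model_dist \<kappa> u v) = mform \<kappa> (u - v) (u - v) / 2"
  proof (cases "\<kappa> = 0")
    case True
    have "(dist u v)\<^sup>2 = mform 0 (u - v) (u - v)"
      using assms True by (simp add: dist_norm power2_norm_eq_inner inner_vec_def sum_3 mform_def
        model_plane_iff)
    then show ?thesis using True by (simp add: model_dist_def fits_def sig_zero_curv)
  next
    case False
    have s: "sig \<kappa> d = mform \<kappa> (u - v) (u - v) / 2" if "csk \<kappa> d = \<kappa> * mform \<kappa> u v" for d
    proof -
      have "mform \<kappa> (u - v) (u - v) = 2 / \<kappa> - 2 * mform \<kappa> u v"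
        using assms[THEN model_plane_form, OF False] mform_sym[of \<kappa> u v] by (simp add: mform_diff)
      then have "\<kappa> * mform \<kappa> (u - v) (u - v) = 2 - 2 * (\<kappa> * mform \<kappa> u v)"
        using False by (simp add: field_simps)
      then have "\<kappa> * mform \<kappa> (u - v) (u - v) = \<kappa> * (2 * sig \<kappa> d)"
        using that by (simp add: csk_sig)
      then show ?thesis using False by simp
    qed
    show ?thesis
    proof (cases "\<kappa> > 0")
      case True
      have i: "mform \<kappa> u v = u \<bullet> v" for u v
        using True by (simp add: mform_def inner_vec_def sum_3)
      have n: "norm u = 1 / sqrt \<kappa>" "norm v = 1 / sqrt \<kappa>"
        using assms True by (auto simp: norm_eq_sqrt_inner model_plane_def real_sqrt_divide)
      have "\<bar>u \<bullet> v\<bar> \<le> 1 / \<kappa>"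
        using Cauchy_Schwarz_ineq2[of u v] True unfolding n by simp
      then have b: "\<bar>\<kappa> * (u \<bullet> v)\<bar> \<le> 1" using True by (simp add: abs_mult field_simps)
      then have "csk \<kappa> (model_dist \<kappa> u v) = \<kappa> * mform \<kappa> u v"
        using True by (simp add: csk_pos model_dist_def i cos_arccos_abs)
      moreover have "0 \<le> arccos (\<kappa> * (u \<bullet> v))" "arccos (\<kappa> * (u \<bullet> v)) \<le> pi"
        using b by (auto intro: arccos_lbound arccos_ubound)
      ultimately show ?thesis using True s
        by (auto simp: model_dist_def fits_def dia_def divide_right_mono)
    next
      case neg: False
      then have "\<kappa> < 0" using False by simp
      have i: "mform \<kappa> u v = lorentz u v" using \<open>\<kappa> < 0\<close> by (simp add: mform_def lorentz_def)
      have b: "\<kappa> * lorentz u v \<ge> 1" using hyperbolic_form(1)[OF \<open>\<kappa> < 0\<close> assms] by (simp add: i)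
      then have "csk \<kappa> (model_dist \<kappa> u v) = \<kappa> * mform \<kappa> u v"
        using \<open>\<kappa> < 0\<close> by (simp add: csk_neg model_dist_def i)
      then show ?thesis using neg \<open>\<kappa> < 0\<close> s b
        by (auto simp: model_dist_def fits_def)
    qed
  qed
  then show "model_dist \<kappa> u v \<ge> 0" "fits \<kappa> (model_dist \<kappa> u v)"
    "sig \<kappa> (model_dist \<kappa> u v) = mform \<kappa> (u - v) (u - v) / 2" by auto
qed

lemma model_dist_unique:
  assumes "u \<in> model_plane \<kappa>" "v \<in> model_plane \<kappa>" "0 \<le> d" "fits \<kappa> d"
    "sig \<kappa> d = mform \<kappa> (u - v) (u - v) / 2"
  shows "model_dist \<kappa> u v = d"
  using assms sig_eq_iff[of "model_dist \<kappa> u v" d \<kappa>]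
  by (simp add: sig_model_dist model_dist_nonneg model_dist_fits)

lemma model_dist_sym: "model_dist \<kappa> u v = model_dist \<kappa> v u"
proof -
  have "lorentz u v = lorentz v u" by (simp add: lorentz_def mult.commute)
  then show ?thesis by (simp add: model_dist_def inner_commute dist_commute)
qed

lemma model_dist_eq_0:
  assumes "u \<in> model_plane \<kappa>" "v \<in> model_plane \<kappa>"
  shows "model_dist \<kappa> u v = 0 \<longleftrightarrow> u = v"
proof
  assume "u = v"
  then show "model_dist \<kappa> u v = 0"
    using assms by (intro model_dist_unique) (auto simp: fits_def dia_def mform_def)
next
  assume "model_dist \<kappa> u v = 0"
  then have 0: "mform \<kappa> (u - v) (u - v) = 0" using sig_model_dist[OF assms] by simp
  show "u = v"
  proof (cases "\<kappa> < 0")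
    case True
    then have "\<kappa> * mform \<kappa> u v = 1"
      using 0 assms[THEN model_plane_form] mform_sym[of \<kappa> u v] by (simp add: mform_diff field_simps)
    then show ?thesis using hyperbolic_form(2)[OF True assms] by simp
  next
    case False
    then have "(u$1 - v$1)\<^sup>2 + (u$2 - v$2)\<^sup>2 + sgn \<kappa> * (u$3 - v$3)\<^sup>2 = 0"
      using 0 by (simp add: mform_def power2_eq_square)
    moreover have "0 \<le> sgn \<kappa> * (u$3 - v$3)\<^sup>2" using False by (simp add: sgn_if)
    ultimately have "(u$1 - v$1)\<^sup>2 = 0" "(u$2 - v$2)\<^sup>2 = 0" "sgn \<kappa> * (u$3 - v$3)\<^sup>2 = 0"
      by (smt (verit) zero_le_power2)+
    then show ?thesis using assms False
      by (auto simp: vec_eq_iff forall_3 model_plane_iff sgn_if split: if_splits)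
  qed
qed

lemma sig_model_dist_mform:
  assumes "u \<in> model_plane \<kappa>" "v \<in> model_plane \<kappa>"
  shows "\<kappa> * mform \<kappa> u v = (if \<kappa> = 0 then 0 else csk \<kappa> (model_dist \<kappa> u v))"
  using assms[THEN model_plane_form] mform_sym[of \<kappa> u v]
  by (simp add: csk_sig sig_model_dist[OF assms] mform_diff field_simps)

subsection \<open>Geodesics\<close>

text \<open>Spherical linear interpolation with its hyperbolic and affine counterparts. For t
  outside the interval from 0 to L the formula prolongs the geodesic.\<close>

definition geod :: "real \<Rightarrow> real^3 \<Rightarrow> real^3 \<Rightarrow> real \<Rightarrow> real^3" where
  "geod \<kappa> a b t = (let L = model_dist \<kappa> a b in
     (snk \<kappa> (L - t) / snk \<kappa> L) *\<^sub>R a + (snk \<kappa> t / snk \<kappa> L) *\<^sub>R b)"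

text \<open>With a + b = L this says that the interpolated vector of \<open>geod\<close> satisfies
  the equation of the surface.\<close>

lemma snk_add_square:
  "(snk \<kappa> (a + b))\<^sup>2 = (snk \<kappa> a)\<^sup>2 + (snk \<kappa> b)\<^sup>2 + 2 * snk \<kappa> a * snk \<kappa> b * csk \<kappa> (a + b)"
proof -
  have "(csk \<kappa> a)\<^sup>2 = 1 - \<kappa> * (snk \<kappa> a)\<^sup>2" "(csk \<kappa> b)\<^sup>2 = 1 - \<kappa> * (snk \<kappa> b)\<^sup>2"
    unfolding csk_sig snk_square by algebra+
  then show ?thesis unfolding snk_add csk_add by algebra
qed

text \<open>The weights of \<open>geod\<close> do not add up to 1. Their discrepancy produces the
  constant terms of Stewart's equality.\<close>

lemma snk_sum_sig: "\<kappa> * (snk \<kappa> b * sig \<kappa> a + snk \<kappa> a * sig \<kappa> b) = snk \<kappa> a + snk \<kappa> b - snk \<kappa> (a + b)"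
  unfolding snk_add csk_sig by algebra

context
  fixes \<kappa> a b L
  assumes ab: "a \<in> model_plane \<kappa>" "b \<in> model_plane \<kappa>"
    and L: "L = model_dist \<kappa> a b" "0 < L" "short \<kappa> L"
begin

lemma snk_L: "snk \<kappa> L > 0" using L snk_pos by auto

lemma geod_eq: "geod \<kappa> a b t = (snk \<kappa> (L - t) / snk \<kappa> L) *\<^sub>R a + (snk \<kappa> t / snk \<kappa> L) *\<^sub>R b"
  by (simp add: geod_def L(1) Let_def)

lemma geod_in: "geod \<kappa> a b t \<in> model_plane \<kappa>"
proof (cases "\<kappa> = 0")
  case True
  then show ?thesis using ab L(2) unfolding geod_eq
    by (simp add: model_plane_iff snk_zero_def field_simps)
next
  case False
  let ?v = "geod \<kappa> a b t"
  let ?p = "snk \<kappa> (L - t)" and ?q = "snk \<kappa> t"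
  have "snk \<kappa> L *\<^sub>R ?v = ?p *\<^sub>R a + ?q *\<^sub>R b"
    using snk_L by (simp add: geod_eq scaleR_add_right)
  then have "(snk \<kappa> L)\<^sup>2 * mform \<kappa> ?v ?v = mform \<kappa> (?p *\<^sub>R a + ?q *\<^sub>R b) (?p *\<^sub>R a + ?q *\<^sub>R b)"
    by (metis mform_scale power2_eq_square mult.assoc)
  also have "\<kappa> * \<dots> = ?p\<^sup>2 * (\<kappa> * mform \<kappa> a a) + ?q\<^sup>2 * (\<kappa> * mform \<kappa> b b) + 2 * ?p * ?q * (\<kappa> * mform \<kappa> a b)"
    using mform_sym[of \<kappa> a b] by (simp add: mform_add mform_scale power2_eq_square algebra_simps)
  also have "\<dots> = (snk \<kappa> L)\<^sup>2"
    using False ab snk_add_square[of \<kappa> "L - t" t]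
    by (simp add: sig_model_dist_mform L model_plane_iff)
  finally have "(snk \<kappa> L)\<^sup>2 * (\<kappa> * mform \<kappa> ?v ?v) = (snk \<kappa> L)\<^sup>2 * 1" by (simp add: algebra_simps)
  then have 1: "\<kappa> * mform \<kappa> ?v ?v = 1" using snk_L by (simp only: mult_cancel_left) auto
  \<comment> \<open>The quadratic equation alone would allow the lower sheet. Then -v would be on
    the upper sheet and \<kappa> times its form with a at least 1, whereas for v itself this number
    is a value of cosh.\<close>
  have "?v$3 > 0" if "\<kappa> < 0"
  proof (rule ccontr)
    assume "\<not> ?v$3 > 0"
    moreover have "?v$3 \<noteq> 0"
    proof
      assume "?v$3 = 0"
      then have "mform \<kappa> ?v ?v \<ge> 0" by (simp add: mform_def)
      then show False using 1 that by (smt (verit) mult_nonpos_nonneg)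
    qed
    ultimately have "-?v \<in> model_plane \<kappa>" using 1 that by (simp add: model_plane_iff mform_def)
    then have "\<kappa> * mform \<kappa> a (-?v) \<ge> 1" "\<kappa> * mform \<kappa> b (-?v) \<ge> 1"
      using hyperbolic_form(1)[OF that] ab by blast+
    then have neg: "\<kappa> * mform \<kappa> a ?v \<le> -1" by (simp add: mform_def algebra_simps)
    have "\<kappa> * (snk \<kappa> L * mform \<kappa> a ?v) = ?p * (\<kappa> * mform \<kappa> a a) + ?q * (\<kappa> * mform \<kappa> a b)"
      using snk_L by (simp add: geod_eq mform_add mform_scale field_simps)
    also have "\<dots> = ?p + ?q * csk \<kappa> L"
      using False ab by (simp add: sig_model_dist_mform L model_plane_iff)
    also have "\<dots> = snk \<kappa> L * csk \<kappa> t"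
    proof -
      have *: "snk \<kappa> (L - t) = snk \<kappa> L * csk \<kappa> t - csk \<kappa> L * snk \<kappa> t"
        using snk_add[of \<kappa> L "-t"] by simp
      show ?thesis unfolding * by (simp add: algebra_simps)
    qed
    finally have "\<kappa> * mform \<kappa> a ?v = csk \<kappa> t" using snk_L by simp
    also have "\<dots> > 0" using that by (simp add: csk_neg)
    finally show False using neg by simp
  qed
  then show ?thesis using 1 False by (simp add: model_plane_iff)
qed

text \<open>For \<kappa> \<noteq> 0, \<open>sig\<close> of the distance to c is 1/\<kappa> minus the
  form with c, hence affine in the point, and \<open>geod\<close> is a linear combination of a and
  b. For \<kappa> = 0 the squared distance is expanded as in the classical theorem.\<close>

lemma geod_stewart:
  assumes c: "c \<in> model_plane \<kappa>"
  shows "snk \<kappa> L * sig \<kappa> (model_dist \<kappa> c (geod \<kappa> a b t)) =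
    snk \<kappa> (L - t) * (sig \<kappa> (model_dist \<kappa> c a) - sig \<kappa> t) +
    snk \<kappa> t * (sig \<kappa> (model_dist \<kappa> c b) - sig \<kappa> (L - t))"
proof (cases "\<kappa> = 0")
  case False
  let ?v = "geod \<kappa> a b t"
  let ?f = "\<lambda>u. mform \<kappa> c u"
  have s: "sig \<kappa> (model_dist \<kappa> c u) = 1 / \<kappa> - ?f u" if "u \<in> model_plane \<kappa>" for u
    using that c model_plane_form[OF c False] model_plane_form[OF that False] mform_sym[of \<kappa> c u]
    by (simp add: sig_model_dist mform_diff field_simps)
  have f: "snk \<kappa> L * ?f ?v = snk \<kappa> (L - t) * ?f a + snk \<kappa> t * ?f b"
    using snk_L by (simp add: geod_eq mform_add mform_scale field_simps)
  have e: "snk \<kappa> t * sig \<kappa> (L - t) + snk \<kappa> (L - t) * sig \<kappa> t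
      = (snk \<kappa> (L - t) + snk \<kappa> t - snk \<kappa> L) / \<kappa>"
    using snk_sum_sig[of \<kappa> t "L - t"] False by (simp add: field_simps)
  show ?thesis unfolding s[OF geod_in] s[OF ab(1)] s[OF ab(2)]
    using f e by (simp add: algebra_simps add_divide_distrib diff_divide_distrib)
next
  case True
  let ?v = "geod \<kappa> a b t"
  have ab2: "L\<^sup>2 = mform 0 (a - b) (a - b)"
    using sig_model_dist[OF ab] True by (simp add: sig_zero_curv L)
  have v: "L *\<^sub>R ?v = (L - t) *\<^sub>R a + t *\<^sub>R b"
    using L(2) unfolding geod_eq unfolding True by (simp add: snk_zero_def scaleR_add_right)
  have "L\<^sup>2 * mform 0 (c - ?v) (c - ?v) =
      mform 0 ((L - t) *\<^sub>R (c - a) + t *\<^sub>R (c - b)) ((L - t) *\<^sub>R (c - a) + t *\<^sub>R (c - b))"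
  proof -
    have "L *\<^sub>R (c - ?v) = (L - t) *\<^sub>R (c - a) + t *\<^sub>R (c - b)"
      using v by (simp add: algebra_simps)
    then show ?thesis by (metis mform_scale power2_eq_square mult.assoc)
  qed
  also have "\<dots> = L * (L - t) * mform 0 (c - a) (c - a) + L * t * mform 0 (c - b) (c - b)
      - (L - t) * t * mform 0 (a - b) (a - b)"
    by (simp add: mform_def) algebra
  finally have "L * (L * mform 0 (c - ?v) (c - ?v)) =
      L * ((L - t) * mform 0 (c - a) (c - a) + t * mform 0 (c - b) (c - b) - (L - t) * t * L)"
    unfolding ab2[symmetric] by (simp add: power2_eq_square algebra_simps)
  then have e: "L * mform 0 (c - ?v) (c - ?v) =
      (L - t) * mform 0 (c - a) (c - a) + t * mform 0 (c - b) (c - b) - (L - t) * t * L"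
    using L by simp
  show ?thesis using e sig_model_dist[OF c geod_in] sig_model_dist[OF c ab(1)] sig_model_dist[OF c ab(2)]
    unfolding True by (simp add: snk_zero_def sig_zero_curv power2_eq_square field_simps)
qed

lemma geod_dist_left:
  assumes "fits \<kappa> \<bar>t\<bar>" shows "model_dist \<kappa> a (geod \<kappa> a b t) = \<bar>t\<bar>"
proof -
  have "snk \<kappa> L * sig \<kappa> (model_dist \<kappa> a (geod \<kappa> a b t)) = snk \<kappa> L * sig \<kappa> t"
    using geod_stewart[OF ab(1), of t] snk_sig_add[of \<kappa> t "L - t"] model_dist_eq_0[OF ab(1) ab(1)] L(1)
    by (simp add: algebra_simps)
  then have "sig \<kappa> (model_dist \<kappa> a (geod \<kappa> a b t)) = sig \<kappa> \<bar>t\<bar>" using snk_L by simp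
  then show ?thesis using assms sig_eq_iff model_dist_fits[OF ab(1) geod_in]
      model_dist_nonneg[OF ab(1) geod_in] abs_ge_zero by blast
qed

lemma geod_dist_right:
  assumes "fits \<kappa> \<bar>L - t\<bar>" shows "model_dist \<kappa> (geod \<kappa> a b t) b = \<bar>L - t\<bar>"
proof -
  have "snk \<kappa> L * sig \<kappa> (model_dist \<kappa> b (geod \<kappa> a b t)) = snk \<kappa> L * sig \<kappa> (L - t)"
    using geod_stewart[OF ab(2), of t] snk_sig_add[of \<kappa> "L - t" t] model_dist_eq_0[OF ab(2) ab(2)]
      L(1) model_dist_sym[of \<kappa> a b]
    by (simp add: algebra_simps)
  then have "sig \<kappa> (model_dist \<kappa> b (geod \<kappa> a b t)) = sig \<kappa> \<bar>L - t\<bar>" using snk_L by simp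
  then show ?thesis using assms sig_eq_iff model_dist_fits[OF ab(2) geod_in]
      model_dist_nonneg[OF ab(2) geod_in] abs_ge_zero model_dist_sym by metis
qed

end

abbreviation seg :: "real \<Rightarrow> real^3 \<Rightarrow> real^3 \<Rightarrow> (real^3) set" where
  "seg \<kappa> a b \<equiv> between_closed (model_plane \<kappa>) (model_dist \<kappa>) a b"

lemma model_dist_self [simp]: "a \<in> model_plane \<kappa> \<Longrightarrow> model_dist \<kappa> a a = 0"
  by (simp add: model_dist_eq_0)

lemma model_dist_pos: "a \<in> model_plane \<kappa> \<Longrightarrow> b \<in> model_plane \<kappa> \<Longrightarrow> a \<noteq> b \<Longrightarrow> 0 < model_dist \<kappa> a b"
  using model_dist_eq_0[of a \<kappa> b] model_dist_nonneg[of a \<kappa> b] by fastforce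

text \<open>Stewart's identity for the point at distance \<open>d(u, b)\<close> beyond \<open>u\<close> on the geodesic from \<open>a\<close>
  through \<open>u\<close> expresses the defect of the triangle inequality as a nonnegative quantity.\<close>

lemma model_dist_triangle:
  assumes "a \<in> model_plane \<kappa>" "u \<in> model_plane \<kappa>" "b \<in> model_plane \<kappa>"
  shows "model_dist \<kappa> a b \<le> model_dist \<kappa> a u + model_dist \<kappa> u b"
proof -
  let ?\<alpha> = "model_dist \<kappa> a u" and ?\<beta> = "model_dist \<kappa> u b"
  consider "?\<alpha> = 0" | "?\<beta> = 0" | "\<not> short \<kappa> (?\<alpha> + ?\<beta>)" | "0 < ?\<alpha>" "0 < ?\<beta>" "short \<kappa> (?\<alpha> + ?\<beta>)"
    using model_dist_nonneg[OF assms(1,2)] model_dist_nonneg[OF assms(2,3)] by linarith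
  then show ?thesis
  proof cases
    case 3
    then show ?thesis using model_dist_fits[OF assms(1,3)] by (auto simp: short_def fits_def)
  next
    case 4
    have L: "short \<kappa> ?\<alpha>" using shortD[OF 4(3)] 4 by simp
    have b: "short \<kappa> ?\<beta>" using shortD[OF 4(3)] 4 by simp
    have "snk \<kappa> ?\<alpha> * sig \<kappa> (model_dist \<kappa> b (geod \<kappa> a u (?\<alpha> + ?\<beta>))) =
      snk \<kappa> ?\<beta> * (sig \<kappa> (?\<alpha> + ?\<beta>) - sig \<kappa> (model_dist \<kappa> a b))"
      using geod_stewart[OF assms(1,2) refl 4(1) L assms(3), of "?\<alpha> + ?\<beta>"]
      by (simp add: model_dist_sym[of \<kappa> b] algebra_simps)
    moreover have "0 \<le> snk \<kappa> ?\<alpha> * sig \<kappa> (model_dist \<kappa> b (geod \<kappa> a u (?\<alpha> + ?\<beta>)))"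
      using snk_pos[OF 4(1) L] by simp
    ultimately have "sig \<kappa> (model_dist \<kappa> a b) \<le> sig \<kappa> (?\<alpha> + ?\<beta>)"
      using snk_pos[OF 4(2) b] by (simp add: zero_le_mult_iff)
    then show ?thesis
      using sig_le_iff[of "model_dist \<kappa> a b" "?\<alpha> + ?\<beta>" \<kappa>] 4 short_fits[OF 4(3)]
        model_dist_fits[OF assms(1,3)] model_dist_nonneg[OF assms(1,3)] by auto
  qed (use assms in \<open>auto simp: model_dist_eq_0\<close>)
qed

lemma geod_0 [simp]: "a \<in> model_plane \<kappa> \<Longrightarrow> b \<in> model_plane \<kappa> \<Longrightarrow> a \<noteq> b \<Longrightarrow>
    short \<kappa> (model_dist \<kappa> a b) \<Longrightarrow> geod \<kappa> a b 0 = a"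
  and geod_end [simp]: "a \<in> model_plane \<kappa> \<Longrightarrow> b \<in> model_plane \<kappa> \<Longrightarrow> a \<noteq> b \<Longrightarrow>
    short \<kappa> (model_dist \<kappa> a b) \<Longrightarrow> geod \<kappa> a b (model_dist \<kappa> a b) = b"
  using snk_pos[of "model_dist \<kappa> a b" \<kappa>] model_dist_pos[of a \<kappa> b]
  by (auto simp: geod_def)

lemma seg_iff: "u \<in> seg \<kappa> a b \<longleftrightarrow>
    u \<in> model_plane \<kappa> \<and> model_dist \<kappa> a b = model_dist \<kappa> a u + model_dist \<kappa> u b"
  by (auto simp: between_closed_def)

lemma seg_sym: "seg \<kappa> a b = seg \<kappa> b a"
  by (auto simp: seg_iff model_dist_sym)

context
  fixes \<kappa> a b L
  assumes ab: "a \<in> model_plane \<kappa>" "b \<in> model_plane \<kappa>"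
    and L: "L = model_dist \<kappa> a b" "0 < L" "short \<kappa> L"
begin

text \<open>In Stewart's equality with third point u at the parameter d(a, u) both brackets vanish,
  so u has distance zero from the interpolated point.\<close>

lemma seg_geod:
  assumes "u \<in> seg \<kappa> a b"
  shows "u = geod \<kappa> a b (model_dist \<kappa> a u)"
proof -
  let ?t = "model_dist \<kappa> a u"
  have u: "u \<in> model_plane \<kappa>" "L = ?t + model_dist \<kappa> u b" using assms L by (auto simp: seg_iff)
  have "snk \<kappa> L * sig \<kappa> (model_dist \<kappa> u (geod \<kappa> a b ?t)) = 0"
    using geod_stewart[OF ab L u(1), of ?t] u(2) by (simp add: model_dist_sym[of \<kappa> u a])
  then have "sig \<kappa> (model_dist \<kappa> u (geod \<kappa> a b ?t)) = 0"
    using snk_pos[OF L(2,3)] by simp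
  then have "model_dist \<kappa> u (geod \<kappa> a b ?t) = 0"
    using sig_pos[of "model_dist \<kappa> u (geod \<kappa> a b ?t)" \<kappa>] model_dist_nonneg[OF u(1) geod_in[OF ab L], of ?t]
      model_dist_fits[OF u(1) geod_in[OF ab L], of ?t] by fastforce
  then show ?thesis using model_dist_eq_0[OF u(1) geod_in[OF ab L]] by simp
qed

lemma geod_seg:
  assumes "0 \<le> t" "t \<le> L"
  shows "geod \<kappa> a b t \<in> seg \<kappa> a b" "model_dist \<kappa> a (geod \<kappa> a b t) = t"
    "model_dist \<kappa> (geod \<kappa> a b t) b = L - t"
proof -
  show 1: "model_dist \<kappa> a (geod \<kappa> a b t) = t"
    using geod_dist_left[OF ab L, of t] short_fits[OF L(3)] assms by simp
  show 2: "model_dist \<kappa> (geod \<kappa> a b t) b = L - t"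
    using geod_dist_right[OF ab L, of t] short_fits[OF L(3)] assms by simp
  show "geod \<kappa> a b t \<in> seg \<kappa> a b" using 1 2 geod_in[OF ab L] by (simp add: seg_iff L(1)[symmetric])
qed

lemma geod_dist:
  assumes "0 \<le> t" "t \<le> L" "0 \<le> s" "s \<le> L"
  shows "model_dist \<kappa> (geod \<kappa> a b s) (geod \<kappa> a b t) = \<bar>s - t\<bar>"
proof -
  let ?u = "geod \<kappa> a b s" and ?v = "geod \<kappa> a b t"
  have uv: "?u \<in> model_plane \<kappa>" "?v \<in> model_plane \<kappa>" using geod_in[OF ab L] by auto
  \<comment> \<open>The right side of Stewart's equality when the third point lies on the same
    geodesic, at signed distance z from the point with parameter x.\<close>
  have id: "snk \<kappa> (x + y) * sig \<kappa> z =
    snk \<kappa> y * (sig \<kappa> (x + z) - sig \<kappa> x) + snk \<kappa> x * (sig \<kappa> (y - z) - sig \<kappa> y)" for x y z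
  proof -
    have "sig \<kappa> (y - z) = sig \<kappa> y + sig \<kappa> z - \<kappa> * sig \<kappa> y * sig \<kappa> z - snk \<kappa> y * snk \<kappa> z"
      using sig_add[of \<kappa> y "-z"] by simp
    then show ?thesis unfolding sig_add[of \<kappa> x z] snk_add csk_sig by algebra
  qed
  have "snk \<kappa> L * sig \<kappa> (model_dist \<kappa> ?u ?v) = snk \<kappa> L * sig \<kappa> (s - t)"
    using geod_stewart[OF ab L uv(1), of t] id[of t "L - t" "s - t"]
      geod_seg[OF assms(1,2)] geod_seg[OF assms(3,4)]
    by (simp add: model_dist_sym[of \<kappa> _ a])
  then have "sig \<kappa> (model_dist \<kappa> ?u ?v) = sig \<kappa> \<bar>s - t\<bar>"
    using snk_pos[OF L(2,3)] by simp
  moreover have "fits \<kappa> \<bar>s - t\<bar>" by (rule short_fits[OF L(3)]) (use assms in auto)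
  ultimately show ?thesis
    using sig_eq_iff model_dist_fits[OF uv] model_dist_nonneg[OF uv] abs_ge_zero by blast
qed

lemma seg_coeffs:
  assumes "u \<in> seg \<kappa> a b"
  obtains l m where "0 \<le> l" "0 \<le> m" "u = l *\<^sub>R a + m *\<^sub>R b"
    "u \<noteq> a \<Longrightarrow> u \<noteq> b \<Longrightarrow> 0 < l \<and> 0 < m"
proof -
  let ?t = "model_dist \<kappa> a u"
  have u: "u \<in> model_plane \<kappa>" "L = ?t + model_dist \<kappa> u b" using assms L by (auto simp: seg_iff)
  have t: "0 \<le> ?t" "?t \<le> L"
    using u ab model_dist_nonneg[of a \<kappa> u] model_dist_nonneg[of u \<kappa> b] by auto
  have S: "snk \<kappa> L > 0" by (rule snk_pos[OF L(2,3)])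
  show ?thesis
  proof (rule that[of "snk \<kappa> (L - ?t) / snk \<kappa> L" "snk \<kappa> ?t / snk \<kappa> L"])
    show "u = (snk \<kappa> (L - ?t) / snk \<kappa> L) *\<^sub>R a + (snk \<kappa> ?t / snk \<kappa> L) *\<^sub>R b"
      using seg_geod[OF assms] geod_eq[OF ab L] by metis
    show "0 \<le> snk \<kappa> (L - ?t) / snk \<kappa> L" "0 \<le> snk \<kappa> ?t / snk \<kappa> L"
      using S t snk_nonneg[of "L - ?t" \<kappa>] snk_nonneg[of ?t \<kappa>] short_fits[OF L(3)] by auto
    assume "u \<noteq> a" "u \<noteq> b"
    then have "0 < ?t" "?t < L" using u ab model_dist_pos[of a \<kappa> u] model_dist_pos[of u \<kappa> b] by auto
    then show "0 < snk \<kappa> (L - ?t) / snk \<kappa> L \<and> 0 < snk \<kappa> ?t / snk \<kappa> L"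
      using S snk_pos[of "L - ?t" \<kappa>] snk_pos[of ?t \<kappa>] shortD[OF L(3)] by auto
  qed
qed

end

lemma zero_notin_model: "0 \<notin> model_plane \<kappa>"
  by (simp add: model_plane_iff mform_def)

text \<open>Allows points of the surface to be computed up to a positive factor, as in homogeneous
  coordinates.\<close>

lemma model_plane_proportional:
  assumes "v \<in> model_plane \<kappa>" "r *\<^sub>R v \<in> model_plane \<kappa>" "0 < r"
  shows "r = 1"
proof (cases "\<kappa> = 0")
  case False
  then have v: "\<kappa> * (r * (r * mform \<kappa> v v)) = 1" "\<kappa> * mform \<kappa> v v = 1"
    using assms by (auto simp: model_plane_iff mform_scale)
  have "r\<^sup>2 * (\<kappa> * mform \<kappa> v v) = 1" using v(1) by (simp add: power2_eq_square algebra_simps)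
  then have "r\<^sup>2 = 1" unfolding v(2) by simp
  then show ?thesis using assms(3) by (simp add: power2_eq_1_iff)
qed (use assms in \<open>auto simp: model_plane_iff\<close>)

text \<open>The intermediate value theorem finds the parameter at which the two weights of
  \<open>geod\<close> are in the ratio l : m. Then v is a positive multiple of that point, hence
  equal to it.\<close>

lemma coeffs_seg:
  assumes ab: "a \<in> model_plane \<kappa>" "b \<in> model_plane \<kappa>" "short \<kappa> (model_dist \<kappa> a b)"
    and v: "v \<in> model_plane \<kappa>" "v = l *\<^sub>R a + m *\<^sub>R b" "0 \<le> l" "0 \<le> m"
  shows "v \<in> seg \<kappa> a b"
proof (cases "a = b")
  case True
  have lm: "l + m > 0"
  proof (rule ccontr)
    assume "\<not> l + m > 0"
    then have "l = 0" "m = 0" using v(3,4) by auto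
    then have "v = 0" using v(2) by simp
    then show False using v zero_notin_model by simp
  qed
  have "v = (l + m) *\<^sub>R a" using True v by (simp add: scaleR_add_left)
  then have "v = a" using model_plane_proportional[of a \<kappa> "l + m"] ab v lm by simp
  then show ?thesis using True ab by (simp add: seg_iff)
next
  case False
  define L where "L = model_dist \<kappa> a b"
  have L: "L = model_dist \<kappa> a b" "0 < L" "short \<kappa> L"
    using False ab by (auto simp: L_def model_dist_pos)
  have S: "snk \<kappa> L > 0" by (rule snk_pos[OF L(2,3)])
  let ?f = "\<lambda>t. snk \<kappa> t * l - snk \<kappa> (L - t) * m"
  have "\<exists>t\<ge>0. t \<le> L \<and> ?f t = 0"
    by (rule IVT') (use L(2) S v in \<open>auto intro!: continuous_intros\<close>)
  then obtain t where t: "0 \<le> t" "t \<le> L" "snk \<kappa> t * l = snk \<kappa> (L - t) * m" by auto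
  have n: "0 \<le> snk \<kappa> t" "0 \<le> snk \<kappa> (L - t)"
    using t snk_nonneg[of "L - t" \<kappa>] snk_nonneg[of t \<kappa>] short_fits[OF L(3)] by auto
  have p: "snk \<kappa> t + snk \<kappa> (L - t) > 0"
  proof (cases "t = 0")
    case False
    then show ?thesis using t n snk_pos[of t \<kappa>] shortD[OF L(3)] by force
  qed (use S in simp)
  let ?D = "snk \<kappa> t + snk \<kappa> (L - t)"
  define r where "r = snk \<kappa> L * (l + m) / ?D"
  have lm: "l + m > 0"
  proof (rule ccontr)
    assume "\<not> l + m > 0"
    then have "l = 0" "m = 0" using v by auto
    then have "v = 0" using v by simp
    then show False using v zero_notin_model by simp
  qed
  have "r > 0" using S p lm by (simp add: r_def)
  have "r * (snk \<kappa> (L - t) / snk \<kappa> L) = (l + m) * snk \<kappa> (L - t) / ?D" using S by (simp add: r_def)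
  also have "\<dots> = l" using p t(3) by (simp add: field_simps)
  finally have 1: "r * (snk \<kappa> (L - t) / snk \<kappa> L) = l" .
  have "r * (snk \<kappa> t / snk \<kappa> L) = (l + m) * snk \<kappa> t / ?D" using S by (simp add: r_def)
  also have "\<dots> = m" using p t(3) by (simp add: field_simps)
  finally have "v = r *\<^sub>R geod \<kappa> a b t"
    using 1 v(2) by (simp add: geod_eq[OF ab(1,2) L] scaleR_add_right)
  then have "v = geod \<kappa> a b t"
    using model_plane_proportional[OF geod_in[OF ab(1,2) L], of r t] v(1) \<open>r > 0\<close> by simp
  then show ?thesis using geod_seg(1)[OF ab(1,2) L t(1,2)] by simp
qed

subsection \<open>Points in a common open half-space\<close>

text \<open>An open hemisphere for \<kappa> > 0. It contains no antipodal pair and contains the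
  geodesics between its points, so its distances are \<open>short\<close> and its perimeters
  \<open>small\<close>. For the other signs it keeps the treatment uniform.\<close>

definition half_plane :: "real \<Rightarrow> real^3 \<Rightarrow> (real^3) set" where
  "half_plane \<kappa> e = {v \<in> model_plane \<kappa>. e \<bullet> v > 0}"

lemma hsD: "v \<in> half_plane \<kappa> e \<Longrightarrow> v \<in> model_plane \<kappa>" "v \<in> half_plane \<kappa> e \<Longrightarrow> e \<bullet> v > 0"
  by (auto simp: half_plane_def)

lemma normalize_pos:
  assumes "\<kappa> > 0" "v \<noteq> 0"
  shows "\<exists>k>0. k *\<^sub>R v \<in> model_plane \<kappa>"
proof (intro exI conjI)
  show "1 / (sqrt \<kappa> * norm v) > 0" using assms by simp
  show "(1 / (sqrt \<kappa> * norm v)) *\<^sub>R v \<in> model_plane \<kappa>"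
    using assms by (simp add: model_plane_def power2_norm_eq_inner[symmetric] power2_eq_square field_simps)
qed

text \<open>The combination is nonzero because e is positive on it. For \<kappa> < 0 the mixed term
  is nonnegative by \<open>hyperbolic_form\<close>, so the combination stays timelike and can be
  rescaled.\<close>

lemma normalize_comb:
  assumes "a \<in> half_plane \<kappa> e" "b \<in> half_plane \<kappa> e" "0 \<le> l" "0 \<le> m" "0 < l + m"
  obtains k where "k > 0" "k *\<^sub>R (l *\<^sub>R a + m *\<^sub>R b) \<in> half_plane \<kappa> e"
proof -
  let ?v = "l *\<^sub>R a + m *\<^sub>R b"
  note ab = hsD(1)[OF assms(1)] hsD(1)[OF assms(2)]
  have lm: "0 < l \<or> 0 < m" using assms by linarith
  have pos: "l * s + m * t > 0" if "s > 0" "t > 0" for s t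
    using lm assms(3,4) that by (metis add.commute add_nonneg_pos less_imp_le mult_nonneg_nonneg mult_pos_pos)
  have e: "e \<bullet> ?v > 0"
    using pos[OF hsD(2)[OF assms(1)] hsD(2)[OF assms(2)]] by (simp add: inner_add_right)
  have "\<exists>k>0. k *\<^sub>R ?v \<in> model_plane \<kappa>"
  proof (cases \<kappa> "0::real" rule: linorder_cases)
    case greater
    have "?v \<noteq> 0" using e by auto
    then show ?thesis using normalize_pos[OF greater] by blast
  next
    case equal
    then have "?v$3 = l + m" using ab by (simp add: model_plane_iff)
    then show ?thesis using equal assms by (intro exI[of _ "1 / (l + m)"]) (simp add: model_plane_iff)
  next
    case less
    have "\<kappa> * mform \<kappa> ?v ?v = l\<^sup>2 * (\<kappa> * mform \<kappa> a a) + m\<^sup>2 * (\<kappa> * mform \<kappa> b b) + 2 * l * m * (\<kappa> * mform \<kappa> a b)"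
      using mform_sym[of \<kappa> a b] by (simp add: mform_add mform_scale power2_eq_square algebra_simps)
    also have "\<dots> = l\<^sup>2 + m\<^sup>2 + 2 * l * m * (\<kappa> * mform \<kappa> a b)"
      using less ab by (simp add: model_plane_iff)
    also have "\<dots> > 0"
    proof -
      have "0 \<le> 2 * l * m * (\<kappa> * mform \<kappa> a b)"
        using hyperbolic_form(1)[OF less ab] assms by simp
      moreover have "0 < l\<^sup>2 + m\<^sup>2" using lm by (auto simp: sum_power2_gt_zero_iff)
      ultimately show ?thesis by linarith
    qed
    finally have q: "\<kappa> * mform \<kappa> ?v ?v > 0" .
    define k where "k = 1 / sqrt (\<kappa> * mform \<kappa> ?v ?v)"
    have k: "k > 0" using q by (simp add: k_def)
    have "(1 / sqrt q)\<^sup>2 * q = 1" if "q > 0" for q :: real using that by (simp add: power_divide)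
    from this[OF q] have "k\<^sup>2 * (\<kappa> * mform \<kappa> ?v ?v) = 1" by (simp only: k_def)
    then have "\<kappa> * mform \<kappa> (k *\<^sub>R ?v) (k *\<^sub>R ?v) = 1"
      by (simp only: mform_scale power2_eq_square mult.assoc mult.left_commute)
    moreover have "?v$3 > 0" using pos[of "a$3" "b$3"] less ab by (simp add: model_plane_iff)
    ultimately show ?thesis using k less by (intro exI[of _ k]) (simp add: model_plane_iff)
  qed
  then show ?thesis using that e by (auto simp: half_plane_def)
qed

lemma antipode:
  assumes "\<kappa> > 0" "b \<in> model_plane \<kappa>"
  shows "- b \<in> model_plane \<kappa>"
    and "a \<in> model_plane \<kappa> \<Longrightarrow> model_dist \<kappa> a (- b) = dia \<kappa> - model_dist \<kappa> a b"
proof -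
  show "- b \<in> model_plane \<kappa>" using assms by (simp add: model_plane_def)
  assume a: "a \<in> model_plane \<kappa>"
  have n: "norm a = 1 / sqrt \<kappa>" "norm b = 1 / sqrt \<kappa>"
    using assms a by (auto simp: norm_eq_sqrt_inner model_plane_def real_sqrt_divide)
  have "\<bar>a \<bullet> b\<bar> \<le> 1 / \<kappa>"
    using Cauchy_Schwarz_ineq2[of a b] assms unfolding n by simp
  then have "\<bar>\<kappa> * (a \<bullet> b)\<bar> \<le> 1" using assms by (simp add: abs_mult field_simps)
  then show "model_dist \<kappa> a (- b) = dia \<kappa> - model_dist \<kappa> a b"
    using assms by (simp add: model_dist_def dia_def arccos_minus diff_divide_distrib abs_le_iff)
qed

lemma short_of_not_antipodal:
  assumes "a \<in> model_plane \<kappa>" "b \<in> model_plane \<kappa>" "\<kappa> > 0 \<Longrightarrow> b \<noteq> - a"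
  shows "short \<kappa> (model_dist \<kappa> a b)"
proof (rule ccontr)
  assume "\<not> short \<kappa> (model_dist \<kappa> a b)"
  then have k: "\<kappa> > 0" and "model_dist \<kappa> a b = dia \<kappa>"
    using model_dist_fits[OF assms(1,2)] by (auto simp: short_def fits_def)
  then have "model_dist \<kappa> b (- a) = 0"
    using antipode(2)[OF k assms(1,2)] by (simp add: model_dist_sym)
  then have "b = - a" using model_dist_eq_0 assms antipode(1)[OF k] by blast
  then show False using assms(3) k by simp
qed

lemma hs_short: "a \<in> half_plane \<kappa> e \<Longrightarrow> b \<in> half_plane \<kappa> e \<Longrightarrow> short \<kappa> (model_dist \<kappa> a b)"
  by (rule short_of_not_antipodal) (auto simp: half_plane_def)

lemma seg_hs:
  assumes "a \<in> half_plane \<kappa> e" "b \<in> half_plane \<kappa> e" "u \<in> seg \<kappa> a b"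
  shows "u \<in> half_plane \<kappa> e"
proof (cases "a = b")
  case True
  have u: "u \<in> model_plane \<kappa>" "model_dist \<kappa> a u + model_dist \<kappa> u b = 0"
    using assms True hsD by (auto simp: seg_iff)
  then have "model_dist \<kappa> a u = 0"
    using model_dist_nonneg[of a \<kappa> u] model_dist_nonneg[of u \<kappa> b] hsD assms by fastforce
  then show ?thesis using model_dist_eq_0[of a \<kappa> u] u hsD(1)[OF assms(1)] assms(1) by simp
next
  case False
  note ab = hsD(1)[OF assms(1)] hsD(1)[OF assms(2)]
  obtain l m where lm: "0 \<le> l" "0 \<le> m" "u = l *\<^sub>R a + m *\<^sub>R b"
    using seg_coeffs[OF ab refl model_dist_pos[OF ab False] hs_short[OF assms(1,2)] assms(3)] by metis
  have u: "u \<in> model_plane \<kappa>" using assms by (simp add: seg_iff)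
  then have "l \<noteq> 0 \<or> m \<noteq> 0" using lm zero_notin_model by fastforce
  then have "0 < l \<or> 0 < m" using lm by linarith
  then have "e \<bullet> u > 0" unfolding lm(3) inner_add_right inner_scaleR_right
    using lm hsD(2)[OF assms(1)] hsD(2)[OF assms(2)]
    by (metis add.commute add_nonneg_pos less_imp_le mult_nonneg_nonneg mult_pos_pos)
  then show ?thesis using u by (simp add: half_plane_def)
qed

lemma hs_coeffs:
  assumes "a \<in> half_plane \<kappa> e" "b \<in> half_plane \<kappa> e" "u \<in> seg \<kappa> a b"
  obtains l m where "0 \<le> l" "0 \<le> m" "u = l *\<^sub>R a + m *\<^sub>R b" "u \<noteq> a \<Longrightarrow> u \<noteq> b \<Longrightarrow> 0 < l \<and> 0 < m"
proof (cases "a = b")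
  case True
  have u: "u \<in> model_plane \<kappa>" "model_dist \<kappa> a u + model_dist \<kappa> u b = 0"
    using assms True hsD by (auto simp: seg_iff)
  then have "model_dist \<kappa> a u = 0"
    using model_dist_nonneg[of a \<kappa> u] model_dist_nonneg[of u \<kappa> b] hsD assms by fastforce
  then have "u = a" using model_dist_eq_0[of a \<kappa> u] u hsD(1)[OF assms(1)] by simp
  then show ?thesis using that[of 1 0] by simp
next
  case False
  note ab = hsD(1)[OF assms(1)] hsD(1)[OF assms(2)]
  show ?thesis
    using seg_coeffs[OF ab refl model_dist_pos[OF ab False] hs_short[OF assms(1,2)] assms(3)] that by metis
qed

lemma hs_seg:
  assumes "a \<in> half_plane \<kappa> e" "b \<in> half_plane \<kappa> e" "v \<in> model_plane \<kappa>" "v = l *\<^sub>R a + m *\<^sub>R b" "0 \<le> l" "0 \<le> m"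
  shows "v \<in> seg \<kappa> a b"
  using coeffs_seg[OF hsD(1)[OF assms(1)] hsD(1)[OF assms(2)] hs_short[OF assms(1,2)] assms(3-6)] .

text \<open>The triangle inequality through the antipode of b bounds the perimeter by twice the
  diameter. Equality would put -b on the geodesic from a to c, inside the half-space that contains
  b.\<close>

lemma hs_small:
  assumes "a \<in> half_plane \<kappa> e" "b \<in> half_plane \<kappa> e" "c \<in> half_plane \<kappa> e"
  shows "small \<kappa> (model_dist \<kappa> a b + model_dist \<kappa> b c + model_dist \<kappa> c a)"
  unfolding small_def
proof
  assume k: "\<kappa> > 0"
  note abc = assms[THEN hsD(1)]
  note m = antipode(1)[OF k abc(2)]
  have tri: "model_dist \<kappa> a c \<le> model_dist \<kappa> a (- b) + model_dist \<kappa> (- b) c"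
    by (rule model_dist_triangle[OF abc(1) m abc(3)])
  have sum: "model_dist \<kappa> a (- b) + model_dist \<kappa> (- b) c = 2 * dia \<kappa> - model_dist \<kappa> a b - model_dist \<kappa> b c"
    using antipode(2)[OF k abc(2) abc(1)] antipode(2)[OF k abc(2) abc(3)]
    by (simp add: model_dist_sym[of \<kappa> _ c] model_dist_sym[of \<kappa> b])
  have "model_dist \<kappa> a c \<noteq> model_dist \<kappa> a (- b) + model_dist \<kappa> (- b) c"
  proof
    assume "model_dist \<kappa> a c = model_dist \<kappa> a (- b) + model_dist \<kappa> (- b) c"
    then have "- b \<in> seg \<kappa> a c" using m by (simp add: seg_iff)
    then have "- b \<in> half_plane \<kappa> e" by (rule seg_hs[OF assms(1,3)])
    then show False using assms(2) by (simp add: half_plane_def)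
  qed
  then show "model_dist \<kappa> a b + model_dist \<kappa> b c + model_dist \<kappa> c a < 2 * dia \<kappa>"
    using tri sum by (simp add: model_dist_sym[of \<kappa> c a])
qed

lemma sig_mono: "0 \<le> r \<Longrightarrow> r \<le> s \<Longrightarrow> fits \<kappa> s \<Longrightarrow> sig \<kappa> r \<le> sig \<kappa> s"
  using sig_strict_mono[of r s \<kappa>] by (cases "r = s") auto

lemma model_stewart:
  assumes ABC: "A \<in> model_plane \<kappa>" "B \<in> model_plane \<kappa>" "C \<in> model_plane \<kappa>"
    and pos: "0 < model_dist \<kappa> A B" and short: "short \<kappa> (model_dist \<kappa> A B)"
    and U: "U \<in> seg \<kappa> A B"
  shows "snk \<kappa> (model_dist \<kappa> A B) * sig \<kappa> (model_dist \<kappa> U C) =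
    snk \<kappa> (model_dist \<kappa> U B) * (sig \<kappa> (model_dist \<kappa> A C) - sig \<kappa> (model_dist \<kappa> A U)) +
    snk \<kappa> (model_dist \<kappa> A U) * (sig \<kappa> (model_dist \<kappa> B C) - sig \<kappa> (model_dist \<kappa> U B))"
proof -
  have "model_dist \<kappa> A B - model_dist \<kappa> A U = model_dist \<kappa> U B" using U by (simp add: seg_iff)
  then show ?thesis
    using geod_stewart[OF ABC(1,2) refl pos short ABC(3), of "model_dist \<kappa> A U"]
      seg_geod[OF ABC(1,2) refl pos short U]
    by (simp add: model_dist_sym[of \<kappa> C])
qed

section \<open>Spaces satisfying Stewart's inequality\<close>

text \<open>The set \<open>N\<close> plays the role of the complete space inside its ultrapower \<open>Y\<close>: geodesics exist in
  \<open>Y\<close>, and a point of \<open>Y\<close> that is determined by its distances to two points of \<open>N\<close> lies in \<open>N\<close>.\<close>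

locale stewart_space =
  fixes \<kappa> :: real and Y :: "'b set" and d :: "'b \<Rightarrow> 'b \<Rightarrow> real" and N :: "'b set"
  assumes d_nonneg: "a \<in> Y \<Longrightarrow> b \<in> Y \<Longrightarrow> 0 \<le> d a b"
    and d_self: "a \<in> Y \<Longrightarrow> d a a = 0"
    and d_sym: "d a b = d b a"
    and d_triangle: "a \<in> Y \<Longrightarrow> b \<in> Y \<Longrightarrow> c \<in> Y \<Longrightarrow> d a c \<le> d a b + d b c"
    and geodesic: "a \<in> Y \<Longrightarrow> b \<in> Y \<Longrightarrow> 0 \<le> t \<Longrightarrow> t \<le> d a b \<Longrightarrow>
      \<exists>u\<in>Y. d a u = t \<and> d u b = d a b - t"
    and stewart: "a \<in> Y \<Longrightarrow> b \<in> Y \<Longrightarrow> c \<in> Y \<Longrightarrow> u \<in> Y \<Longrightarrow> 0 < d a u \<Longrightarrow> 0 < d u b \<Longrightarrow>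
      d a b = d a u + d u b \<Longrightarrow> small \<kappa> (d a b + d b c + d c a) \<Longrightarrow>
      snk \<kappa> (d u b) * (sig \<kappa> (d a c) - sig \<kappa> (d a u)) +
      snk \<kappa> (d a u) * (sig \<kappa> (d b c) - sig \<kappa> (d u b)) \<le> snk \<kappa> (d a b) * sig \<kappa> (d u c)"
    and N_subset: "N \<subseteq> Y"
    and N_eq: "a \<in> N \<Longrightarrow> b \<in> N \<Longrightarrow> d a b = 0 \<Longrightarrow> a = b"
    and N_closed: "a \<in> N \<Longrightarrow> b \<in> N \<Longrightarrow> 0 \<le> t \<Longrightarrow> t \<le> d a b \<Longrightarrow>
      (\<And>u u'. u \<in> Y \<Longrightarrow> u' \<in> Y \<Longrightarrow> d a u = t \<Longrightarrow> d u b = d a b - t \<Longrightarrow>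
        d a u' = t \<Longrightarrow> d u' b = d a b - t \<Longrightarrow> d u u' = 0) \<Longrightarrow>
      \<exists>u\<in>N. d a u = t \<and> d u b = d a b - t"
begin

section \<open>The two readings of Stewart's inequality\<close>

lemma N_Y: "a \<in> N \<Longrightarrow> a \<in> Y" using N_subset by blast

text \<open>The left side of Stewart's inequality increases with d(a, c) and d(b, c), its weights
  being nonnegative, and the model surface gives equality. The ends are separate because
  \<open>stewart\<close> asks for u strictly between a and b.\<close>

lemma lower_bound:
  assumes Y: "a \<in> Y" "b \<in> Y" "c \<in> Y" "u \<in> Y"
    and M: "A \<in> model_plane \<kappa>" "B \<in> model_plane \<kappa>" "C \<in> model_plane \<kappa>"
    and U: "U \<in> seg \<kappa> A B"
    and eq: "d a u = model_dist \<kappa> A U" "d u b = model_dist \<kappa> U B" "d a b = model_dist \<kappa> A B"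
    and le: "model_dist \<kappa> A C \<le> d a c" "model_dist \<kappa> B C \<le> d b c"
    and small: "small \<kappa> (d a b + d b c + d c a)"
  shows "model_dist \<kappa> U C \<le> d u c"
proof -
  have UM: "U \<in> model_plane \<kappa>" and sum: "model_dist \<kappa> A B = model_dist \<kappa> A U + model_dist \<kappa> U B"
    using U by (auto simp: seg_iff)
  consider "d a u = 0" | "d u b = 0" | "0 < d a u" "0 < d u b"
    using d_nonneg Y by fastforce
  then show ?thesis
  proof cases
    case 1
    then have "A = U" using eq M UM model_dist_eq_0 by metis
    then show ?thesis using le d_triangle[of a u c] Y 1 by (auto simp: d_sym)
  next
    case 2
    then have "U = B" using eq M UM model_dist_eq_0 by metis
    then show ?thesis using le d_triangle[of b u c] Y 2 by (auto simp: d_sym)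
  next
    case 3
    have L: "0 < model_dist \<kappa> A B" using 3 eq sum by simp
    have tri: "d a b \<le> d b c + d c a" "d b c \<le> d a b + d c a" "d c a \<le> d a b + d b c"
      using d_triangle[of a c b] d_triangle[of b a c] d_triangle[of c b a] Y by (auto simp: d_sym)
    have ab: "short \<kappa> (d a b)" and bc: "short \<kappa> (d b c)" and ac: "short \<kappa> (d a c)"
      using small_short[OF small] tri Y by (auto simp: d_sym)
    have uc: "d u c \<le> d a u + d c a" "d u c \<le> d u b + d b c"
      using d_triangle[of u a c] d_triangle[of u b c] Y by (auto simp: d_sym)
    then have "2 * d u c \<le> d a b + d b c + d c a" using eq sum by (auto simp: d_sym)
    then have suc: "short \<kappa> (d u c)" by (rule small_short[OF small])
    note st = model_stewart[OF M L ab[unfolded eq] U]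
    have pos: "0 \<le> snk \<kappa> (d u b)" "0 \<le> snk \<kappa> (d a u)" "0 < snk \<kappa> (d a b)"
      using snk_pos[of "d u b" \<kappa>] snk_pos[of "d a u" \<kappa>] snk_pos[of "d a b" \<kappa>] 3 ab
        shortD[OF ab, of "d u b"] shortD[OF ab, of "d a u"] eq sum L by (auto simp: d_sym)
    have "sig \<kappa> (model_dist \<kappa> A C) \<le> sig \<kappa> (d a c)" "sig \<kappa> (model_dist \<kappa> B C) \<le> sig \<kappa> (d b c)"
      using sig_mono[OF model_dist_nonneg[OF M(1,3)] le(1)] sig_mono[OF model_dist_nonneg[OF M(2,3)] le(2)]
        short_fits[OF ac] short_fits[OF bc] by auto
    then have "snk \<kappa> (d u b) * (sig \<kappa> (model_dist \<kappa> A C) - sig \<kappa> (d a u)) \<le>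
          snk \<kappa> (d u b) * (sig \<kappa> (d a c) - sig \<kappa> (d a u))"
        "snk \<kappa> (d a u) * (sig \<kappa> (model_dist \<kappa> B C) - sig \<kappa> (d u b)) \<le>
          snk \<kappa> (d a u) * (sig \<kappa> (d b c) - sig \<kappa> (d u b))"
      using pos by (auto intro!: mult_left_mono)
    then have "snk \<kappa> (d a b) * sig \<kappa> (model_dist \<kappa> U C) \<le> snk \<kappa> (d a b) * sig \<kappa> (d u c)"
      using stewart[OF Y 3 _ small] st eq sum by simp
    then have "sig \<kappa> (model_dist \<kappa> U C) \<le> sig \<kappa> (d u c)" using pos by simp
    then show ?thesis
      using sig_le_iff[of "model_dist \<kappa> U C" "d u c" \<kappa>] model_dist_nonneg[OF UM M(3)]
        model_dist_fits[OF UM M(3)] short_fits[OF suc] d_nonneg Y by blast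
  qed
qed

text \<open>Stewart's inequality is solved for d(a, c). Its weight S(d(u, b)) must be positive,
  which is why u has to differ from b.\<close>

lemma upper_bound_small:
  assumes Y: "a \<in> Y" "b \<in> Y" "c \<in> Y" "u \<in> Y"
    and M: "A \<in> model_plane \<kappa>" "B \<in> model_plane \<kappa>" "C \<in> model_plane \<kappa>"
    and U: "U \<in> seg \<kappa> A B"
    and pos: "0 < d a u" "0 < d u b"
    and eq: "d a u = model_dist \<kappa> A U" "d u b = model_dist \<kappa> U B" "d a b = model_dist \<kappa> A B"
    and le: "d u c \<le> model_dist \<kappa> U C" "model_dist \<kappa> B C \<le> d b c"
    and small: "small \<kappa> (d a b + d b c + d c a)"
  shows "d a c \<le> model_dist \<kappa> A C"
proof -
  have UM: "U \<in> model_plane \<kappa>" and sum: "model_dist \<kappa> A B = model_dist \<kappa> A U + model_dist \<kappa> U B"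
    using U by (auto simp: seg_iff)
  have L: "0 < model_dist \<kappa> A B" using pos eq sum by simp
  have tri: "d a b \<le> d b c + d c a" "d b c \<le> d a b + d c a" "d c a \<le> d a b + d b c"
    using d_triangle[of a c b] d_triangle[of b a c] d_triangle[of c b a] Y by (auto simp: d_sym)
  have ab: "short \<kappa> (d a b)" and bc: "short \<kappa> (d b c)" and ac: "short \<kappa> (d a c)"
    using small_short[OF small] tri Y by (auto simp: d_sym)
  note st = model_stewart[OF M L ab[unfolded eq] U]
  have snk: "0 < snk \<kappa> (d u b)" "0 < snk \<kappa> (d a u)" "0 < snk \<kappa> (d a b)"
    using snk_pos[of "d u b" \<kappa>] snk_pos[of "d a u" \<kappa>] snk_pos[of "d a b" \<kappa>] pos ab
      shortD[OF ab, of "d u b"] shortD[OF ab, of "d a u"] eq sum L by (auto simp: d_sym)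
  have uM: "fits \<kappa> (model_dist \<kappa> U C)" by (rule model_dist_fits[OF UM M(3)])
  have "sig \<kappa> (d u c) \<le> sig \<kappa> (model_dist \<kappa> U C)" "sig \<kappa> (model_dist \<kappa> B C) \<le> sig \<kappa> (d b c)"
    using sig_mono[OF d_nonneg[OF Y(4,3)] le(1) uM] sig_mono[OF model_dist_nonneg[OF M(2,3)] le(2)]
      short_fits[OF bc] by auto
  then have "snk \<kappa> (d a u) * (sig \<kappa> (model_dist \<kappa> B C) - sig \<kappa> (d u b)) \<le>
        snk \<kappa> (d a u) * (sig \<kappa> (d b c) - sig \<kappa> (d u b))"
      "snk \<kappa> (d a b) * sig \<kappa> (d u c) \<le> snk \<kappa> (d a b) * sig \<kappa> (model_dist \<kappa> U C)"
    using snk by (auto intro!: mult_left_mono)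
  then have "snk \<kappa> (d u b) * sig \<kappa> (d a c) \<le> snk \<kappa> (d u b) * sig \<kappa> (model_dist \<kappa> A C)"
    using stewart[OF Y pos _ small] st eq sum by (simp add: algebra_simps)
  then have "sig \<kappa> (d a c) \<le> sig \<kappa> (model_dist \<kappa> A C)" using snk by simp
  then show ?thesis
    using sig_le_iff[of "d a c" "model_dist \<kappa> A C" \<kappa>] model_dist_nonneg[OF M(1,3)]
      model_dist_fits[OF M(1,3)] short_fits[OF ac] d_nonneg Y by blast
qed

text \<open>The perimeter of \<open>\<Delta>abc\<close> need not be small here: the bound is first obtained at a point close
  to \<open>u\<close> on the geodesic from \<open>u\<close> to \<open>a\<close>.\<close>

lemma upper_bound:
  assumes Y: "a \<in> Y" "b \<in> Y" "c \<in> Y" "u \<in> Y"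
    and M: "A \<in> model_plane \<kappa>" "B \<in> model_plane \<kappa>" "C \<in> model_plane \<kappa>"
    and U: "U \<in> seg \<kappa> A B"
    and pos: "0 < d a u" "0 < d u b"
    and eq: "d a u = model_dist \<kappa> A U" "d u b = model_dist \<kappa> U B" "d a b = model_dist \<kappa> A B"
    and short: "short \<kappa> (model_dist \<kappa> A B)"
    and uc: "d u c = model_dist \<kappa> U C" and bc: "model_dist \<kappa> B C \<le> d b c"
    and small: "small \<kappa> (d u a + d a c + d c u)" "small \<kappa> (d u b + d b c + d c u)"
  shows "d a c \<le> model_dist \<kappa> A C"
proof -
  have UM: "U \<in> model_plane \<kappa>" and sum: "model_dist \<kappa> A B = model_dist \<kappa> A U + model_dist \<kappa> U B"
    using U by (auto simp: seg_iff)
  have "d u c \<le> d a u + d a c" using d_triangle[of u a c] Y by (auto simp: d_sym)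
  then have suc: "short \<kappa> (d u c)" using small_short[OF small(1)] Y by (auto simp: d_sym)
  \<comment> \<open>The quarter gives 4 * \<epsilon> + 2 * d(u, c) < 2 * \<open>dia\<close>
    \<kappa>, which bounds the perimeter of c and two points at distance \<epsilon> on either side
    of u.\<close>
  define \<epsilon> where "\<epsilon> = (if \<kappa> > 0 then min (min (d a u) (d u b)) ((dia \<kappa> - d u c) / 4)
    else min (d a u) (d u b))"
  have \<epsilon>: "0 < \<epsilon>" "\<epsilon> \<le> d a u" "\<epsilon> \<le> d u b" and \<epsilon>s: "small \<kappa> (4 * \<epsilon> + 2 * d u c)"
    using pos suc by (auto simp: \<epsilon>_def short_def small_def min_def field_simps)
  obtain a' where a': "a' \<in> Y" "d u a' = \<epsilon>" "d a' a = d u a - \<epsilon>"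
    using geodesic[of u a \<epsilon>] \<epsilon> Y by (auto simp: d_sym)
  obtain b' where b': "b' \<in> Y" "d u b' = \<epsilon>" "d b' b = d u b - \<epsilon>"
    using geodesic[of u b \<epsilon>] \<epsilon> Y by (auto simp: d_sym)
  let ?L1 = "model_dist \<kappa> U A" and ?L2 = "model_dist \<kappa> U B"
  have L: "0 < ?L1" "short \<kappa> ?L1" "0 < ?L2" "short \<kappa> ?L2" "\<epsilon> \<le> ?L1" "\<epsilon> \<le> ?L2"
    using pos eq \<epsilon> shortD[OF short] sum by (auto simp: model_dist_sym[of \<kappa> U A])
  define A' where "A' = geod \<kappa> U A \<epsilon>"
  define B' where "B' = geod \<kappa> U B \<epsilon>"
  have A': "A' \<in> seg \<kappa> U A" "model_dist \<kappa> U A' = \<epsilon>" "model_dist \<kappa> A' A = ?L1 - \<epsilon>"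
    unfolding A'_def using geod_seg[OF UM M(1) refl L(1,2), of \<epsilon>] L \<epsilon> by (auto simp: d_sym)
  have B': "B' \<in> seg \<kappa> U B" "model_dist \<kappa> U B' = \<epsilon>" "model_dist \<kappa> B' B = ?L2 - \<epsilon>"
    unfolding B'_def using geod_seg[OF UM M(2) refl L(3,4), of \<epsilon>] L \<epsilon> by (auto simp: d_sym)
  have M': "A' \<in> model_plane \<kappa>" "B' \<in> model_plane \<kappa>" using A' B' by (auto simp: seg_iff)
  \<comment> \<open>The forward reading on [u, b] carries the lower bound from b to b'.\<close>
  have b'c: "model_dist \<kappa> B' C \<le> d b' c"
    by (rule lower_bound[OF Y(4,2,3) b'(1) UM M(2,3) B'(1)])
      (use b' B' eq uc bc small Y in \<open>auto simp: d_sym model_dist_sym add_ac\<close>)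
  have AB: "model_dist \<kappa> A' B' = 2 * \<epsilon>"
    using model_dist_triangle[OF M'(1) UM M'(2)] model_dist_triangle[OF M(1) M'(1) M(2)]
      model_dist_triangle[OF M'(1,2) M(2)] sum A' B' by (simp add: model_dist_sym)
  have ab: "d a' b' = 2 * \<epsilon>"
  proof -
    have "d a' b' \<le> 2 * \<epsilon>" using d_triangle[of a' u b'] a' b' Y by (auto simp: d_sym)
    moreover have "d a b \<le> d a a' + d a' b'  + d b' b"
      using d_triangle[of a a' b] d_triangle[of a' b' b] a' b' Y by (auto simp: d_sym)
    ultimately show ?thesis using a' b' eq sum Y by (auto simp: d_sym)
  qed
  have tri: "d b' c \<le> \<epsilon> + d u c" "d c a' \<le> \<epsilon> + d u c"
    using d_triangle[of b' u c] d_triangle[of c u a'] a' b' Y by (auto simp: d_sym)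
  have a'c: "d a' c \<le> model_dist \<kappa> A' C"
  proof (rule upper_bound_small[OF a'(1) b'(1) Y(3,4) M'(1,2) M(3)])
    show "U \<in> seg \<kappa> A' B'" using AB A' B' UM by (simp add: seg_iff model_dist_sym)
    show "small \<kappa> (d a' b' + d b' c + d c a')"
      by (rule smallD[OF \<epsilon>s]) (use ab tri in auto)
  qed (use \<epsilon> a' b' A' B' AB ab uc b'c Y in \<open>auto simp: d_sym model_dist_sym\<close>)
  show ?thesis
  proof (cases "\<epsilon> = d a u")
    case True
    then have "A' = A" using A' M M' eq model_dist_eq_0[of A' \<kappa> A] by (simp add: model_dist_sym)
    moreover have "d a a' = 0" using True a' Y by (auto simp: d_sym)
    ultimately show ?thesis using a'c d_triangle[of a a' c] a' Y by (auto simp: d_sym)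
  next
    case False
    \<comment> \<open>The backward reading on [a, u] with a' in between moves the bound from a' to
      a; its perimeter is the first one assumed small.\<close>
    show ?thesis
    proof (rule upper_bound_small[OF Y(1,4,3) a'(1) M(1) UM M(3) _ _ _ _ _ _ a'c])
      show "A' \<in> seg \<kappa> A U" using A'(1) by (simp add: seg_sym)
    qed (use False \<epsilon> a' A' eq uc Y small in
        \<open>auto simp: d_sym model_dist_sym add_ac\<close>)
  qed
qed

text \<open>The prolongation of [a, m] to b excludes branching before m. Both u and u' correspond to
  the same model point U, and the backward reading along u, m, b with third point u' bounds d(u, u')
  by the distance of U from itself.\<close>

lemma between_unique:
  assumes Y: "a \<in> Y" "b \<in> Y" "m \<in> Y" "u \<in> Y" "u' \<in> Y"
    and M: "A \<in> model_plane \<kappa>" "B \<in> model_plane \<kappa>" "model_dist \<kappa> A B = d a b"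
    and m: "d a b = d a m + d m b" "0 < d m b" and short: "short \<kappa> (d a b)"
    and u: "d a u + d u m = d a m" "d a u' = d a u" "d u' m = d u m"
  shows "d u u' = 0"
proof (cases "d u m = 0")
  case True
  then show ?thesis using u d_triangle[of u m u'] d_nonneg[of u u'] Y by (auto simp: d_sym)
next
  case False
  then have um: "0 < d u m" using d_nonneg[of u m] Y by (auto simp: d_sym)
  let ?t = "d a u"
  have pos: "0 < d a b" using m um u d_nonneg Y by (smt (verit))
  have t: "0 \<le> ?t" "?t \<le> d a m" "d a m \<le> d a b" using d_nonneg Y um u m by (auto simp: d_sym)
  have ub: "d u b = d a b - ?t" "d u' b = d a b - ?t"
    using d_triangle[of a u b] d_triangle[of u m b] d_triangle[of a u' b] d_triangle[of u' m b] u m Y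
    by (auto simp: d_sym)
  note P = M(1,2) M(3)[symmetric] pos short
  define U where "U = geod \<kappa> A B ?t"
  define V where "V = geod \<kappa> A B (d a m)"
  have UV: "U \<in> model_plane \<kappa>" "V \<in> model_plane \<kappa>"
    unfolding U_def V_def using geod_in[OF P] by (auto simp: d_sym)
  have dist: "model_dist \<kappa> U V = d u m" "model_dist \<kappa> V B = d m b" "model_dist \<kappa> U B = d u b"
    unfolding U_def V_def using geod_dist[OF P, of "d a m" ?t] geod_seg(3)[OF P, of ?t]
      geod_seg(3)[OF P, of "d a m"] t u m ub by (auto simp: d_sym)
  have uu: "d u u' \<le> 2 * ?t" using d_triangle[of u a u'] u Y by (auto simp: d_sym)
  have "d u u' \<le> model_dist \<kappa> U U"
  proof (rule upper_bound[OF Y(4,2,5,3) UV(1) M(2) UV(1), of V])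
    have "2 * d a m < 2 * dia \<kappa>" if "\<kappa> > 0" using short that t(3) by (simp add: short_def)
    then show "small \<kappa> (d m u + d u u' + d u' m)"
      using uu u Y by (auto simp: small_def d_sym)
    have "2 * d u b < 2 * dia \<kappa>" if "\<kappa> > 0" using short that t(1) ub by (simp add: short_def)
    then show "small \<kappa> (d m b + d b u' + d u' m)"
      using u ub Y m by (auto simp: small_def d_sym)
  qed (use dist UV u ub m um shortD[OF short] t Y in
      \<open>auto simp: seg_iff model_dist_sym d_sym\<close>)
  then show ?thesis using UV d_nonneg[of u u'] Y by simp
qed

end

section \<open>Geodesics inside \<open>N\<close>\<close>

context stewart_space begin

lemma d_zero_dist: "a \<in> Y \<Longrightarrow> b \<in> Y \<Longrightarrow> c \<in> Y \<Longrightarrow> d a b = 0 \<Longrightarrow> d a c = d b c"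
  using d_triangle[of a b c] d_triangle[of b a c] by (simp add: d_sym)

text \<open>By \<open>between_unique\<close> a point of [a, m] is determined by its parameter, so
  \<open>N_closed\<close> supplies it in \<open>N\<close>. The choices are compatible: a geodesic
  from a to F t passes F s up to distance zero.\<close>

lemma half_path_exists:
  assumes N: "a \<in> N" "b \<in> N" "m \<in> N"
    and M: "A \<in> model_plane \<kappa>" "B \<in> model_plane \<kappa>" "model_dist \<kappa> A B = d a b"
    and m: "d a b = d a m + d m b" "0 < d m b" and short: "short \<kappa> (d a b)"
  obtains F where "\<And>t. 0 \<le> t \<Longrightarrow> t \<le> d a m \<Longrightarrow> F t \<in> N"
    "\<And>s t. 0 \<le> s \<Longrightarrow> s \<le> d a m \<Longrightarrow> 0 \<le> t \<Longrightarrow> t \<le> d a m \<Longrightarrow> d (F s) (F t) = \<bar>s - t\<bar>"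
    "F 0 = a" "F (d a m) = m"
proof -
  note Y = N[THEN N_Y]
  note uniq = between_unique[OF Y _ _ M m short]
  have "\<exists>u\<in>N. d a u = t \<and> d u m = d a m - t" if "0 \<le> t" "t \<le> d a m" for t
    by (rule N_closed[OF N(1,3) that]) (rule uniq, auto)
  then obtain F where F: "\<And>t. 0 \<le> t \<Longrightarrow> t \<le> d a m \<Longrightarrow> F t \<in> N"
    "\<And>t. 0 \<le> t \<Longrightarrow> t \<le> d a m \<Longrightarrow> d a (F t) = t \<and> d (F t) m = d a m - t"
    by metis
  have dist: "d (F s) (F t) = t - s" if st: "0 \<le> s" "s \<le> t" "t \<le> d a m" for s t
  proof -
    have t: "F t \<in> Y" "d a (F t) = t" "d (F t) m = d a m - t"
      and s: "F s \<in> Y" "d a (F s) = s" "d (F s) m = d a m - s" using F N_Y that by auto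
    obtain u where u: "u \<in> Y" "d a u = s" "d u (F t) = t - s"
      using geodesic[OF Y(1) t(1), of s] st t by auto
    have "d u m = d a m - s"
      using d_triangle[of u "F t" m] d_triangle[of a u m] u t Y by auto
    then have "d (F s) u = 0" using uniq[OF s(1) u(1)] s u by auto
    then show ?thesis using d_zero_dist[OF s(1) u(1) t(1)] u by simp
  qed
  have m0: "0 \<le> d a m" using d_nonneg Y by simp
  show ?thesis
  proof (rule that[of F])
    show "d (F s) (F t) = \<bar>s - t\<bar>" if "0 \<le> s" "s \<le> d a m" "0 \<le> t" "t \<le> d a m" for s t
    proof (cases "s \<le> t")
      case True
      then show ?thesis using dist[of s t] that by simp
    next
      case False
      then have "d (F t) (F s) = s - t" using dist[of t s] that by simp
      then show ?thesis using False d_sym[of "F s" "F t"] by linarith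
    qed
    have "d a (F 0) = 0" using F(2)[of 0] m0 by simp
    then show "F 0 = a" using N_eq[OF N(1) F(1)[OF order.refl m0]] by metis
    have "d (F (d a m)) m = 0" using F(2)[of "d a m"] m0 by simp
    then show "F (d a m) = m" by (rule N_eq[OF F(1)[OF m0 order.refl] N(3)])
  qed (rule F(1))
qed

text \<open>Each half is prolonged by the other one. Across m the triangle inequalities are tight
  because the lengths add up to d(a, b).\<close>

lemma path_exists:
  assumes N: "a \<in> N" "b \<in> N" "m \<in> N"
    and M: "A \<in> model_plane \<kappa>" "B \<in> model_plane \<kappa>" "model_dist \<kappa> A B = d a b"
    and m: "d a b = d a m + d m b" "0 < d a m" "0 < d m b" and short: "short \<kappa> (d a b)"
  obtains F where "\<And>t. 0 \<le> t \<Longrightarrow> t \<le> d a b \<Longrightarrow> F t \<in> N"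
    "\<And>s t. 0 \<le> s \<Longrightarrow> s \<le> d a b \<Longrightarrow> 0 \<le> t \<Longrightarrow> t \<le> d a b \<Longrightarrow> d (F s) (F t) = \<bar>s - t\<bar>"
    "F 0 = a" "F (d a m) = m" "F (d a b) = b"
proof -
  note Y = N[THEN N_Y]
  obtain F1 where F1: "\<And>t. 0 \<le> t \<Longrightarrow> t \<le> d a m \<Longrightarrow> F1 t \<in> N"
    "\<And>s t. 0 \<le> s \<Longrightarrow> s \<le> d a m \<Longrightarrow> 0 \<le> t \<Longrightarrow> t \<le> d a m \<Longrightarrow> d (F1 s) (F1 t) = \<bar>s - t\<bar>"
    "F1 0 = a" "F1 (d a m) = m"
    using half_path_exists[OF N M m(1,3) short] by blast
  have "model_dist \<kappa> B A = d b a" "d b a = d b m + d m a" "0 < d m a" "short \<kappa> (d b a)"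
    using M m short by (auto simp: d_sym model_dist_sym)
  then obtain F2 where F2: "\<And>t. 0 \<le> t \<Longrightarrow> t \<le> d b m \<Longrightarrow> F2 t \<in> N"
    "\<And>s t. 0 \<le> s \<Longrightarrow> s \<le> d b m \<Longrightarrow> 0 \<le> t \<Longrightarrow> t \<le> d b m \<Longrightarrow> d (F2 s) (F2 t) = \<bar>s - t\<bar>"
    "F2 0 = b" "F2 (d b m) = m"
    using half_path_exists[OF N(2,1,3) M(2,1)] by blast
  define F where "F t = (if t \<le> d a m then F1 t else F2 (d a b - t))" for t
  have bm: "d b m = d m b" by (rule d_sym)
  have FN: "F t \<in> N" if "0 \<le> t" "t \<le> d a b" for t
    using that F1 F2 m bm by (auto simp: F_def)
  have cross: "d (F s) (F t) = t - s" if "0 \<le> s" "s \<le> d a m" "d a m < t" "t \<le> d a b" for s t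
  proof -
    have s: "F s \<in> Y" "d a (F s) = s" "d (F s) m = d a m - s"
      using that F1(1)[of s] F1(2)[of 0 s] F1(2)[of s "d a m"] F1(3,4) N_Y m by (auto simp: F_def)
    have t: "F t \<in> Y" "d (F t) b = d a b - t" "d m (F t) = t - d a m"
      using that F2(1)[of "d a b - t"] F2(2)[of "d a b - t" 0] F2(2)[of "d b m" "d a b - t"] F2(3,4) N_Y m bm
      by (auto simp: F_def)
    show ?thesis
      using d_triangle[of "F s" m "F t"] d_triangle[of a "F s" b] d_triangle[of "F s" "F t" b] s t Y by auto
  qed
  show ?thesis
  proof (rule that[of F])
    fix s t assume st: "0 \<le> s" "s \<le> d a b" "0 \<le> t" "t \<le> d a b"
    show "d (F s) (F t) = \<bar>s - t\<bar>"
    proof (cases "s \<le> d a m"; cases "t \<le> d a m")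
      assume "s \<le> d a m" "t \<le> d a m"
      then show ?thesis using F1(2) st by (simp add: F_def)
    next
      assume "\<not> s \<le> d a m" "\<not> t \<le> d a m"
      then show ?thesis using F2(2)[of "d a b - s" "d a b - t"] st m bm by (simp add: F_def)
    next
      assume "s \<le> d a m" "\<not> t \<le> d a m"
      then show ?thesis using cross[of s t] st by simp
    next
      assume "\<not> s \<le> d a m" "t \<le> d a m"
      then show ?thesis using cross[of t s] st d_sym[of "F s"] by simp
    qed
  qed (use FN F1 F2 m in \<open>auto simp: F_def\<close>)
qed

end

section \<open>Filling in the triangle\<close>

lemma coeff_sum_pos: "0 \<le> (l::real) \<Longrightarrow> 0 \<le> m \<Longrightarrow> l *\<^sub>R a + m *\<^sub>R b \<in> model_plane \<kappa> \<Longrightarrow> 0 < l + m"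
  using zero_notin_model[of \<kappa>] by (cases "l = 0 \<and> m = 0") auto

lemma scaleR_solve: "c *\<^sub>R u = d *\<^sub>R v \<Longrightarrow> c \<noteq> 0 \<Longrightarrow> (d / c) *\<^sub>R v = (u::'a::real_vector)"
proof -
  assume a: "c *\<^sub>R u = d *\<^sub>R v" "c \<noteq> 0"
  have "(d / c) *\<^sub>R v = (1 / c) *\<^sub>R (d *\<^sub>R v)" by simp
  also have "\<dots> = u" using a(2) unfolding a(1)[symmetric] by simp
  finally show ?thesis .
qed

text \<open>The nondegenerate configuration after the segment [x, w] has been constructed inside
  \<open>N\<close> as F. The model points lie in one open half-space, and the hypotheses are
  symmetric in y and z.\<close>

locale cevian = stewart_space +
  fixes e :: "real^3" and x y z w :: 'b and x' y' z' w' :: "real^3" and F :: "real \<Rightarrow> 'b" and L :: real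
  assumes hs: "x' \<in> half_plane \<kappa> e" "y' \<in> half_plane \<kappa> e" "z' \<in> half_plane \<kappa> e" "w' \<in> half_plane \<kappa> e"
    and N4: "x \<in> N" "y \<in> N" "z \<in> N" "w \<in> N"
    and w': "w' \<in> seg \<kappa> y' z'" "w' \<noteq> y'" "w' \<noteq> z'" "x' \<noteq> w'"
    and dist: "d x y = model_dist \<kappa> x' y'" "d x z = model_dist \<kappa> x' z'" "d x w = model_dist \<kappa> x' w'"
      "d y z = model_dist \<kappa> y' z'" "d y w = model_dist \<kappa> y' w'" "d z w = model_dist \<kappa> z' w'"
    and L: "L = model_dist \<kappa> x' w'"
    and F_N: "0 \<le> t \<Longrightarrow> t \<le> L \<Longrightarrow> F t \<in> N"
    and F_dist: "0 \<le> s \<Longrightarrow> s \<le> L \<Longrightarrow> 0 \<le> t \<Longrightarrow> t \<le> L \<Longrightarrow> d (F s) (F t) = \<bar>s - t\<bar>"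
    and F_ends: "F 0 = x" "F L = w"
begin

definition G :: "real \<Rightarrow> real^3" where "G t = geod \<kappa> x' w' t"

text \<open>Transfers every statement about the half at y to the half at z.\<close>

lemma swap: "cevian \<kappa> Y d N e x z y w x' z' y' w' F L"
  using hs N4 w' dist L F_N F_dist F_ends d_sym model_dist_sym[of \<kappa> y' z'] seg_sym
  by unfold_locales auto

lemma XM: "x' \<in> model_plane \<kappa>" "y' \<in> model_plane \<kappa>" "z' \<in> model_plane \<kappa>" "w' \<in> model_plane \<kappa>"
  using hs hsD by auto

lemma XY: "x \<in> Y" "y \<in> Y" "z \<in> Y" "w \<in> Y" using N4 N_Y by auto

lemma L_pos: "0 < L" using L w' XM model_dist_pos by auto

lemma L_short: "short \<kappa> L" using L hs hs_short by auto

lemmas LL = XM(1,4) L L_pos L_short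

lemma G_ends: "G 0 = x'" "G L = w'"
  using geod_0[OF XM(1,4) w'(4)] geod_end[OF XM(1,4) w'(4)] L_short L by (auto simp: G_def)

lemma G_seg: "0 \<le> t \<Longrightarrow> t \<le> L \<Longrightarrow> G t \<in> seg \<kappa> x' w'"
  using geod_seg(1)[OF LL] by (simp add: G_def)

lemma G_hs: "0 \<le> t \<Longrightarrow> t \<le> L \<Longrightarrow> G t \<in> half_plane \<kappa> e"
  using seg_hs[OF hs(1,4) G_seg] by simp

lemma G_M: "G t \<in> model_plane \<kappa>" using geod_in[OF LL] by (simp add: G_def)

lemma G_dist: "0 \<le> s \<Longrightarrow> s \<le> L \<Longrightarrow> 0 \<le> t \<Longrightarrow> t \<le> L \<Longrightarrow> model_dist \<kappa> (G s) (G t) = \<bar>s - t\<bar>"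
  using geod_dist[OF LL, of t s] by (simp add: G_def)

lemma F_Y: "0 \<le> t \<Longrightarrow> t \<le> L \<Longrightarrow> F t \<in> Y" using F_N N_Y by simp

lemma F_G: "0 \<le> s \<Longrightarrow> s \<le> L \<Longrightarrow> 0 \<le> t \<Longrightarrow> t \<le> L \<Longrightarrow> d (F s) (F t) = model_dist \<kappa> (G s) (G t)"
  using F_dist G_dist by simp

lemma G_coeffs:
  assumes "0 < t" "t < L"
  obtains l m where "0 < l" "0 < m" "G t = l *\<^sub>R x' + m *\<^sub>R w'"
proof -
  have "G t \<noteq> x'" "G t \<noteq> w'"
    using G_dist[of 0 t] G_dist[of t L] G_ends assms model_dist_self[OF XM(1)] model_dist_self[OF XM(4)]
    by auto
  then show ?thesis using hs_coeffs[OF hs(1,4) G_seg, of t] assms that by (metis less_imp_le)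
qed

text \<open>As distinct points of the surface, x' and w' are not positive multiples of each other.
  This keeps the normalized combination away from both ends.\<close>

lemma G_of_coeffs:
  assumes "0 < l" "0 < m"
  obtains k t where "0 < k" "0 < t" "t < L" "l *\<^sub>R x' + m *\<^sub>R w' = k *\<^sub>R G t"
proof -
  obtain k where k: "0 < k" "k *\<^sub>R (l *\<^sub>R x' + m *\<^sub>R w') \<in> half_plane \<kappa> e"
    using normalize_comb[OF hs(1,4), of l m] assms by auto
  let ?u = "k *\<^sub>R (l *\<^sub>R x' + m *\<^sub>R w')"
  have u: "?u \<in> model_plane \<kappa>" using k hsD by auto
  have "?u \<in> seg \<kappa> x' w'"
    by (rule hs_seg[OF hs(1,4) u, of "k * l" "k * m"]) (use k assms in \<open>auto simp: scaleR_add_right\<close>)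
  note us = this seg_geod[OF LL this]
  have sum: "model_dist \<kappa> x' ?u + model_dist \<kappa> ?u w' = L" using us L by (simp add: seg_iff)
  have par: "c *\<^sub>R x' \<noteq> w'" if "c > 0" for c
    using model_plane_proportional[OF XM(1), of c] XM(4) w'(4) that by auto
  have "?u \<noteq> x'"
  proof
    assume "?u = x'"
    then have eq: "(k * m) *\<^sub>R w' = (1 - k * l) *\<^sub>R x'" by (simp add: algebra_simps)
    have "e \<bullet> ((k * m) *\<^sub>R w') > 0" using hsD(2)[OF hs(4)] k assms by simp
    then have "1 - k * l > 0" unfolding eq using hsD(2)[OF hs(1)] by (simp add: zero_less_mult_iff)
    moreover have "((1 - k * l) / (k * m)) *\<^sub>R x' = w'"
      using scaleR_solve[OF eq] k assms by simp
    ultimately show False using par[of "(1 - k * l) / (k * m)"] k assms by simp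
  qed
  then have "0 < model_dist \<kappa> x' ?u" using model_dist_pos[OF XM(1) u] by metis
  have "?u \<noteq> w'"
  proof
    assume "?u = w'"
    then have eq: "(k * l) *\<^sub>R x' = (1 - k * m) *\<^sub>R w'" by (simp add: algebra_simps)
    have "e \<bullet> ((k * l) *\<^sub>R x') > 0" using hsD(2)[OF hs(1)] k assms by simp
    then have p: "1 - k * m > 0" unfolding eq using hsD(2)[OF hs(4)] by (simp add: zero_less_mult_iff)
    moreover have "((k * l) / (1 - k * m)) *\<^sub>R x' = w'"
      using scaleR_solve[OF eq[symmetric]] p by simp
    ultimately show False using par[of "(k * l) / (1 - k * m)"] k assms by simp
  qed
  then have "0 < model_dist \<kappa> ?u w'" using model_dist_pos[OF u XM(4)] by metis
  show ?thesis
  proof (rule that[of "1 / k" "model_dist \<kappa> x' ?u"])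
    show "l *\<^sub>R x' + m *\<^sub>R w' = (1 / k) *\<^sub>R G (model_dist \<kappa> x' ?u)"
      unfolding G_def us(2)[symmetric] using k by simp
  qed (use k sum \<open>0 < model_dist \<kappa> x' ?u\<close> \<open>0 < model_dist \<kappa> ?u w'\<close> in auto)
qed

lemma w_coeffs:
  obtains l m where "0 < l" "0 < m" "w' = l *\<^sub>R y' + m *\<^sub>R z'"
  using hs_coeffs[OF hs(2,3) w'(1)] w'(2,3) by metis

text \<open>If part of w' in G t is expanded through y' and z' and the y' term is dropped, the
  remaining vector lies beyond G t as seen from y', in the cone over z' and [x', w']. Its
  normalization R0 is then pulled back towards G t to respect \<delta>.\<close>

lemma beyond:
  assumes t: "0 < t" "t < L" and Q: "Q \<in> seg \<kappa> y' (G t)" "Q \<noteq> G t" and \<delta>: "0 < \<delta>"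
  obtains R s where "0 < s" "s < L" "R \<in> seg \<kappa> z' (G s)" "R \<in> half_plane \<kappa> e"
    "0 < model_dist \<kappa> (G t) R" "model_dist \<kappa> (G t) R < \<delta>" "G t \<in> seg \<kappa> Q R"
proof -
  obtain a b where ab: "0 < a" "0 < b" "G t = a *\<^sub>R x' + b *\<^sub>R w'" by (rule G_coeffs[OF t])
  obtain \<beta> \<gamma> where bc: "0 < \<beta>" "0 < \<gamma>" "w' = \<beta> *\<^sub>R y' + \<gamma> *\<^sub>R z'" by (rule w_coeffs)
  have Gh: "G t \<in> half_plane \<kappa> e" using G_hs t by simp
  note Qh = seg_hs[OF hs(2) Gh Q(1)]
  have on_z: "\<exists>s. 0 < s \<and> s < L \<and> R \<in> seg \<kappa> z' (G s)"
    if R: "R \<in> model_plane \<kappa>" "R = l *\<^sub>R x' + m *\<^sub>R w' + n *\<^sub>R z'" "0 < l" "0 < m" "0 \<le> n" for R l m n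
  proof -
    obtain k s where k: "0 < k" "0 < s" "s < L" "l *\<^sub>R x' + m *\<^sub>R w' = k *\<^sub>R G s"
      by (rule G_of_coeffs[OF R(3,4)])
    have "R \<in> seg \<kappa> z' (G s)"
      by (rule hs_seg[OF hs(3) G_hs R(1), of s n k]) (use k R in \<open>auto simp: add.commute\<close>)
    then show ?thesis using k by blast
  qed
  \<comment> \<open>Only half of the w' part is expanded, so that V keeps a positive w' coefficient
    and hence lies over an interior point of [x', w']. The y' coefficient that splits off is
    \<epsilon>.\<close>
  define \<epsilon> where "\<epsilon> = b * \<beta> / 2"
  let ?V = "a *\<^sub>R x' + (b / 2) *\<^sub>R w' + (b * \<gamma> / 2) *\<^sub>R z'"
  have "b *\<^sub>R w' = (b / 2) *\<^sub>R w' + (b / 2) *\<^sub>R (\<beta> *\<^sub>R y' + \<gamma> *\<^sub>R z')"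
    unfolding bc(3)[symmetric] by (simp flip: scaleR_add_left)
  then have V: "G t = \<epsilon> *\<^sub>R y' + ?V" by (simp add: ab(3) \<epsilon>_def algebra_simps)
  obtain k1 s1 where k1: "0 < k1" "0 < s1" "s1 < L" "a *\<^sub>R x' + (b / 2) *\<^sub>R w' = k1 *\<^sub>R G s1"
    using G_of_coeffs[of a "b / 2"] ab by auto
  have p: "0 < b * \<gamma> / 2" using ab(2) bc(2) by simp
  moreover have "0 < k1 + b * \<gamma> / 2" by (rule add_pos_pos[OF k1(1) p])
  ultimately obtain k2 where k2: "0 < k2" "k2 *\<^sub>R (k1 *\<^sub>R G s1 + (b * \<gamma> / 2) *\<^sub>R z') \<in> half_plane \<kappa> e"
    using normalize_comb[OF G_hs[of s1] hs(3), of k1 "b * \<gamma> / 2"] k1(1-3)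
    by auto
  define R0 where "R0 = k2 *\<^sub>R ?V"
  have R0: "R0 \<in> half_plane \<kappa> e" using k2 k1 by (simp add: R0_def)
  have "?V = (1 / k2) *\<^sub>R R0" using k2 by (simp add: R0_def)
  then have GtR: "G t = \<epsilon> *\<^sub>R y' + (1 / k2) *\<^sub>R R0" using V by simp
  have \<epsilon>: "0 < \<epsilon>" using ab bc by (simp add: \<epsilon>_def)
  have Gseg: "G t \<in> seg \<kappa> y' R0"
    by (rule hs_seg[OF hs(2) R0 hsD(1)[OF Gh] GtR]) (use \<epsilon> k2 in auto)
  \<comment> \<open>Otherwise y' would be proportional to G t, hence equal to it, and the segment
    containing Q would shrink to G t.\<close>
  have ne: "R0 \<noteq> G t"
  proof
    assume eq: "R0 = G t"
    have "model_dist \<kappa> y' (G t) > 0"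
    proof (rule model_dist_pos[OF XM(2) G_M])
      show "y' \<noteq> G t"
      proof
        assume "y' = G t"
        then have "model_dist \<kappa> (G t) Q + model_dist \<kappa> Q (G t) = 0"
          using Q(1) hsD(1)[OF hs(2)] by (simp add: seg_iff)
        then have "model_dist \<kappa> Q (G t) = 0" by (simp add: model_dist_sym)
        then show False using Q(2) model_dist_eq_0[OF hsD(1)[OF Qh] G_M] by blast
      qed
    qed
    have e1: "\<epsilon> *\<^sub>R y' = (1 - 1 / k2) *\<^sub>R G t" using GtR eq by (simp add: algebra_simps)
    have "e \<bullet> (\<epsilon> *\<^sub>R y') > 0" using hsD(2)[OF hs(2)] \<epsilon> by simp
    then have p: "1 - 1 / k2 > 0" unfolding e1 using hsD(2)[OF Gh] by (simp add: zero_less_mult_iff)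
    have "((1 - 1 / k2) / \<epsilon>) *\<^sub>R G t = y'"
      using scaleR_solve[OF e1] \<epsilon> by simp
    then have "y' = G t"
      using model_plane_proportional[OF G_M, of "(1 - 1 / k2) / \<epsilon>" t] XM(2) p \<epsilon> by auto
    then show False using \<open>model_dist \<kappa> y' (G t) > 0\<close> XM by simp
  qed
  note R0M = hsD(1)[OF R0]
  have D: "0 < model_dist \<kappa> (G t) R0" by (rule model_dist_pos[OF G_M R0M ne[symmetric]])
  note D' = G_M R0M refl D hs_short[OF Gh R0]
  define \<tau> where "\<tau> = min (\<delta> / 2) (model_dist \<kappa> (G t) R0)"
  have \<tau>: "0 < \<tau>" "\<tau> < \<delta>" "\<tau> \<le> model_dist \<kappa> (G t) R0" using \<delta> D by (auto simp: \<tau>_def)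
  define R where "R = geod \<kappa> (G t) R0 \<tau>"
  have R: "R \<in> seg \<kappa> (G t) R0" "model_dist \<kappa> (G t) R = \<tau>"
    unfolding R_def using geod_seg[OF D'] \<tau> by auto
  have Rh: "R \<in> half_plane \<kappa> e" by (rule seg_hs[OF Gh R0 R(1)])
  note RM = hsD(1)[OF Rh]
  have "G t \<in> seg \<kappa> Q R"
  proof -
    note QM = hsD(1)[OF Qh]
    have "model_dist \<kappa> y' R0 \<le> model_dist \<kappa> y' Q + model_dist \<kappa> Q R + model_dist \<kappa> R R0"
      using model_dist_triangle[OF XM(2) QM R0M] model_dist_triangle[OF QM RM R0M] by linarith
    moreover have "model_dist \<kappa> Q R \<le> model_dist \<kappa> Q (G t) + model_dist \<kappa> (G t) R"
      by (rule model_dist_triangle[OF QM G_M RM])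
    ultimately show ?thesis using Q(1) R(1) Gseg by (simp add: seg_iff)
  qed
  moreover obtain s where "0 < s" "s < L" "R \<in> seg \<kappa> z' (G s)"
  proof -
    obtain l m where lm: "0 \<le> l" "0 \<le> m" "R = l *\<^sub>R G t + m *\<^sub>R R0"
      using hs_coeffs[OF Gh R0 R(1)] by metis
    have lm0: "0 < l + m" using coeff_sum_pos[OF lm(1,2)] RM lm(3) by simp
    have "R = (l * a + m * k2 * a) *\<^sub>R x' + (l * b + m * k2 * (b / 2)) *\<^sub>R w' + (m * k2 * (b * \<gamma> / 2)) *\<^sub>R z'"
      unfolding lm(3) ab(3) R0_def by (simp add: algebra_simps)
    moreover have "0 < l * a + m * k2 * a" "0 < l * b + m * k2 * (b / 2)"
    proof -
      have "0 < l \<or> 0 < m" using lm0 lm by linarith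
      then show "0 < l * a + m * k2 * a" "0 < l * b + m * k2 * (b / 2)"
        using lm(1,2) ab k2 by (auto intro: add_pos_nonneg add_nonneg_pos)
    qed
    moreover have "0 \<le> m * k2 * (b * \<gamma> / 2)" using lm ab bc k2 by simp
    ultimately show ?thesis using on_z[OF RM] that by blast
  qed
  ultimately show ?thesis using that[of s R] Rh R(2) \<tau> by auto
qed

text \<open>The geodesic from x' through Q reaches [y', w'] in a point S; the triangle inequality is
  then used for Q, S, w' and for x', y', S. The bound controls a perimeter in
  \<open>on_y_z\<close>.\<close>

lemma inner_path_le:
  assumes t: "0 \<le> t" "t < L" and Q: "Q \<in> seg \<kappa> y' (G t)"
  shows "model_dist \<kappa> x' Q + model_dist \<kappa> Q w' \<le> model_dist \<kappa> x' y' + model_dist \<kappa> y' w'"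
proof (cases "Q = x'")
  case True
  then show ?thesis using model_dist_triangle[OF XM(1,2,4)] XM by simp
next
  case False
  have Gh: "G t \<in> half_plane \<kappa> e" using G_hs t by simp
  note Qh = seg_hs[OF hs(2) Gh Q]
  note QM = hsD(1)[OF Qh]
  obtain l m where lm: "0 \<le> l" "0 \<le> m" "Q = l *\<^sub>R y' + m *\<^sub>R G t"
    using hs_coeffs[OF hs(2) Gh Q] by metis
  obtain a b where ab: "0 \<le> a" "0 \<le> b" "G t = a *\<^sub>R x' + b *\<^sub>R w'"
    using hs_coeffs[OF hs(1,4) G_seg, of t] t by (metis less_imp_le)
  have Qe: "Q = (m * a) *\<^sub>R x' + (l *\<^sub>R y' + (m * b) *\<^sub>R w')"
    unfolding lm(3) ab(3) by (simp add: algebra_simps)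
  show ?thesis
  proof (cases "l + m * b = 0")
    case True
    then have "l = 0" "m * b = 0" using lm ab by (auto simp: add_nonneg_eq_0_iff)
    then have e: "Q = (m * a) *\<^sub>R x'" using Qe by auto
    have "0 \<le> m * a" "m * a \<noteq> 0" using lm ab e QM zero_notin_model by auto
    then have "0 < m * a" by (simp only: order.strict_iff_order) auto
    then have "m * a = 1" using model_plane_proportional[OF XM(1), of "m * a"] e QM by simp
    then show ?thesis using e False by simp
  next
    case l0: False
    have "0 < l + m * b" using l0 lm ab by (smt (verit) mult_nonneg_nonneg)
    then obtain k where k: "0 < k" "k *\<^sub>R (l *\<^sub>R y' + (m * b) *\<^sub>R w') \<in> half_plane \<kappa> e"
      using normalize_comb[OF hs(2,4), of l "m * b"] lm ab by auto
    define S where "S = k *\<^sub>R (l *\<^sub>R y' + (m * b) *\<^sub>R w')"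
    have Sh: "S \<in> half_plane \<kappa> e" using k by (simp add: S_def)
    note SM = hsD(1)[OF Sh]
    have "S \<in> seg \<kappa> y' w'"
      by (rule hs_seg[OF hs(2,4) SM, of "k * l" "k * (m * b)"])
        (use k lm ab in \<open>auto simp: S_def scaleR_add_right\<close>)
    moreover have "Q \<in> seg \<kappa> x' S"
      by (rule hs_seg[OF hs(1) Sh QM, of "m * a" "1 / k"]) (use k lm ab Qe in \<open>auto simp: S_def\<close>)
    ultimately show ?thesis
      using model_dist_triangle[OF QM SM XM(4)] model_dist_triangle[OF XM(1,2) SM] by (simp add: seg_iff)
  qed
qed

end

section \<open>Model distances for points between y and the segment [x, w]\<close>

context cevian begin

text \<open>These distances are the data that will determine a point over an interior C. The
  parameters 0 and L include the distances to x and w.\<close>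

definition ok :: "'b \<Rightarrow> real^3 \<Rightarrow> bool" where
  "ok c C \<longleftrightarrow> c \<in> Y \<and> C \<in> half_plane \<kappa> e \<and> d c y = model_dist \<kappa> C y' \<and> d c z = model_dist \<kappa> C z' \<and>
     (\<forall>s. 0 \<le> s \<longrightarrow> s \<le> L \<longrightarrow> d c (F s) = model_dist \<kappa> C (G s))"

definition on_y :: "real \<Rightarrow> 'b \<Rightarrow> real^3 \<Rightarrow> bool" where
  "on_y t q Q \<longleftrightarrow> q \<in> Y \<and> Q \<in> seg \<kappa> y' (G t) \<and>
     d y q = model_dist \<kappa> y' Q \<and> d q (F t) = model_dist \<kappa> Q (G t)"

lemma small3: "a \<in> half_plane \<kappa> e \<Longrightarrow> b \<in> half_plane \<kappa> e \<Longrightarrow> c \<in> half_plane \<kappa> e \<Longrightarrow>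
    r \<le> model_dist \<kappa> a b + model_dist \<kappa> b c + model_dist \<kappa> c a \<Longrightarrow> small \<kappa> r"
  using hs_small smallD by blast

lemma F_lower:
  assumes t: "0 \<le> t" "t \<le> L" and c: "c \<in> Y" "C \<in> half_plane \<kappa> e" "d x c = model_dist \<kappa> x' C" "d w c = model_dist \<kappa> w' C"
  shows "model_dist \<kappa> (G t) C \<le> d (F t) c"
proof (rule lower_bound[OF XY(1,4) c(1) F_Y[OF t] XM(1,4) hsD(1)[OF c(2)] G_seg[OF t]])
  show "d x (F t) = model_dist \<kappa> x' (G t)" "d (F t) w = model_dist \<kappa> (G t) w'"
    using F_G[of 0 t] F_G[of t L] t L_pos F_ends G_ends by auto
  show "d x w = model_dist \<kappa> x' w'" "model_dist \<kappa> x' C \<le> d x c" "model_dist \<kappa> w' C \<le> d w c"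
    using dist c by auto
  show "small \<kappa> (d x w + d w c + d c x)"
    by (rule small3[OF hs(1,4) c(2)]) (use dist c in \<open>auto simp: d_sym model_dist_sym\<close>)
qed

lemma F_y_lower: "0 \<le> t \<Longrightarrow> t \<le> L \<Longrightarrow> model_dist \<kappa> (G t) y' \<le> d (F t) y"
  and F_z_lower: "0 \<le> t \<Longrightarrow> t \<le> L \<Longrightarrow> model_dist \<kappa> (G t) z' \<le> d (F t) z"
  by (rule F_lower; use XY hs dist in \<open>simp add: d_sym model_dist_sym\<close>)+

text \<open>Backward reading at w, between y and z, with third point F t; the lower bound it needs
  at z is \<open>F_z_lower\<close>.\<close>

lemma F_y_upper:
  assumes t: "0 \<le> t" "t \<le> L"
  shows "d y (F t) \<le> model_dist \<kappa> y' (G t)"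
proof -
  have xF: "d x (F t) = t" "d (F t) w = L - t" "model_dist \<kappa> (G t) w' = L - t"
    using F_dist[of 0 t] F_dist[of t L] G_dist[of t L] t L_pos F_ends G_ends by auto
  \<comment> \<open>The detour from b to F t through x bounds the perimeter by that of w, b, x,
    since F t lies between x and w.\<close>
  have sm: "small \<kappa> (d w b + d b (F t) + d (F t) w)" if "b \<in> {y, z}" for b
  proof -
    define B where "B = (if b = y then y' else z')"
    have B: "B \<in> half_plane \<kappa> e" "d x b = model_dist \<kappa> x' B" "d w b = model_dist \<kappa> w' B" "b \<in> Y"
      using that hs dist XY by (auto simp: d_sym model_dist_sym B_def)
    have "d b (F t) \<le> d b x + t" using d_triangle[of b x "F t"] B XY F_Y t xF by auto
    then show ?thesis
      by (intro small3[OF hs(4) B(1) hs(1)]) (use B xF L in \<open>auto simp: d_sym model_dist_sym\<close>)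
  qed
  show ?thesis
  proof (rule upper_bound[OF XY(2,3) F_Y[OF t] XY(4) XM(2,3) G_M w'(1)])
    show "0 < d y w" "0 < d w z"
      using dist model_dist_pos[OF XM(2,4)] model_dist_pos[OF XM(4,3)] w'
      by (auto simp: d_sym model_dist_sym)
    show "d y w = model_dist \<kappa> y' w'" "d w z = model_dist \<kappa> w' z'" "d y z = model_dist \<kappa> y' z'"
      using dist by (auto simp: d_sym model_dist_sym)
    show "short \<kappa> (model_dist \<kappa> y' z')" by (rule hs_short[OF hs(2,3)])
    show "d w (F t) = model_dist \<kappa> w' (G t)" using xF by (simp add: d_sym model_dist_sym)
    show "model_dist \<kappa> z' (G t) \<le> d z (F t)"
      using F_z_lower[OF t] by (simp add: d_sym model_dist_sym)
  qed (use sm in \<open>auto simp: add_ac\<close>)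
qed

lemma F_y: "0 \<le> t \<Longrightarrow> t \<le> L \<Longrightarrow> d (F t) y = model_dist \<kappa> (G t) y'"
  using F_y_upper[of t] F_y_lower[of t] by (auto simp: d_sym model_dist_sym)

lemma F_z: "0 \<le> t \<Longrightarrow> t \<le> L \<Longrightarrow> d (F t) z = model_dist \<kappa> (G t) z'"
  using cevian.F_y[OF swap, of t] by simp

lemma ok_F: "0 \<le> t \<Longrightarrow> t \<le> L \<Longrightarrow> ok (F t) (G t)"
  using F_y F_z F_G F_Y G_hs by (auto simp: ok_def)

lemma ok_y: "ok y y'"
  using XY hs dist F_y XM by (auto simp: ok_def d_self d_sym model_dist_sym)

lemma ok_z: "ok z z'"
  using XY hs dist F_z XM by (auto simp: ok_def d_self d_sym model_dist_sym)

lemma okD: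
  assumes "ok c C"
  shows "c \<in> Y" "C \<in> half_plane \<kappa> e" "C \<in> model_plane \<kappa>" "d c y = model_dist \<kappa> C y'" "d c z = model_dist \<kappa> C z'"
    "0 \<le> s \<Longrightarrow> s \<le> L \<Longrightarrow> d c (F s) = model_dist \<kappa> C (G s)"
  using assms hsD by (auto simp: ok_def)

lemma on_y_hs: "0 \<le> t \<Longrightarrow> t \<le> L \<Longrightarrow> on_y t q Q \<Longrightarrow> Q \<in> half_plane \<kappa> e"
  using seg_hs[OF hs(2) G_hs] by (auto simp: on_y_def)

lemma on_y_lower:
  assumes t: "0 \<le> t" "t \<le> L" and q: "on_y t q Q" and c: "ok c C"
  shows "model_dist \<kappa> Q C \<le> d q c"
proof (rule lower_bound[OF XY(2) F_Y[OF t] okD(1)[OF c] _ XM(2) G_M okD(3)[OF c]])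
  show "q \<in> Y" "Q \<in> seg \<kappa> y' (G t)" "d y q = model_dist \<kappa> y' Q" "d q (F t) = model_dist \<kappa> Q (G t)"
    using q by (auto simp: on_y_def)
  show "d y (F t) = model_dist \<kappa> y' (G t)" using F_y[OF t] by (simp add: d_sym model_dist_sym)
  show "model_dist \<kappa> y' C \<le> d y c" "model_dist \<kappa> (G t) C \<le> d (F t) c"
    using okD[OF c] t by (auto simp: d_sym model_dist_sym)
  show "small \<kappa> (d y (F t) + d (F t) c + d c y)"
    by (rule small3[OF hs(2) G_hs[OF t] okD(2)[OF c]])
      (use okD[OF c] t F_y[OF t] in \<open>auto simp: d_sym model_dist_sym\<close>)
qed

text \<open>Backward reading at F t along [x, w], using the end F r on the other side of F t from F
  s. The lower bound at that end comes from \<open>on_y_lower\<close>.\<close>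

lemma on_y_F:
  assumes t: "0 < t" "t < L" and q: "on_y t q Q" and s: "0 \<le> s" "s \<le> L"
  shows "d q (F s) = model_dist \<kappa> Q (G s)"
proof (cases "s = t")
  case True
  then show ?thesis using q by (simp add: on_y_def)
next
  case False
  have qY: "q \<in> Y" and Q: "Q \<in> seg \<kappa> y' (G t)"
    and qd: "d y q = model_dist \<kappa> y' Q" "d q (F t) = model_dist \<kappa> Q (G t)"
    using q by (auto simp: on_y_def)
  have t': "0 \<le> t" "t \<le> L" using t by auto
  note Qh = on_y_hs[OF t' q]
  have ys: "d y q + d q (F t) = d y (F t)"
    using Q qd F_y[OF t'] by (auto simp: seg_iff d_sym model_dist_sym)
  \<comment> \<open>The detour through y bounds this perimeter by that of F t, F r, y, since q lies
    between y and F t.\<close>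
  have sm: "small \<kappa> (d (F t) (F r) + d (F r) q + d q (F t))" if r: "0 \<le> r" "r \<le> L" for r
  proof -
    have "d (F r) q \<le> d (F r) y + d y q" by (rule d_triangle) (use XY qY F_Y r in auto)
    then show ?thesis
      by (intro small3[OF G_hs[OF t'] G_hs[OF r] hs(2)])
        (use ys F_G[OF t' r] F_y[OF r] F_y[OF t'] in \<open>auto simp: d_sym model_dist_sym\<close>)
  qed
  define r where "r = (if s < t then L else 0)"
  have r: "0 \<le> r" "r \<le> L" using L_pos by (auto simp: r_def)
  have "d (F s) q \<le> model_dist \<kappa> (G s) Q"
  proof (rule upper_bound[OF F_Y[OF s] F_Y[OF r] qY F_Y[OF t'] G_M G_M hsD(1)[OF Qh]])
    show "G t \<in> seg \<kappa> (G s) (G r)"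
      using G_dist[OF s r] G_dist[OF s t'] G_dist[OF t' r] G_M False t s by (auto simp: seg_iff r_def)
    show "0 < d (F s) (F t)" "0 < d (F t) (F r)"
      using F_dist[OF s t'] F_dist[OF t' r] False t by (auto simp: r_def)
    show "short \<kappa> (model_dist \<kappa> (G s) (G r))" by (rule hs_short[OF G_hs[OF s] G_hs[OF r]])
    show "d (F t) q = model_dist \<kappa> (G t) Q" using qd by (simp add: d_sym model_dist_sym)
    show "model_dist \<kappa> (G r) Q \<le> d (F r) q"
      using on_y_lower[OF t' q ok_F[OF r]] by (simp add: d_sym model_dist_sym)
  qed (use F_G[OF s t'] F_G[OF t' r] F_G[OF s r] sm[OF s] sm[OF r] in auto)
  then show ?thesis using on_y_lower[OF t' q ok_F[OF s]] by (simp add: d_sym model_dist_sym)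
qed

text \<open>Backward reading at w, between z and y, with third point q: d(y, q) is exact by
  construction and d(w, q) by \<open>on_y_F\<close>.\<close>

lemma on_y_z:
  assumes t: "0 < t" "t < L" and q: "on_y t q Q"
  shows "d q z = model_dist \<kappa> Q z'"
proof -
  have qY: "q \<in> Y" and Q: "Q \<in> seg \<kappa> y' (G t)" and qd: "d y q = model_dist \<kappa> y' Q"
    using q by (auto simp: on_y_def)
  have t': "0 \<le> t" "t \<le> L" using t by auto
  note Qh = on_y_hs[OF t' q]
  have qw: "d q w = model_dist \<kappa> Q w'" and qx: "d q x = model_dist \<kappa> Q x'"
    using on_y_F[OF t q, of L] on_y_F[OF t q, of 0] F_ends G_ends L_pos by auto
  have "d z q \<le> model_dist \<kappa> z' Q"
  proof (rule upper_bound[OF XY(3,2) qY XY(4) XM(3,2) hsD(1)[OF Qh]])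
    show "w' \<in> seg \<kappa> z' y'" using w'(1) by (simp add: seg_sym)
    show "0 < d w y" "0 < d z w"
      using dist model_dist_pos[OF XM(2,4)] model_dist_pos[OF XM(3,4)] w'
      by (auto simp: d_sym model_dist_sym)
    show "short \<kappa> (model_dist \<kappa> z' y')" by (rule hs_short[OF hs(3,2)])
    show "d z w = model_dist \<kappa> z' w'" "d w y = model_dist \<kappa> w' y'" "d z y = model_dist \<kappa> z' y'"
      using dist by (auto simp: d_sym model_dist_sym)
    show "d w q = model_dist \<kappa> w' Q" "model_dist \<kappa> y' Q \<le> d y q"
      using qw qd by (auto simp: d_sym model_dist_sym)
    show "small \<kappa> (d w y + d y q + d q w)"
      by (rule small3[OF hs(4,2) Qh]) (use dist qw qd in \<open>auto simp: d_sym model_dist_sym\<close>)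
    \<comment> \<open>The detour from z to q through x, together with \<open>inner_path_le\<close>,
      bounds the perimeter of w, z, q by that of x, y, z.\<close>
    have "d z q \<le> d z x + d x q" by (rule d_triangle) (use XY qY in auto)
    moreover have "model_dist \<kappa> y' z' = model_dist \<kappa> y' w' + model_dist \<kappa> w' z'"
      using w'(1) by (simp add: seg_iff)
    ultimately show "small \<kappa> (d w z + d z q + d q w)"
      using inner_path_le[OF t'(1) t(2) Q] dist qw qx
      by (intro small3[OF hs(1,2,3)]) (auto simp: d_sym model_dist_sym)
  qed
  then show ?thesis using on_y_lower[OF t' q ok_z] by (simp add: d_sym model_dist_sym)
qed

lemma on_y_ok: "0 < t \<Longrightarrow> t < L \<Longrightarrow> on_y t q Q \<Longrightarrow> ok q Q"
  using on_y_F[of t q Q] on_y_z[of t q Q] on_y_hs[of t q Q]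
  by (auto simp: ok_def on_y_def d_sym model_dist_sym)

lemma swap_ok: "cevian.ok \<kappa> Y d e z y x' z' y' w' F L = ok"
  by (intro ext) (auto simp: cevian.ok_def[OF swap] ok_def)

text \<open>The upper bound comes from a point \<open>r\<close> on the far side of \<open>[x, w]\<close>, chosen so close to
  \<open>F t\<close> that the perimeters involved stay small.\<close>

lemma on_y_exact:
  assumes t: "0 < t" "t < L" and q: "on_y t q Q" and c: "ok c C"
  shows "d q c = model_dist \<kappa> Q C"
proof -
  have qY: "q \<in> Y" and Q: "Q \<in> seg \<kappa> y' (G t)"
    and qd: "d y q = model_dist \<kappa> y' Q" "d q (F t) = model_dist \<kappa> Q (G t)"
    using q by (auto simp: on_y_def)
  have t': "0 \<le> t" "t \<le> L" using t by auto
  note Qh = on_y_hs[OF t' q]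
  note QM = hsD(1)[OF Qh]
  note Gh = G_hs[OF t']
  note cc = okD[OF c]
  have ys: "d y q + d q (F t) = d y (F t)"
    using Q qd F_y[OF t'] by (auto simp: seg_iff d_sym model_dist_sym)
  have "d q c \<le> model_dist \<kappa> Q C"
  proof (cases "Q = G t")
    case True
    then have "d q (F t) = 0" using qd QM by simp
    then show ?thesis using d_zero_dist[OF qY F_Y[OF t'] cc(1)] cc(6)[OF t'] True
      by (simp add: d_sym model_dist_sym)
  next
    case False
    \<comment> \<open>Keeps d(F t, r) + d(F t, c) below the diameter, so that the perimeter on the
      far side is small whatever d(r, c) turns out to be.\<close>
    define \<delta> where "\<delta> = (if \<kappa> > 0 then dia \<kappa> - model_dist \<kappa> (G t) C else 1)"
    have "0 < \<delta>" using hs_short[OF Gh cc(2)] by (simp add: \<delta>_def short_def)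
    obtain R s where s: "0 < s" "s < L" and R: "R \<in> seg \<kappa> z' (G s)" "R \<in> half_plane \<kappa> e"
      "0 < model_dist \<kappa> (G t) R" "model_dist \<kappa> (G t) R < \<delta>" "G t \<in> seg \<kappa> Q R"
      using beyond[OF t Q False \<open>0 < \<delta>\<close>] by blast
    have s': "0 \<le> s" "s \<le> L" using s by auto
    note RM = hsD(1)[OF R(2)]
    have zF: "d z (F s) = model_dist \<kappa> z' (G s)"
      using F_z[OF s'] by (simp add: d_sym model_dist_sym)
    have zs: "d z (F s) = model_dist \<kappa> z' R + model_dist \<kappa> R (G s)"
      using R(1) zF by (simp add: seg_iff)
    then have "model_dist \<kappa> z' R \<le> d z (F s)" using model_dist_nonneg[OF RM G_M[of s]] by linarith
    then obtain r where r: "r \<in> Y" "d z r = model_dist \<kappa> z' R" "d r (F s) = d z (F s) - model_dist \<kappa> z' R"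
      using geodesic[OF XY(3) F_Y[OF s'] model_dist_nonneg[OF XM(3) RM]] by blast
    have r3: "d r (F s) = model_dist \<kappa> R (G s)" using r(3) zs by linarith
    have onz: "cevian.on_y \<kappa> Y d z x' z' w' F s r R"
      using r(1,2) r3 R(1) by (simp add: cevian.on_y_def[OF swap])
    have okr: "ok r R" using cevian.on_y_ok[OF swap s onz] swap_ok by simp
    have low: "model_dist \<kappa> R D \<le> d r b" if "ok b D" for b D
      using cevian.on_y_lower[OF swap s' onz, of b D] that swap_ok by simp
    have rc: "model_dist \<kappa> R C \<le> d r c" by (rule low[OF c])
    have Ftr: "d (F t) r = model_dist \<kappa> (G t) R"
      using okD(6)[OF okr t'] by (simp add: d_sym model_dist_sym)
    have sumR: "model_dist \<kappa> Q R = model_dist \<kappa> Q (G t) + model_dist \<kappa> (G t) R"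
      using R(5) by (simp add: seg_iff)
    \<comment> \<open>The points q, F t, r are aligned as in the model: the triangle inequality
      through F t meets the lower bound available for r as a point on the z side.\<close>
    have qr: "d q r = model_dist \<kappa> Q R"
    proof (rule antisym)
      show "d q r \<le> model_dist \<kappa> Q R"
        using d_triangle[OF qY F_Y[OF t'] r(1)] qd Ftr sumR by simp
      show "model_dist \<kappa> Q R \<le> d q r"
        using low[OF on_y_ok[OF t q]] by (simp add: d_sym model_dist_sym)
    qed
    have cF: "d (F t) c = model_dist \<kappa> (G t) C" using cc(6)[OF t'] by (simp add: d_sym model_dist_sym)
    show ?thesis
    proof (rule upper_bound[OF qY r(1) cc(1) F_Y[OF t'] QM RM cc(3) R(5)])
      show "0 < d q (F t)" using qd model_dist_pos[OF QM G_M False] by simp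
      show "0 < d (F t) r" using Ftr R(3) by simp
      show "short \<kappa> (model_dist \<kappa> Q R)" by (rule hs_short[OF Qh R(2)])
      have "d q c \<le> d q y + d y c" by (rule d_triangle[OF qY XY(2) cc(1)])
      then show "small \<kappa> (d (F t) q + d q c + d c (F t))"
        by (intro small3[OF Gh hs(2) cc(2)])
          (use ys F_y[OF t'] cc(4) cF in \<open>auto simp: d_sym model_dist_sym\<close>)
      have "d r c \<le> d r (F t) + d (F t) c" by (rule d_triangle[OF r(1) F_Y[OF t'] cc(1)])
      then have "d (F t) r + d r c + d c (F t) \<le> 2 * (model_dist \<kappa> (G t) R + model_dist \<kappa> (G t) C)"
        using Ftr cF by (simp add: d_sym)
      moreover have "small \<kappa> (2 * (model_dist \<kappa> (G t) R + model_dist \<kappa> (G t) C))"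
        using R(4) by (auto simp: small_def \<delta>_def)
      ultimately show "small \<kappa> (d (F t) r + d r c + d c (F t))" using smallD by blast
    qed (use qd Ftr qr cF rc in auto)
  qed
  then show ?thesis using on_y_lower[OF t' q c] by simp
qed

lemma on_y_unique:
  assumes t: "0 < t" "t < L" and q: "on_y t q Q" and r: "ok r Q"
  shows "d q r = 0"
  using on_y_exact[OF t q r] okD(3)[OF r] by simp

text \<open>Uniqueness is what \<open>N_closed\<close> demands, so the point is found in
  \<open>N\<close> itself and not only in \<open>Y\<close>.\<close>

lemma on_y_exists:
  assumes t: "0 < t" "t < L" and Q: "Q \<in> seg \<kappa> y' (G t)"
  obtains q where "q \<in> N" "on_y t q Q"
proof -
  have t': "0 \<le> t" "t \<le> L" using t by auto
  have QM: "Q \<in> model_plane \<kappa>" using Q by (simp add: seg_iff)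
  have yF: "d y (F t) = model_dist \<kappa> y' (G t)"
    using F_y[OF t'] by (simp add: d_sym model_dist_sym)
  have sum: "model_dist \<kappa> y' (G t) = model_dist \<kappa> y' Q + model_dist \<kappa> Q (G t)"
    using Q by (simp add: seg_iff)
  have "\<exists>u\<in>N. d y u = model_dist \<kappa> y' Q \<and> d u (F t) = d y (F t) - model_dist \<kappa> y' Q"
  proof (rule N_closed[OF N4(2) F_N[OF t']])
    show "0 \<le> model_dist \<kappa> y' Q" "model_dist \<kappa> y' Q \<le> d y (F t)"
      using model_dist_nonneg XM QM G_M sum yF by auto
    fix u u' assume u: "u \<in> Y" "u' \<in> Y" "d y u = model_dist \<kappa> y' Q"
      "d u (F t) = d y (F t) - model_dist \<kappa> y' Q" "d y u' = model_dist \<kappa> y' Q"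
      "d u' (F t) = d y (F t) - model_dist \<kappa> y' Q"
    then have "on_y t u Q" "on_y t u' Q" using Q yF sum by (auto simp: on_y_def)
    then show "d u u' = 0" using on_y_unique[OF t] on_y_ok[OF t] by blast
  qed
  then show ?thesis using that Q yF sum N_Y by (auto simp: on_y_def)
qed

end

section \<open>Ultralimits\<close>

text \<open>Ultrafilters are the minimal proper filters, obtained from Zorn's lemma for the reversed
  order. The infimum of a chain is proper because whatever holds eventually for it holds eventually
  for some member.\<close>

lemma ultrafilter_exists:
  fixes F :: "'i filter"
  assumes "F \<noteq> bot"
  obtains U where "U \<le> F" "U \<noteq> bot" "\<And>V. V \<le> U \<Longrightarrow> V \<noteq> bot \<Longrightarrow> V = U"
proof -
  let ?A = "{V. V \<le> F \<and> V \<noteq> bot}" and ?P = "\<lambda>V W :: 'i filter. W \<le> V"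
  have "\<exists>m\<in>?A. \<forall>a\<in>?A. ?P m a \<longrightarrow> a = m"
  proof (rule predicate_Zorn)
    show "partial_order_on ?A (relation_of ?P ?A)"
      by (auto simp: partial_order_on_def preorder_on_def refl_on_def trans_def antisym_def relation_of_def)
    fix C assume C: "C \<in> Chains (relation_of ?P ?A)"
    then have CA: "C \<subseteq> ?A" and tot: "\<And>V W. V \<in> C \<Longrightarrow> W \<in> C \<Longrightarrow> V \<le> W \<or> W \<le> V"
      by (auto simp: Chains_def relation_of_def)
    show "\<exists>u\<in>?A. \<forall>a\<in>C. ?P a u"
    proof (cases "C = {}")
      case True
      then show ?thesis using assms by auto
    next
      case False
      have "eventually P (Inf C) \<longleftrightarrow> (\<exists>b\<in>C. eventually P b)" for P
      proof (rule eventually_Inf_base[OF False])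
        fix V W assume "V \<in> C" "W \<in> C"
        then show "\<exists>x\<in>C. x \<le> inf V W" using tot[of V W] by (auto intro: bexI[of _ V] bexI[of _ W])
      qed
      then have "Inf C \<noteq> bot" using CA by (auto simp: trivial_limit_def)
      moreover have "Inf C \<le> F" using False CA by (auto intro: Inf_lower2)
      ultimately show ?thesis by (intro bexI[of _ "Inf C"]) (auto intro: Inf_lower)
    qed
  qed
  then obtain m where m: "m \<le> F" "m \<noteq> bot" "\<And>V. V \<le> F \<Longrightarrow> V \<noteq> bot \<Longrightarrow> V \<le> m \<Longrightarrow> V = m" by blast
  show ?thesis
  proof (rule that[OF m(1,2)])
    show "V = m" if "V \<le> m" "V \<noteq> bot" for V
      by (rule m(3)[OF order_trans[OF that(1) m(1)] that(2,1)])
  qed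
qed

text \<open>Minimality is the ultrafilter property; lying below \<open>sequentially\<close> makes
  ordinary limits persist.\<close>

definition ultra :: "nat filter" where
  "ultra = (SOME U. U \<le> sequentially \<and> U \<noteq> bot \<and> (\<forall>V\<le>U. V \<noteq> bot \<longrightarrow> V = U))"

lemma ultra: "ultra \<le> sequentially" "ultra \<noteq> bot" "V \<le> ultra \<Longrightarrow> V \<noteq> bot \<Longrightarrow> V = ultra"
proof -
  have "(sequentially :: nat filter) \<noteq> bot" by simp
  then obtain U :: "nat filter" where "U \<le> sequentially" "U \<noteq> bot" "\<And>V. V \<le> U \<Longrightarrow> V \<noteq> bot \<Longrightarrow> V = U"
    by (rule ultrafilter_exists) blast
  then have "\<exists>U :: nat filter. U \<le> sequentially \<and> U \<noteq> bot \<and> (\<forall>V\<le>U. V \<noteq> bot \<longrightarrow> V = U)"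
    by (intro exI[of _ U]) simp
  from someI_ex[OF this] show "ultra \<le> sequentially" "ultra \<noteq> bot"
    "V \<le> ultra \<Longrightarrow> V \<noteq> bot \<Longrightarrow> V = ultra" unfolding ultra_def by blast+
qed

text \<open>Compactness gives a cluster point. Restricting the filter to the preimage of a
  neighbourhood leaves it proper, hence unchanged by minimality, so the cluster point is a
  limit.\<close>

lemma ultra_converges:
  fixes f :: "nat \<Rightarrow> real"
  assumes "\<And>n. \<bar>f n\<bar> \<le> B"
  shows "(f \<longlongrightarrow> Lim ultra f) ultra"
proof -
  have "compact {-B..B}" by simp
  moreover have "filtermap f ultra \<noteq> bot" using ultra by (simp add: filtermap_bot_iff)
  moreover have "eventually (\<lambda>x. x \<in> {-B..B}) (filtermap f ultra)"
  proof -
    have "f n \<in> {-B..B}" for n using assms[of n] by auto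
    then show ?thesis unfolding eventually_filtermap by (intro always_eventually allI)
  qed
  ultimately obtain l where l: "inf (nhds l) (filtermap f ultra) \<noteq> bot"
    unfolding compact_filter by blast
  have "(f \<longlongrightarrow> l) ultra"
  proof (rule topological_tendstoI)
    fix S assume S: "open S" "l \<in> S"
    let ?V = "inf ultra (principal {i. f i \<in> S})"
    have "?V \<noteq> bot"
    proof
      assume "?V = bot"
      then have "eventually (\<lambda>i. f i \<notin> S) ultra"
        unfolding trivial_limit_def eventually_inf_principal by simp
      then have "eventually (\<lambda>x. x \<notin> S) (filtermap f ultra)" by (simp add: eventually_filtermap)
      moreover have "eventually (\<lambda>x. x \<in> S) (nhds l)" using S by (rule eventually_nhds_in_open)
      ultimately have "eventually (\<lambda>_. False) (inf (nhds l) (filtermap f ultra))"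
        unfolding eventually_inf by blast
      then show False using l by (simp add: trivial_limit_def)
    qed
    then have V: "?V = ultra" by (intro ultra(3)) auto
    have "eventually (\<lambda>i. f i \<in> S) ?V" unfolding eventually_inf_principal by simp
    then show "eventually (\<lambda>i. f i \<in> S) ultra" unfolding V .
  qed
  then show ?thesis using tendsto_Lim[OF ultra(2)] by blast
qed

text \<open>Sequences at distance zero are not identified, so this is only a pseudometric space.
  Boundedness makes all limits of distances exist.\<close>

definition ultrapower :: "'a::metric_space set \<Rightarrow> (nat \<Rightarrow> 'a) set" where
  "ultrapower X = {s. range s \<subseteq> X \<and> bounded (range s)}"

definition ultra_dist :: "(nat \<Rightarrow> 'a::metric_space) \<Rightarrow> (nat \<Rightarrow> 'a) \<Rightarrow> real" where
  "ultra_dist s r = Lim ultra (\<lambda>n. dist (s n) (r n))"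

lemma ultra_dist_tendsto:
  assumes "s \<in> ultrapower X" "r \<in> ultrapower X"
  shows "((\<lambda>n. dist (s n) (r n)) \<longlongrightarrow> ultra_dist s r) ultra"
proof -
  have "bounded (range s \<union> range r)" using assms by (auto simp: ultrapower_def)
  then obtain B where "\<And>x y. x \<in> range s \<union> range r \<Longrightarrow> y \<in> range s \<union> range r \<Longrightarrow> dist x y \<le> B"
    by (meson bounded_two_points)
  then have "\<bar>dist (s n) (r n)\<bar> \<le> B" for n by auto
  then show ?thesis unfolding ultra_dist_def by (rule ultra_converges)
qed

lemma ultra_dist_eqI: "((\<lambda>n. dist (s n) (r n)) \<longlongrightarrow> l) ultra \<Longrightarrow> ultra_dist s r = l"
  unfolding ultra_dist_def by (rule tendsto_Lim[OF ultra(2)])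

lemma ultra_dist_const [simp]: "ultra_dist (\<lambda>_. a) (\<lambda>_. b) = dist a b"
  by (rule ultra_dist_eqI) simp

lemma const_ultrapower [simp]: "(\<lambda>_. a) \<in> ultrapower X \<longleftrightarrow> a \<in> X"
  by (auto simp: ultrapower_def)

lemma ultra_dist_sym: "ultra_dist s r = ultra_dist r s"
  by (simp add: ultra_dist_def dist_commute)

lemma ultra_dist_nonneg: "s \<in> ultrapower X \<Longrightarrow> r \<in> ultrapower X \<Longrightarrow> 0 \<le> ultra_dist s r"
  by (rule tendsto_lowerbound[OF ultra_dist_tendsto always_eventually ultra(2)]) auto

lemma ultra_dist_triangle:
  assumes "s \<in> ultrapower X" "r \<in> ultrapower X" "t \<in> ultrapower X"
  shows "ultra_dist s t \<le> ultra_dist s r + ultra_dist r t"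
  by (rule tendsto_le[OF ultra(2) tendsto_add[OF ultra_dist_tendsto ultra_dist_tendsto] ultra_dist_tendsto])
    (use assms in \<open>auto intro!: always_eventually dist_triangle\<close>)

lemma ultrapower_boundedI:
  assumes "a \<in> ultrapower X" "\<And>n. u n \<in> X" "\<And>n. dist (a n) (u n) \<le> B"
  shows "u \<in> ultrapower X"
proof -
  obtain e c where "\<And>n. dist c (a n) \<le> e" using assms(1) by (auto simp: ultrapower_def bounded_def)
  then have "dist c (u n) \<le> e + B" for n
    using dist_triangle[of c "u n" "a n"] assms(3)[of n] by (smt (verit))
  then have "bounded (range u)" by (auto simp: bounded_def)
  then show ?thesis using assms(2) by (auto simp: ultrapower_def)
qed

section \<open>Length spaces and the comparison inequality\<close>

text \<open>A nearly shortest curve passes through distance t from a by continuity, at a time s. Its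
  length over the partition 0, s, 1 bounds the remaining distance to b.\<close>

lemma length_space_between:
  assumes X: "length_space X" "a \<in> X" "b \<in> X" and t: "0 \<le> t" "t \<le> dist a b" and "0 < \<epsilon>"
  obtains u where "u \<in> X" "dist a u = t" "dist u b \<le> dist a b - t + \<epsilon>"
proof -
  let ?S = "{g. path g \<and> path_image g \<subseteq> X \<and> pathstart g = a \<and> pathfinish g = b}"
  have "(INF g \<in> ?S. curve_length g) = ereal (dist a b)" using X by (auto simp: length_space_def)
  also have "\<dots> < ereal (dist a b + \<epsilon>)" using \<open>0 < \<epsilon>\<close> by simp
  finally obtain g where g: "path g" "path_image g \<subseteq> X" "pathstart g = a" "pathfinish g = b"
    and len: "curve_length g < ereal (dist a b + \<epsilon>)"
    by (auto simp: INF_less_iff)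
  have "continuous_on {0..1} (\<lambda>s. dist a (g s))"
    using g by (intro continuous_intros) (auto simp: path_def)
  then have "\<exists>s\<ge>0. s \<le> 1 \<and> dist a (g s) = t"
    by (intro IVT') (use g t in \<open>auto simp: pathstart_def pathfinish_def\<close>)
  then obtain s where s: "0 \<le> s" "s \<le> 1" "dist a (g s) = t" by blast
  define p :: "nat \<Rightarrow> real" where "p i = (if i = 0 then 0 else if i = 1 then s else 1)" for i
  have "mono_on {..2} p" using s by (auto simp: p_def mono_on_def)
  moreover have "p ` {..2} \<subseteq> {0..1}" using s by (auto simp: p_def)
  ultimately have "ereal (\<Sum>i<2. dist (g (p i)) (g (p (Suc i)))) \<le> curve_length g"
    unfolding curve_length_def by (intro SUP_upper2[of "(2, p)"]) auto
  also have "(\<Sum>i<2. dist (g (p i)) (g (p (Suc i)))) = dist a (g s) + dist (g s) b"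
    using g by (simp add: p_def numeral_2_eq_2 pathstart_def pathfinish_def)
  finally have "dist a (g s) + dist (g s) b < dist a b + \<epsilon>" using len
    by (metis ereal_less_eq(3) less_ereal.simps(1) order_le_less_trans)
  moreover have "g s \<in> X" using g s by (auto simp: path_image_def)
  ultimately show ?thesis using that s by auto
qed

text \<open>The cosine of the comparison angle between sides r and s opposite to t, as a function of
  lengths alone so that limits can be taken.\<close>

definition cosk :: "real \<Rightarrow> real \<Rightarrow> real \<Rightarrow> real \<Rightarrow> real" where
  "cosk \<kappa> r s t = (sig \<kappa> r + sig \<kappa> s - \<kappa> * sig \<kappa> r * sig \<kappa> s - sig \<kappa> t) / (snk \<kappa> r * snk \<kappa> s)"

text \<open>The triangle inequalities place \<open>sig\<close> of t between its values at r - s and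
  r + s, where the addition formula makes the quotient 1 and -1.\<close>

lemma cosk_bounds:
  assumes "0 < r" "0 < s" "0 \<le> t" "t \<le> r + s" "r \<le> s + t" "s \<le> r + t" "small \<kappa> (r + s + t)"
  shows "- 1 \<le> cosk \<kappa> r s t" "cosk \<kappa> r s t \<le> 1"
proof -
  have sh: "short \<kappa> r" "short \<kappa> s" "short \<kappa> t"
    using small_short[OF assms(7)] assms by auto
  have pos: "0 < snk \<kappa> r * snk \<kappa> s" using snk_pos assms sh by simp
  have "sig \<kappa> t \<le> sig \<kappa> (r + s)" by (rule sig_le_of_triangle) (use assms in auto)
  then have "- (snk \<kappa> r * snk \<kappa> s) \<le> sig \<kappa> r + sig \<kappa> s - \<kappa> * sig \<kappa> r * sig \<kappa> s - sig \<kappa> t"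
    unfolding sig_add by simp
  then show "- 1 \<le> cosk \<kappa> r s t" using pos by (simp add: cosk_def field_simps)
  have "sig \<kappa> \<bar>r - s\<bar> \<le> sig \<kappa> t"
    by (rule sig_mono) (use assms short_fits[OF sh(3)] in auto)
  then have "sig \<kappa> r + sig \<kappa> s - \<kappa> * sig \<kappa> r * sig \<kappa> s - snk \<kappa> r * snk \<kappa> s \<le> sig \<kappa> t"
    using sig_add[of \<kappa> r "- s"] by simp
  then show "cosk \<kappa> r s t \<le> 1" using pos by (simp add: cosk_def field_simps)
qed

lemma cosk_tendsto:
  assumes "(r \<longlongrightarrow> R) F" "(s \<longlongrightarrow> S) F" "(t \<longlongrightarrow> T) F" "0 < R" "0 < S" "short \<kappa> R" "short \<kappa> S"
  shows "((\<lambda>n. cosk \<kappa> (r n) (s n) (t n)) \<longlongrightarrow> cosk \<kappa> R S T) F"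
  unfolding cosk_def using assms snk_pos[of R \<kappa>] snk_pos[of S \<kappa>]
  by (intro tendsto_intros) auto

text \<open>Points of X need only be approximately between two others, so the quadruple condition is
  applied to them and passed to the limit. There the first angle is pi, and the other two add up to
  at most pi, that is, their cosines have a nonnegative sum.\<close>

lemma curvature_stewart_limit:
  fixes X :: "'a::metric_space set" and F :: "'b filter"
  assumes X: "curvature_ge \<kappa> X" and F: "F \<noteq> bot"
    and mem: "\<And>n. a n \<in> X" "\<And>n. b n \<in> X" "\<And>n. c n \<in> X" "\<And>n. u n \<in> X"
    and lim: "((\<lambda>n. dist (u n) (a n)) \<longlongrightarrow> \<alpha>) F" "((\<lambda>n. dist (u n) (b n)) \<longlongrightarrow> \<beta>) F"
      "((\<lambda>n. dist (u n) (c n)) \<longlongrightarrow> s) F" "((\<lambda>n. dist (a n) (c n)) \<longlongrightarrow> A) F"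
      "((\<lambda>n. dist (b n) (c n)) \<longlongrightarrow> B) F" "((\<lambda>n. dist (a n) (b n)) \<longlongrightarrow> \<alpha> + \<beta>) F"
    and pos: "0 < \<alpha>" "0 < \<beta>" "0 < s" "0 < A" "0 < B"
    and small: "small \<kappa> (\<alpha> + \<beta> + A + B)"
  shows "snk \<kappa> \<beta> * (sig \<kappa> A - sig \<kappa> \<alpha>) + snk \<kappa> \<alpha> * (sig \<kappa> B - sig \<kappa> \<beta>)
    \<le> snk \<kappa> (\<alpha> + \<beta>) * sig \<kappa> s"
proof -
  have le: "l \<le> m + k" if "(f \<longlongrightarrow> l) F" "(g \<longlongrightarrow> m) F" "(h \<longlongrightarrow> k) F" "\<And>n. f n \<le> g n + h n"
    for f g h :: "'b \<Rightarrow> real" and l m k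
    by (rule tendsto_le[OF F tendsto_add[OF that(2,3)] that(1)]) (simp add: that(4))
  have tri: "A \<le> \<alpha> + s" "\<alpha> \<le> s + A" "s \<le> \<alpha> + A" "B \<le> \<beta> + s" "\<beta> \<le> s + B" "s \<le> \<beta> + B"
    "\<alpha> + \<beta> \<le> A + B"
    using le[OF lim(4,1,3) dist_triangle3] le[OF lim(1,3,4) dist_triangle2] le[OF lim(3,1,4) dist_triangle]
      le[OF lim(5,2,3) dist_triangle3] le[OF lim(2,3,5) dist_triangle2] le[OF lim(3,2,5) dist_triangle]
      le[OF lim(6,4,5) dist_triangle2] by auto
  have sh: "short \<kappa> \<alpha>" "short \<kappa> \<beta>" "short \<kappa> s"
    by (rule small_short[OF small], use tri in linarith)+
  have sm: "small \<kappa> (\<alpha> + \<beta> + (\<alpha> + \<beta>))" "small \<kappa> (\<alpha> + s + A)" "small \<kappa> (\<beta> + s + B)"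
    by (rule smallD[OF small], use tri in linarith)+
  let ?c1 = "\<lambda>n. cosk \<kappa> (dist (u n) (a n)) (dist (u n) (b n)) (dist (a n) (b n))"
  let ?c2 = "\<lambda>n. cosk \<kappa> (dist (u n) (b n)) (dist (u n) (c n)) (dist (b n) (c n))"
  let ?c3 = "\<lambda>n. cosk \<kappa> (dist (u n) (c n)) (dist (u n) (a n)) (dist (c n) (a n))"
  have angle: "comparison_angle \<kappa> p q r = arccos (cosk \<kappa> (dist p q) (dist p r) (dist q r))" for p q r :: 'a
    by (simp add: comparison_angle_sig cosk_def)
  have lim': "((\<lambda>n. dist (c n) (a n)) \<longlongrightarrow> A) F" using lim(4) by (simp add: dist_commute)
  have k: "(?c1 \<longlongrightarrow> cosk \<kappa> \<alpha> \<beta> (\<alpha> + \<beta>)) F" "(?c2 \<longlongrightarrow> cosk \<kappa> \<beta> s B) F" "(?c3 \<longlongrightarrow> cosk \<kappa> s \<alpha> A) F"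
    by (intro cosk_tendsto lim lim' pos sh)+
  have evpos: "\<forall>\<^sub>F n in F. 0 < dist (u n) (a n) \<and> 0 < dist (u n) (b n) \<and> 0 < dist (u n) (c n) \<and>
      0 < dist (a n) (c n) \<and> 0 < dist (b n) (c n) \<and> 0 < dist (a n) (b n)"
    using lim[THEN order_tendstoD(1), of 0] pos by (auto intro!: eventually_conj)
  let ?P = "\<lambda>n. dist (u n) (a n) + dist (a n) (b n) + dist (u n) (b n)"
  let ?Q = "\<lambda>n. dist (u n) (b n) + dist (b n) (c n) + dist (u n) (c n)"
  let ?R = "\<lambda>n. dist (u n) (a n) + dist (a n) (c n) + dist (u n) (c n)"
  let ?T = "\<lambda>n. dist (a n) (b n) + dist (b n) (c n) + dist (a n) (c n)"
  have small_ev: "\<forall>\<^sub>F n in F. small \<kappa> (f n)" if "(f \<longlongrightarrow> l) F" "small \<kappa> l" for f l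
    using that order_tendstoD(2)[OF that(1), of "2 * dia \<kappa>"]
    by (cases "\<kappa> > 0") (auto simp: small_def elim: eventually_mono)
  have evsm: "\<forall>\<^sub>F n in F. small \<kappa> (?P n) \<and> small \<kappa> (?Q n) \<and> small \<kappa> (?R n) \<and> small \<kappa> (?T n)"
    by (intro eventually_conj small_ev[OF tendsto_add[OF tendsto_add[OF lim(1) lim(6)] lim(2)]]
       small_ev[OF tendsto_add[OF tendsto_add[OF lim(2) lim(5)] lim(3)]]
       small_ev[OF tendsto_add[OF tendsto_add[OF lim(1) lim(4)] lim(3)]]
       small_ev[OF tendsto_add[OF tendsto_add[OF lim(6) lim(5)] lim(4)]])
      (rule smallD[OF small], use tri in linarith)+
  have ev: "\<forall>\<^sub>F n in F. -1 \<le> ?c1 n \<and> ?c1 n \<le> 1 \<and> -1 \<le> ?c2 n \<and> ?c2 n \<le> 1 \<and> -1 \<le> ?c3 n \<and> ?c3 n \<le> 1 \<and>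
     arccos (?c1 n) + arccos (?c2 n) + arccos (?c3 n) \<le> 2 * pi"
    using evpos evsm
  proof eventually_elim
    case (elim n)
    have t1: "dist (a n) (b n) \<le> dist (u n) (a n) + dist (u n) (b n)"
        "dist (u n) (a n) \<le> dist (u n) (b n) + dist (a n) (b n)"
        "dist (u n) (b n) \<le> dist (u n) (a n) + dist (a n) (b n)"
      and t2: "dist (b n) (c n) \<le> dist (u n) (b n) + dist (u n) (c n)"
        "dist (u n) (b n) \<le> dist (u n) (c n) + dist (b n) (c n)"
        "dist (u n) (c n) \<le> dist (u n) (b n) + dist (b n) (c n)"
      and t3: "dist (c n) (a n) \<le> dist (u n) (c n) + dist (u n) (a n)"
        "dist (u n) (c n) \<le> dist (u n) (a n) + dist (c n) (a n)"
        "dist (u n) (a n) \<le> dist (u n) (c n) + dist (c n) (a n)"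
      using dist_triangle3[of "a n" "b n" "u n"] dist_triangle2[of "u n" "a n" "b n"]
        dist_triangle[of "u n" "b n" "a n"] dist_triangle3[of "b n" "c n" "u n"]
        dist_triangle2[of "u n" "b n" "c n"] dist_triangle[of "u n" "c n" "b n"]
        dist_triangle3[of "c n" "a n" "u n"] dist_triangle2[of "u n" "c n" "a n"]
        dist_triangle[of "u n" "a n" "c n"] by (simp_all add: dist_commute[of "a n" "c n"])
    have 1: "-1 \<le> ?c1 n" "?c1 n \<le> 1"
      by (rule cosk_bounds; (use elim t1 in \<open>simp add: algebra_simps\<close>))+
    have 2: "-1 \<le> ?c2 n" "?c2 n \<le> 1"
      by (rule cosk_bounds; (use elim t2 in \<open>simp add: algebra_simps\<close>))+
    have 3: "-1 \<le> ?c3 n" "?c3 n \<le> 1"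
      by (rule cosk_bounds; (use elim t3 in \<open>simp add: algebra_simps dist_commute\<close>))+
    have "quad_size (u n) (a n) (b n) (c n) < 2 * pi / sqrt \<kappa>" if "\<kappa> > 0"
    proof -
      have e: "2 * pi / sqrt \<kappa> = 2 * dia \<kappa>" by (simp add: dia_def)
      show ?thesis unfolding quad_size_def e using elim that
        by (auto simp: peri_def small_def dist_commute add_ac)
    qed
    moreover have "distinct [u n, a n, b n, c n]" using elim by auto
    ultimately have "comparison_angle \<kappa> (u n) (a n) (b n) + comparison_angle \<kappa> (u n) (b n) (c n) +
        comparison_angle \<kappa> (u n) (c n) (a n) \<le> 2 * pi"
      using X mem unfolding curvature_ge_def by blast
    then show ?case using 1 2 3 by (simp add: angle)
  qed
  have arc: "((\<lambda>n. arccos (f n)) \<longlongrightarrow> arccos l) F"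
    if "(f \<longlongrightarrow> l) F" "\<forall>\<^sub>F n in F. -1 \<le> f n \<and> f n \<le> 1" for f l
  proof -
    have l: "l \<in> {-1..1}"
      by (rule Lim_in_closed_set[OF _ _ F that(1)]) (use that(2) in \<open>auto elim: eventually_mono\<close>)
    show ?thesis
      by (rule continuous_on_tendsto_compose[OF continuous_on_arccos' that(1) l])
        (use that(2) in \<open>auto elim: eventually_mono\<close>)
  qed
  have "arccos (cosk \<kappa> \<alpha> \<beta> (\<alpha> + \<beta>)) + arccos (cosk \<kappa> \<beta> s B) + arccos (cosk \<kappa> s \<alpha> A) \<le> 2 * pi"
    by (rule tendsto_upperbound[OF _ _ F, of "\<lambda>n. arccos (?c1 n) + arccos (?c2 n) + arccos (?c3 n)"])
      (use ev in \<open>auto intro!: tendsto_add arc k elim: eventually_mono\<close>)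
  moreover have "cosk \<kappa> \<alpha> \<beta> (\<alpha> + \<beta>) = -1"
    using snk_pos[OF pos(1) sh(1)] snk_pos[OF pos(2) sh(2)] by (simp add: cosk_def sig_add field_simps)
  moreover have b2: "-1 \<le> cosk \<kappa> \<beta> s B" "cosk \<kappa> \<beta> s B \<le> 1"
    by (rule cosk_bounds, use pos tri sm in auto)+
  moreover have b3: "-1 \<le> cosk \<kappa> s \<alpha> A" "cosk \<kappa> s \<alpha> A \<le> 1"
    by (rule cosk_bounds, use pos tri sm in \<open>auto simp: add_ac\<close>)+
  ultimately have "arccos (cosk \<kappa> \<beta> s B) \<le> pi - arccos (cosk \<kappa> s \<alpha> A)" by simp
  moreover have "0 \<le> arccos (cosk \<kappa> \<beta> s B)" "pi - arccos (cosk \<kappa> s \<alpha> A) \<le> pi"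
    using b2 b3 by (auto intro: arccos_lbound)
  ultimately have "cos (pi - arccos (cosk \<kappa> s \<alpha> A)) \<le> cos (arccos (cosk \<kappa> \<beta> s B))"
    by (intro cos_monotone_0_pi_le)
  then have sum: "0 \<le> cosk \<kappa> \<beta> s B + cosk \<kappa> s \<alpha> A" using b2 b3 by simp
  note p = snk_pos[OF pos(1) sh(1)] snk_pos[OF pos(2) sh(2)] snk_pos[OF pos(3) sh(3)]
  \<comment> \<open>Clearing denominators makes the sum of the two cosines linear in the values of
    \<open>sig\<close> at A, B and s; the addition theorem collects the coefficient of the last
    one.\<close>
  have "0 \<le> (snk \<kappa> \<alpha> * snk \<kappa> \<beta> * snk \<kappa> s) * (cosk \<kappa> \<beta> s B + cosk \<kappa> s \<alpha> A)"
    using sum p by simp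
  also have "\<dots> = snk \<kappa> \<alpha> * (sig \<kappa> \<beta> + sig \<kappa> s - \<kappa> * sig \<kappa> \<beta> * sig \<kappa> s - sig \<kappa> B)
      + snk \<kappa> \<beta> * (sig \<kappa> s + sig \<kappa> \<alpha> - \<kappa> * sig \<kappa> s * sig \<kappa> \<alpha> - sig \<kappa> A)"
    unfolding cosk_def using p by (simp add: field_simps)
  finally show ?thesis unfolding snk_add csk_sig by (simp add: algebra_simps)
qed

section \<open>The ultrapower as a space satisfying Stewart's inequality\<close>

lemma ultra_tendsto: "(f \<longlongrightarrow> l) sequentially \<Longrightarrow> (f \<longlongrightarrow> l) ultra"
  using ultra(1) by (rule tendsto_mono)

lemma error_tendsto: "(\<lambda>n. 1 / real (Suc n)) \<longlonglongrightarrow> 0"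
  by (rule LIMSEQ_Suc[OF lim_1_over_n])

lemma ultrapower_geodesic:
  assumes X: "length_space X" and ab: "a \<in> ultrapower X" "b \<in> ultrapower X" and t: "0 \<le> t" "t \<le> ultra_dist a b"
  shows "\<exists>u\<in>ultrapower X. ultra_dist a u = t \<and> ultra_dist u b = ultra_dist a b - t"
proof -
  have mem: "a n \<in> X" "b n \<in> X" for n using ab by (auto simp: ultrapower_def)
  \<comment> \<open>For a single n the distance from a n to b n may be less than t. Truncation
    guarantees a point for every n and does not change the limit.\<close>
  define t' where "t' n = min t (dist (a n) (b n))" for n
  have "\<exists>u\<in>X. dist (a n) u = t' n \<and> dist u (b n) \<le> dist (a n) (b n) - t' n + 1 / Suc n" for n
  proof -
    have "0 \<le> t' n" "t' n \<le> dist (a n) (b n)" "0 < 1 / real (Suc n)" using t by (auto simp: t'_def)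
    from length_space_between[OF X mem(1) mem(2) this] show ?thesis by blast
  qed
  then have "\<forall>n. \<exists>u. u \<in> X \<and> dist (a n) u = t' n \<and> dist u (b n) \<le> dist (a n) (b n) - t' n + 1 / Suc n"
    by blast
  from choice[OF this] obtain u where u: "\<And>n. u n \<in> X" "\<And>n. dist (a n) (u n) = t' n"
    "\<And>n. dist (u n) (b n) \<le> dist (a n) (b n) - t' n + 1 / Suc n" by blast
  have uU: "u \<in> ultrapower X" by (rule ultrapower_boundedI[where B = t, OF ab(1) u(1)]) (simp add: u(2) t'_def)
  have lt: "(t' \<longlongrightarrow> t) ultra"
  proof -
    have "((\<lambda>n. min t (dist (a n) (b n))) \<longlongrightarrow> min t (ultra_dist a b)) ultra"
      by (intro tendsto_min tendsto_const ultra_dist_tendsto[OF ab])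
    then show ?thesis using t by (simp add: t'_def[abs_def] min_def)
  qed
  have 1: "ultra_dist a u = t" by (rule ultra_dist_eqI) (simp add: u(2) lt)
  have "ultra_dist u b \<le> ultra_dist a b - t + 0"
    by (rule tendsto_le[OF ultra(2) _ ultra_dist_tendsto[OF uU ab(2)]
          always_eventually[rule_format, OF u(3)]])
      (intro tendsto_add tendsto_diff ultra_dist_tendsto[OF ab] lt ultra_tendsto error_tendsto)
  then show ?thesis using 1 uU ultra_dist_triangle[OF ab(1) uU ab(2)] by (intro bexI[of _ u]) auto
qed

text \<open>The limit argument needs c at positive distance from a, b and u. In the excluded
  positions the distances to c are forced, and the claim becomes an identity, at the ends
  \<open>snk_sig_add\<close>.\<close>

lemma ultrapower_stewart:
  assumes X: "curvature_ge \<kappa> X" and mem: "a \<in> ultrapower X" "b \<in> ultrapower X" "c \<in> ultrapower X" "u \<in> ultrapower X"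
    and pos: "0 < ultra_dist a u" "0 < ultra_dist u b" and sum: "ultra_dist a b = ultra_dist a u + ultra_dist u b"
    and small: "small \<kappa> (ultra_dist a b + ultra_dist b c + ultra_dist c a)"
  shows "snk \<kappa> (ultra_dist u b) * (sig \<kappa> (ultra_dist a c) - sig \<kappa> (ultra_dist a u)) +
      snk \<kappa> (ultra_dist a u) * (sig \<kappa> (ultra_dist b c) - sig \<kappa> (ultra_dist u b)) \<le> snk \<kappa> (ultra_dist a b) * sig \<kappa> (ultra_dist u c)"
proof -
  note tri = ultra_dist_triangle
  consider "ultra_dist u c = 0" | "ultra_dist a c = 0" | "ultra_dist b c = 0" | "0 < ultra_dist u c" "0 < ultra_dist a c" "0 < ultra_dist b c"
    using ultra_dist_nonneg mem by (metis less_eq_real_def)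
  then show ?thesis
  proof cases
    case 1
    have "ultra_dist a c = ultra_dist a u" "ultra_dist b c = ultra_dist u b"
      using tri[OF mem(1,4,3)] tri[OF mem(1,3,4)] tri[OF mem(2,4,3)] tri[OF mem(2,3,4)] 1
      by (auto simp: ultra_dist_sym)
    then show ?thesis using 1 by simp
  next
    case 2
    have "ultra_dist u c = ultra_dist a u" "ultra_dist b c = ultra_dist a b"
      using tri[OF mem(4,1,3)] tri[OF mem(4,3,1)] tri[OF mem(2,1,3)] tri[OF mem(2,3,1)] 2
      by (auto simp: ultra_dist_sym)
    then show ?thesis using 2 sum snk_sig_add[of \<kappa> "ultra_dist a u" "ultra_dist u b"] by (simp add: algebra_simps)
  next
    case 3
    have "ultra_dist u c = ultra_dist u b" "ultra_dist a c = ultra_dist a b"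
      using tri[OF mem(4,2,3)] tri[OF mem(4,3,2)] tri[OF mem(1,2,3)] tri[OF mem(1,3,2)] 3
      by (auto simp: ultra_dist_sym)
    then show ?thesis using 3 sum snk_sig_add[of \<kappa> "ultra_dist u b" "ultra_dist a u"] by (simp add: algebra_simps)
  next
    case 4
    note lim = ultra_dist_tendsto
    have "small \<kappa> (ultra_dist u a + ultra_dist u b + ultra_dist a c + ultra_dist b c)" by (rule smallD[OF small]) (simp add: sum ultra_dist_sym)
    moreover have "((\<lambda>n. dist (a n) (b n)) \<longlongrightarrow> ultra_dist u a + ultra_dist u b) ultra"
      using lim[OF mem(1,2)] sum by (simp add: ultra_dist_sym)
    moreover have "a n \<in> X" "b n \<in> X" "c n \<in> X" "u n \<in> X" for n using mem by (auto simp: ultrapower_def)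
    moreover have "0 < ultra_dist u a" using pos by (simp add: ultra_dist_sym)
    ultimately have "snk \<kappa> (ultra_dist u b) * (sig \<kappa> (ultra_dist a c) - sig \<kappa> (ultra_dist u a)) +
        snk \<kappa> (ultra_dist u a) * (sig \<kappa> (ultra_dist b c) - sig \<kappa> (ultra_dist u b)) \<le> snk \<kappa> (ultra_dist u a + ultra_dist u b) * sig \<kappa> (ultra_dist u c)"
      using pos(2) 4
      by (intro curvature_stewart_limit[OF X ultra(2), of a b c u] lim[OF mem(4,1)] lim[OF mem(4,2)]
          lim[OF mem(4,3)] lim[OF mem(1,3)] lim[OF mem(2,3)])
    then show ?thesis using sum by (simp add: ultra_dist_sym)
  qed
qed

text \<open>Uniqueness in the ultrapower makes approximate solutions in X cluster, so a sequence of
  them is Cauchy and completeness turns it into an exact solution.\<close>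

lemma ultrapower_closed:
  assumes X: "complete X" "length_space X" and ab: "a \<in> X" "b \<in> X" and t: "0 \<le> t" "t \<le> dist a b"
    and uniq: "\<And>u u'. u \<in> ultrapower X \<Longrightarrow> u' \<in> ultrapower X \<Longrightarrow> ultra_dist (\<lambda>_. a) u = t \<Longrightarrow> ultra_dist u (\<lambda>_. b) = dist a b - t \<Longrightarrow>
        ultra_dist (\<lambda>_. a) u' = t \<Longrightarrow> ultra_dist u' (\<lambda>_. b) = dist a b - t \<Longrightarrow> ultra_dist u u' = 0"
  shows "\<exists>u\<in>X. dist a u = t \<and> dist u b = dist a b - t"
proof -
  let ?D = "\<lambda>\<delta> u. u \<in> X \<and> dist a u = t \<and> dist u b \<le> dist a b - t + \<delta>"
  \<comment> \<open>Otherwise two sequences of approximate solutions staying \<epsilon> apart would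
    be exact solutions in the ultrapower at positive distance.\<close>
  have key: "\<exists>n. \<forall>u u'. ?D (1 / Suc n) u \<longrightarrow> ?D (1 / Suc n) u' \<longrightarrow> dist u u' < \<epsilon>" if "0 < \<epsilon>" for \<epsilon>
  proof (rule ccontr)
    assume "\<not> ?thesis"
    then have "\<forall>n. \<exists>u u'. ?D (1 / Suc n) u \<and> ?D (1 / Suc n) u' \<and> \<epsilon> \<le> dist u u'"
      by (auto simp: not_less)
    then obtain u u' where u: "\<And>n. ?D (1 / Suc n) (u n)" and u': "\<And>n. ?D (1 / Suc n) (u' n)"
      and \<epsilon>: "\<And>n. \<epsilon> \<le> dist (u n) (u' n)" by metis
    have pr: "v \<in> ultrapower X" "ultra_dist (\<lambda>_. a) v = t" "ultra_dist v (\<lambda>_. b) = dist a b - t"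
      if v: "\<And>n. ?D (1 / Suc n) (v n)" for v
    proof -
      show vU: "v \<in> ultrapower X" by (rule ultrapower_boundedI[of "\<lambda>_. a" X v t]) (use v ab in auto)
      show va: "ultra_dist (\<lambda>_. a) v = t" by (rule ultra_dist_eqI) (use v in simp)
      have "ultra_dist v (\<lambda>_. b) \<le> dist a b - t + 0"
      proof (rule tendsto_le[OF ultra(2) _ ultra_dist_tendsto[OF vU, of "\<lambda>_. b"]])
        show "((\<lambda>n. dist a b - t + 1 / real (Suc n)) \<longlongrightarrow> dist a b - t + 0) ultra"
          by (intro tendsto_add tendsto_const ultra_tendsto[OF error_tendsto])
      qed (use v ab in \<open>auto intro!: always_eventually\<close>)
      then show "ultra_dist v (\<lambda>_. b) = dist a b - t"
        using ultra_dist_triangle[of "\<lambda>_. a" X v "\<lambda>_. b"] vU ab va by simp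
    qed
    have "ultra_dist u u' = 0" using pr[OF u] pr[OF u'] by (intro uniq)
    moreover have "\<epsilon> \<le> ultra_dist u u'"
      by (rule tendsto_lowerbound[OF ultra_dist_tendsto[OF pr(1)[OF u] pr(1)[OF u']] always_eventually ultra(2)])
        (use \<epsilon> in simp)
    ultimately show False using that by simp
  qed
  have "\<exists>u. ?D (1 / Suc n) u" for n
    using length_space_between[OF X(2) ab t, of "1 / real (Suc n)"]
    by (metis of_nat_0_less_iff zero_less_Suc zero_less_divide_1_iff)
  then obtain u where u: "\<And>n. ?D (1 / Suc n) (u n)" by metis
  have mono: "?D (1 / Suc N) (u n)" if "N \<le> n" for N n
  proof -
    have "1 / real (Suc n) \<le> 1 / real (Suc N)" using that by (intro divide_left_mono) auto
    then show ?thesis using u[of n] by simp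
  qed
  have "Cauchy u"
    unfolding Cauchy_def
  proof (intro allI impI)
    fix \<epsilon> :: real assume "0 < \<epsilon>"
    then obtain N where "\<forall>u u'. ?D (1 / Suc N) u \<longrightarrow> ?D (1 / Suc N) u' \<longrightarrow> dist u u' < \<epsilon>" using key by blast
    then show "\<exists>M. \<forall>m\<ge>M. \<forall>n\<ge>M. dist (u m) (u n) < \<epsilon>" using mono by blast
  qed
  then obtain l where l: "l \<in> X" "u \<longlonglongrightarrow> l" using X(1) u unfolding complete_def by blast
  have 1: "dist a l = t"
  proof (rule LIMSEQ_unique)
    show "(\<lambda>n. dist a (u n)) \<longlonglongrightarrow> dist a l" by (intro tendsto_intros l)
    show "(\<lambda>n. dist a (u n)) \<longlonglongrightarrow> t" using u by simp
  qed
  have "dist l b \<le> dist a b - t + 0"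
    by (rule LIMSEQ_le[OF tendsto_dist[OF l(2) tendsto_const] tendsto_add[OF tendsto_const error_tendsto]])
      (use u in auto)
  then show ?thesis using 1 l dist_triangle[of a b l] by (intro bexI[of _ l]) auto
qed

theorem alexandrov_stewart:
  assumes "alexandrov_space \<kappa> X"
  shows "stewart_space \<kappa> (ultrapower X) ultra_dist ((\<lambda>a _. a) ` X)"
proof
  have X: "complete X" "length_space X" "curvature_ge \<kappa> X"
    using assms by (auto simp: alexandrov_space_def)
  show "0 \<le> ultra_dist a b" if "a \<in> ultrapower X" "b \<in> ultrapower X" for a b using that by (rule ultra_dist_nonneg)
  show "ultra_dist a a = 0" for a :: "nat \<Rightarrow> 'a" by (rule ultra_dist_eqI) simp
  show "ultra_dist a b = ultra_dist b a" for a b :: "nat \<Rightarrow> 'a" by (rule ultra_dist_sym)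
  show "ultra_dist a c \<le> ultra_dist a b + ultra_dist b c" if "a \<in> ultrapower X" "b \<in> ultrapower X" "c \<in> ultrapower X" for a b c
    using that by (rule ultra_dist_triangle)
  show "\<exists>u\<in>ultrapower X. ultra_dist a u = t \<and> ultra_dist u b = ultra_dist a b - t"
    if "a \<in> ultrapower X" "b \<in> ultrapower X" "0 \<le> t" "t \<le> ultra_dist a b" for a b t
    using X(2) that by (rule ultrapower_geodesic)
  show "snk \<kappa> (ultra_dist u b) * (sig \<kappa> (ultra_dist a c) - sig \<kappa> (ultra_dist a u)) +
      snk \<kappa> (ultra_dist a u) * (sig \<kappa> (ultra_dist b c) - sig \<kappa> (ultra_dist u b)) \<le> snk \<kappa> (ultra_dist a b) * sig \<kappa> (ultra_dist u c)"
    if "a \<in> ultrapower X" "b \<in> ultrapower X" "c \<in> ultrapower X" "u \<in> ultrapower X" "0 < ultra_dist a u" "0 < ultra_dist u b"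
      "ultra_dist a b = ultra_dist a u + ultra_dist u b" "small \<kappa> (ultra_dist a b + ultra_dist b c + ultra_dist c a)" for a b c u
    using X(3) that by (rule ultrapower_stewart)
  show "(\<lambda>a _. a) ` X \<subseteq> ultrapower X" by auto
  show "a = b" if "a \<in> (\<lambda>a _. a) ` X" "b \<in> (\<lambda>a _. a) ` X" "ultra_dist a b = 0" for a b
    using that by auto
  show "\<exists>u\<in>(\<lambda>a _. a) ` X. ultra_dist a u = t \<and> ultra_dist u b = ultra_dist a b - t"
    if ab: "a \<in> (\<lambda>a _. a) ` X" "b \<in> (\<lambda>a _. a) ` X" and t: "0 \<le> t" "t \<le> ultra_dist a b"
      and uniq: "\<And>u u'. u \<in> ultrapower X \<Longrightarrow> u' \<in> ultrapower X \<Longrightarrow> ultra_dist a u = t \<Longrightarrow> ultra_dist u b = ultra_dist a b - t \<Longrightarrow>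
        ultra_dist a u' = t \<Longrightarrow> ultra_dist u' b = ultra_dist a b - t \<Longrightarrow> ultra_dist u u' = 0" for a b t
  proof -
    obtain a' b' where a': "a' \<in> X" "a = (\<lambda>_. a')" and b': "b' \<in> X" "b = (\<lambda>_. b')" using ab by auto
    have "\<exists>u\<in>X. dist a' u = t \<and> dist u b' = dist a' b' - t"
      by (rule ultrapower_closed[OF X(1,2) a'(1) b'(1)]) (use t uniq a' b' in auto)
    then show ?thesis using a' b' by auto
  qed
qed

section \<open>Extension to the closed region\<close>

context cevian begin

definition inter :: "(real^3) set" where
  "inter = {Q \<in> model_plane \<kappa>. \<exists>a b c. 0 < a \<and> 0 < b \<and> 0 < c \<and> Q = a *\<^sub>R x' + b *\<^sub>R y' + c *\<^sub>R z'}"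

text \<open>The inequality between the products says that Q lies on the y' side of [x', w']. Trading
  z' for w' then leaves a nonnegative y' coefficient.\<close>

lemma cover_y:
  assumes Q: "Q \<in> model_plane \<kappa>" "Q = a *\<^sub>R x' + b *\<^sub>R y' + c *\<^sub>R z'" "0 < a" "0 < c"
    and w: "w' = l *\<^sub>R y' + m *\<^sub>R z'" "0 < m" "l * c \<le> b * m"
  obtains t where "0 < t" "t < L" "Q \<in> seg \<kappa> y' (G t)"
proof -
  obtain k t where k: "0 < k" "0 < t" "t < L" "a *\<^sub>R x' + (c / m) *\<^sub>R w' = k *\<^sub>R G t"
    using G_of_coeffs[of a "c / m"] Q w by auto
  have "(c / m) *\<^sub>R w' = (l * c / m) *\<^sub>R y' + c *\<^sub>R z'" using w by (simp add: scaleR_add_right mult.commute)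
  then have Qe: "Q = (b - l * c / m) *\<^sub>R y' + k *\<^sub>R G t"
    unfolding Q(2) k(4)[symmetric] by (simp add: scaleR_diff_left)
  have "Q \<in> seg \<kappa> y' (G t)"
    by (rule hs_seg[OF hs(2) G_hs Q(1) Qe]) (use k w in \<open>auto simp: field_simps\<close>)
  then show ?thesis using that k by blast
qed

text \<open>Every interior point belongs to one of the two halves cut off by [x, w]. Exactness holds
  against all pairs satisfying \<open>ok\<close>, so points from different halves are covered as
  well.\<close>

lemma interior_map:
  obtains f where "\<And>Q. Q \<in> inter \<Longrightarrow> f Q \<in> N" "\<And>Q. Q \<in> inter \<Longrightarrow> ok (f Q) Q"
    "\<And>Q c C. Q \<in> inter \<Longrightarrow> ok c C \<Longrightarrow> d (f Q) c = model_dist \<kappa> Q C"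
proof -
  have "\<exists>q\<in>N. ok q Q \<and> (\<forall>c C. ok c C \<longrightarrow> d q c = model_dist \<kappa> Q C)" if inQ: "Q \<in> inter" for Q
  proof -
    obtain a b c where Q: "Q \<in> model_plane \<kappa>" "0 < a" "0 < b" "0 < c" "Q = a *\<^sub>R x' + b *\<^sub>R y' + c *\<^sub>R z'"
      using inQ unfolding inter_def by blast
    obtain l m where w: "0 < l" "0 < m" "w' = l *\<^sub>R y' + m *\<^sub>R z'" by (rule w_coeffs)
    show ?thesis
    proof (cases "l * c \<le> b * m")
      case True
      obtain t where t: "0 < t" "t < L" "Q \<in> seg \<kappa> y' (G t)"
        by (rule cover_y[OF Q(1,5,2,4) w(3,2) True])
      obtain q where "q \<in> N" "on_y t q Q" by (rule on_y_exists[OF t])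
      then show ?thesis using on_y_ok[OF t(1,2)] on_y_exact[OF t(1,2)] by blast
    next
      case False
      have 1: "Q = a *\<^sub>R x' + c *\<^sub>R z' + b *\<^sub>R y'" "w' = m *\<^sub>R z' + l *\<^sub>R y'" "m * b \<le> c * l"
        using Q w False by (auto simp: algebra_simps)
      obtain t where t: "0 < t" "t < L" "Q \<in> seg \<kappa> z' (G t)"
        by (rule cevian.cover_y[OF swap Q(1) 1(1) Q(2,3) 1(2) w(1) 1(3)])
      obtain q where "q \<in> N" "cevian.on_y \<kappa> Y d z x' z' w' F t q Q" by (rule cevian.on_y_exists[OF swap t])
      then show ?thesis
        using cevian.on_y_ok[OF swap t(1,2)] cevian.on_y_exact[OF swap t(1,2)] unfolding swap_ok by blast
    qed
  qed
  then show ?thesis using that by metis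
qed

lemma ok_unique:
  assumes "Q \<in> inter" "ok q Q" "ok r Q"
  shows "d q r = 0"
proof -
  obtain f where f: "\<And>Q. Q \<in> inter \<Longrightarrow> f Q \<in> N"
    "\<And>Q c C. Q \<in> inter \<Longrightarrow> ok c C \<Longrightarrow> d (f Q) c = model_dist \<kappa> Q C"
    by (rule interior_map) blast
  have 0: "d (f Q) q = 0" "d (f Q) r = 0"
    using f(2)[OF assms(1,2)] f(2)[OF assms(1,3)] okD(3)[OF assms(2)] by auto
  then have "d q r \<le> 0"
    using d_triangle[of q "f Q" r] okD(1)[OF assms(2)] okD(1)[OF assms(3)] N_Y[OF f(1)[OF assms(1)]]
    by (simp add: d_sym)
  then show ?thesis using d_nonneg okD(1)[OF assms(2)] okD(1)[OF assms(3)] by (simp add: order_antisym)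
qed

end

text \<open>Model points of I converging to Q have a Cauchy image, by the model triangle inequality.
  The limit is recorded through its distances to the image of I, from which the distances between
  two limits follow by density.\<close>

lemma extend_isometry:
  fixes X :: "'a::metric_space set"
  assumes X: "complete X" and K: "K \<subseteq> model_plane \<kappa>" "I \<subseteq> K"
    and dense: "\<And>Q \<epsilon>. Q \<in> K \<Longrightarrow> 0 < \<epsilon> \<Longrightarrow> \<exists>R\<in>I. model_dist \<kappa> Q R < \<epsilon>"
    and g: "\<And>Q. Q \<in> I \<Longrightarrow> g Q \<in> X" "\<And>Q R. Q \<in> I \<Longrightarrow> R \<in> I \<Longrightarrow> dist (g Q) (g R) = model_dist \<kappa> Q R"
  shows "\<exists>f. (\<forall>Q\<in>K. f Q \<in> X) \<and> (\<forall>Q\<in>K. \<forall>R\<in>I. dist (f Q) (g R) = model_dist \<kappa> Q R) \<and>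
    (\<forall>Q\<in>K. \<forall>R\<in>K. dist (f Q) (f R) = model_dist \<kappa> Q R)"
proof -
  have M: "Q \<in> model_plane \<kappa>" if "Q \<in> K" for Q using K that by auto
  have IK: "Q \<in> K" if "Q \<in> I" for Q using K that by auto
  have "\<exists>u\<in>X. \<forall>R\<in>I. dist u (g R) = model_dist \<kappa> Q R" if Q: "Q \<in> K" for Q
  proof -
    have "\<exists>R\<in>I. model_dist \<kappa> Q R < 1 / Suc n" for n by (rule dense[OF Q]) simp
    then obtain R where R: "\<And>n. R n \<in> I" "\<And>n. model_dist \<kappa> Q (R n) < 1 / Suc n" by metis
    have lim: "(\<lambda>n. model_dist \<kappa> Q (R n)) \<longlonglongrightarrow> 0"
    proof (rule tendsto_sandwich[OF _ _ tendsto_const error_tendsto])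
      show "\<forall>\<^sub>F n in sequentially. 0 \<le> model_dist \<kappa> Q (R n)"
        using model_dist_nonneg M Q R IK by (auto intro!: always_eventually)
      show "\<forall>\<^sub>F n in sequentially. model_dist \<kappa> Q (R n) \<le> 1 / real (Suc n)"
        using R by (auto intro!: always_eventually less_imp_le)
    qed
    have gd: "dist (g (R m)) (g S) \<le> model_dist \<kappa> Q (R m) + model_dist \<kappa> Q S" if "S \<in> I" for m S
      using model_dist_triangle[of "R m" \<kappa> Q S] g(2)[of "R m" S] R M Q IK that by (simp add: model_dist_sym)
    have "Cauchy (\<lambda>n. g (R n))"
      unfolding Cauchy_def
    proof (intro allI impI)
      fix \<epsilon> :: real assume "0 < \<epsilon>"
      then have "\<forall>\<^sub>F n in sequentially. model_dist \<kappa> Q (R n) < \<epsilon> / 2" by (intro order_tendstoD[OF lim]) simp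
      then obtain n0 where n0: "\<And>n. n0 \<le> n \<Longrightarrow> model_dist \<kappa> Q (R n) < \<epsilon> / 2"
        by (auto simp: eventually_sequentially)
      have "dist (g (R m)) (g (R n)) < \<epsilon>" if "n0 \<le> m" "n0 \<le> n" for m n
        using gd[OF R(1), of m n] n0[OF that(1)] n0[OF that(2)] by linarith
      then show "\<exists>M. \<forall>m\<ge>M. \<forall>n\<ge>M. dist (g (R m)) (g (R n)) < \<epsilon>" by blast
    qed
    then obtain u where u: "u \<in> X" "(\<lambda>n. g (R n)) \<longlonglongrightarrow> u"
      using X g(1) R(1) unfolding complete_def by meson
    have "dist u (g S) = model_dist \<kappa> Q S" if S: "S \<in> I" for S
    proof (rule LIMSEQ_unique)
      show "(\<lambda>n. dist (g (R n)) (g S)) \<longlonglongrightarrow> dist u (g S)" by (intro tendsto_intros u)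
      have "\<bar>dist (g (R n)) (g S) - model_dist \<kappa> Q S\<bar> \<le> model_dist \<kappa> Q (R n)" for n
        using gd[OF S, of n] model_dist_triangle[of Q \<kappa> "R n" S] g(2)[OF R(1) S, of n] R M Q IK S by auto
      then have "(\<lambda>n. dist (g (R n)) (g S) - model_dist \<kappa> Q S) \<longlonglongrightarrow> 0"
        by (intro tendsto_rabs_zero_cancel[OF tendsto_sandwich[OF _ _ tendsto_const lim]])
          (auto intro!: always_eventually)
      then show "(\<lambda>n. dist (g (R n)) (g S)) \<longlonglongrightarrow> model_dist \<kappa> Q S" by (simp add: LIM_zero_iff)
    qed
    then show ?thesis using u by blast
  qed
  then obtain f where f: "\<And>Q. Q \<in> K \<Longrightarrow> f Q \<in> X"
    "\<And>Q R. Q \<in> K \<Longrightarrow> R \<in> I \<Longrightarrow> dist (f Q) (g R) = model_dist \<kappa> Q R" by metis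
  have "dist (f Q) (f R) = model_dist \<kappa> Q R" if QR: "Q \<in> K" "R \<in> K" for Q R
  proof -
    have "\<bar>dist (f Q) (f R) - model_dist \<kappa> Q R\<bar> \<le> \<epsilon>" if pe: "0 < \<epsilon>" for \<epsilon>
    proof -
      obtain S where S: "S \<in> I" "model_dist \<kappa> R S < \<epsilon> / 2" using dense[OF QR(2) half_gt_zero[OF pe]] by blast
      have "\<bar>dist (f Q) (f R) - dist (f Q) (g S)\<bar> \<le> dist (f R) (g S)"
        using dist_triangle[of "f Q" "f R" "g S"] dist_triangle[of "f Q" "g S" "f R"]
        by (auto simp: dist_commute)
      moreover have "\<bar>model_dist \<kappa> Q R - model_dist \<kappa> Q S\<bar> \<le> model_dist \<kappa> R S"
        using model_dist_triangle[of Q \<kappa> R S] model_dist_triangle[of Q \<kappa> S R] M QR IK S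
        by (auto simp: model_dist_sym)
      ultimately show ?thesis using f(2)[OF QR(1) S(1)] f(2)[OF QR(2) S(1)] S(2) by linarith
    qed
    then show ?thesis using field_le_epsilon[of "\<bar>dist (f Q) (f R) - model_dist \<kappa> Q R\<bar>" 0] by simp
  qed
  then show ?thesis using f by blast
qed

section \<open>Triangular regions\<close>

lemma sinh_ge_half: "0 \<le> (x::real) \<Longrightarrow> x / 2 \<le> sinh x"
proof -
  assume "0 \<le> x"
  then have "exp (- x) \<le> 1" by simp
  then have "x \<le> exp x - exp (- x)" using exp_ge_add_one_self[of x] by linarith
  then show ?thesis by (simp add: sinh_def)
qed

lemma snk_ge: "\<kappa> \<le> 0 \<Longrightarrow> 0 \<le> r \<Longrightarrow> r / 2 \<le> snk \<kappa> r"
proof (cases \<kappa> rule: kappa_cases)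
  case (neg k)
  assume "0 \<le> r"
  then show ?thesis using sinh_ge_half[of "k * r"] neg by (simp add: snk_neg_def field_simps)
qed (auto simp: snk_zero_def)

lemma mform_le_norm: "mform \<kappa> u u \<le> (norm u)\<^sup>2"
proof -
  have "sgn \<kappa> * (u$3 * u$3) \<le> 1 * (u$3 * u$3)" by (rule mult_right_mono) (auto simp: sgn_if)
  then show ?thesis by (simp add: mform_def power2_norm_eq_inner inner_vec_def sum_3)
qed

text \<open>The factor 2 comes from the crude bound sinh x \<ge> x / 2. The estimate makes a bounded
  subset of real^3 bounded for the intrinsic distance, which a geodesic ray is not.\<close>

lemma model_dist_le_norm:
  assumes "\<kappa> \<le> 0" "u \<in> model_plane \<kappa>" "v \<in> model_plane \<kappa>"
  shows "model_dist \<kappa> u v \<le> 2 * norm (u - v)"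
proof -
  let ?t = "model_dist \<kappa> u v"
  have t: "0 \<le> ?t" by (rule model_dist_nonneg[OF assms(2,3)])
  then have "(?t / 4)\<^sup>2 \<le> (snk \<kappa> (?t / 2))\<^sup>2" using snk_ge[OF assms(1), of "?t / 2"] by (intro power_mono) auto
  then have "2 * (?t / 4)\<^sup>2 \<le> sig \<kappa> ?t" by (simp add: sig_def)
  also have "\<dots> \<le> (norm (u - v))\<^sup>2 / 2" using sig_model_dist[OF assms(2,3)] mform_le_norm[of \<kappa> "u - v"] by simp
  finally have "?t\<^sup>2 \<le> (2 * norm (u - v))\<^sup>2" by (simp add: power2_eq_square)
  then show ?thesis by (rule power2_le_imp_le) simp
qed

text \<open>The ambient form never exceeds the squared Euclidean norm, so closeness in real^3 makes
  \<open>sig\<close> of the distance small.\<close>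

lemma isometry_continuous:
  assumes K: "K \<subseteq> model_plane \<kappa>"
    and f: "\<And>u v. u \<in> K \<Longrightarrow> v \<in> K \<Longrightarrow> dist (f u) (f v) = model_dist \<kappa> u v"
  shows "continuous_on K (f :: real^3 \<Rightarrow> 'a::metric_space)"
  unfolding continuous_on_iff
proof (intro ballI allI impI)
  fix u and \<epsilon> :: real assume u: "u \<in> K" and "0 < \<epsilon>"
  \<comment> \<open>Capped at the diameter, up to which \<open>sig\<close> is increasing.\<close>
  define r where "r = (if \<kappa> > 0 then min \<epsilon> (dia \<kappa>) else \<epsilon>)"
  have r: "0 < r" "r \<le> \<epsilon>" "fits \<kappa> r" using \<open>0 < \<epsilon>\<close> dia_pos by (auto simp: r_def fits_def)
  have s: "0 < sig \<kappa> r" by (rule sig_pos[OF r(1,3)])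
  show "\<exists>\<delta>>0. \<forall>v\<in>K. dist v u < \<delta> \<longrightarrow> dist (f v) (f u) < \<epsilon>"
  proof (intro exI[of _ "sqrt (sig \<kappa> r)"] conjI ballI impI)
    fix v assume v: "v \<in> K" "dist v u < sqrt (sig \<kappa> r)"
    have M: "v \<in> model_plane \<kappa>" "u \<in> model_plane \<kappa>" using K u v by auto
    have "(norm (v - u))\<^sup>2 < (sqrt (sig \<kappa> r))\<^sup>2"
      using v(2) by (intro power_strict_mono) (auto simp: dist_norm)
    then have "sig \<kappa> (model_dist \<kappa> v u) < sig \<kappa> r"
      using sig_model_dist[OF M] mform_le_norm[of \<kappa> "v - u"] s by simp
    then have "model_dist \<kappa> v u < r"
      using sig_le_iff[of r "model_dist \<kappa> v u" \<kappa>] r model_dist_nonneg[OF M] model_dist_fits[OF M]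
      by (auto simp: not_le[symmetric])
    then show "dist (f v) (f u) < \<epsilon>" using f[OF v(1) u] r by simp
  qed (use s in simp)
qed

lemma continuous_geod: "continuous_on A (geod \<kappa> a b)"
  unfolding geod_def Let_def divide_inverse by (intro continuous_intros)

lemma geod_antipode:
  assumes "\<kappa> > 0" "a \<in> model_plane \<kappa>" "v \<in> model_plane \<kappa>" "a \<noteq> v" "short \<kappa> (model_dist \<kappa> a v)"
  shows "geod \<kappa> a v (dia \<kappa>) = - a"
proof -
  let ?L = "model_dist \<kappa> a v"
  have 1: "sqrt \<kappa> * dia \<kappa> = pi" using assms(1) by (simp add: dia_def)
  have "snk \<kappa> (dia \<kappa>) = 0" using assms(1) by (simp add: snk_pos_def 1)
  moreover have "snk \<kappa> (?L - dia \<kappa>) = - snk \<kappa> ?L"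
    using assms(1) by (simp add: snk_pos_def right_diff_distrib 1 sin_diff)
  moreover have "snk \<kappa> ?L > 0" by (rule snk_pos) (use assms model_dist_pos in auto)
  ultimately show ?thesis by (simp add: geod_def Let_def)
qed

section \<open>Star-shaped sets and the components enclosed within them\<close>

context
  fixes \<kappa> e a K
  assumes K: "K \<subseteq> half_plane \<kappa> e" "a \<in> K" and star: "\<And>s. s \<in> K \<Longrightarrow> seg \<kappa> a s \<subseteq> K"
begin

text \<open>If the ray from a through v met K beyond v, then v would lie on the segment from a to
  that point and hence in K.\<close>

lemma ray_outside:
  assumes v: "v \<in> model_plane \<kappa>" "v \<notin> K" "\<kappa> > 0 \<Longrightarrow> v \<noteq> - a"
    and t: "model_dist \<kappa> a v \<le> t" "fits \<kappa> t"
  shows "geod \<kappa> a v t \<in> model_plane \<kappa> - K"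
proof -
  let ?L = "model_dist \<kappa> a v"
  have a: "a \<in> model_plane \<kappa>" using K hsD by auto
  have ne: "a \<noteq> v" using v K by auto
  have L: "0 < ?L" "short \<kappa> ?L" using model_dist_pos[OF a v(1) ne] short_of_not_antipodal[OF a v(1,3)] by auto
  let ?s = "geod \<kappa> a v t"
  have s: "?s \<in> model_plane \<kappa>" by (rule geod_in[OF a v(1) refl L])
  have "?s \<notin> K"
  proof
    assume sK: "?s \<in> K"
    have "model_dist \<kappa> a ?s = t" using geod_dist_left[OF a v(1) refl L, of t] t L by simp
    moreover have "model_dist \<kappa> ?s v = t - ?L"
      using geod_dist_right[OF a v(1) refl L, of t] fitsD[OF t(2), of "t - ?L"] t L by simp
    ultimately have "v \<in> seg \<kappa> a ?s" using v by (simp add: seg_iff model_dist_sym)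
    then show False using star[OF sK] v by auto
  qed
  then show ?thesis using s by simp
qed

lemma escape_to_antipode:
  assumes k: "\<kappa> > 0" and v: "v \<in> model_plane \<kappa>" "v \<notin> K"
  obtains \<Gamma> where "connected \<Gamma>" "\<Gamma> \<subseteq> model_plane \<kappa> - K" "v \<in> \<Gamma>" "- a \<in> \<Gamma>"
proof (cases "v = - a")
  case True
  then show ?thesis using that[of "{v}"] v by simp
next
  case False
  let ?L = "model_dist \<kappa> a v"
  have a: "a \<in> model_plane \<kappa>" using K hsD by auto
  have ne: "a \<noteq> v" using v K by auto
  have L: "0 < ?L" "short \<kappa> ?L"
    using model_dist_pos[OF a v(1) ne] short_of_not_antipodal[OF a v(1)] False by auto
  show ?thesis
  proof (rule that[of "geod \<kappa> a v ` {?L..dia \<kappa>}"])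
    show "connected (geod \<kappa> a v ` {?L..dia \<kappa>})"
      by (intro connected_continuous_image continuous_geod) simp
    show "geod \<kappa> a v ` {?L..dia \<kappa>} \<subseteq> model_plane \<kappa> - K"
      using ray_outside[OF v] False by (auto simp: fits_def)
    have le: "?L \<le> dia \<kappa>" using L k by (simp add: short_def)
    show "v \<in> geod \<kappa> a v ` {?L..dia \<kappa>}"
      by (rule image_eqI[where x = ?L and f = "geod \<kappa> a v", OF geod_end[OF a v(1) ne L(2), symmetric]]) (simp add: le)
    show "- a \<in> geod \<kappa> a v ` {?L..dia \<kappa>}"
      by (rule image_eqI[where x = "dia \<kappa>" and f = "geod \<kappa> a v", OF geod_antipode[OF k a v(1) ne L(2), symmetric]]) (simp add: le)
  qed
qed

text \<open>The geodesic ray from an exterior point, pointing away from \<open>a\<close>, never returns to the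
  star-shaped set \<open>K\<close>. For \<open>\<kappa> > 0\<close> it reaches the antipode of \<open>a\<close>.\<close>

lemma enclosed_subset:
  assumes T: "T \<subseteq> K" and C: "C \<in> components (model_plane \<kappa> - T)"
    and enclosed: "if \<kappa> > 0 then \<exists>e. \<forall>v\<in>C. e \<bullet> v > 0 else bounded C"
  shows "C \<subseteq> K"
proof (rule ccontr)
  assume "\<not> C \<subseteq> K"
  then obtain v where v: "v \<in> C" "v \<notin> K" by blast
  have CM: "C \<subseteq> model_plane \<kappa> - T" by (rule in_components_subset[OF C])
  have vM: "v \<in> model_plane \<kappa>" using v CM by auto
  have a: "a \<in> model_plane \<kappa>" using K hsD by auto
  have max: "\<Gamma> \<subseteq> C" if "connected \<Gamma>" "\<Gamma> \<subseteq> model_plane \<kappa> - K" "\<Gamma> \<inter> C \<noteq> {}" for \<Gamma>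
    by (rule components_maximal[OF C that(1)]) (use that T in auto)
  show False
  proof (cases "\<kappa> > 0")
    case True
    have aC: "- a \<in> C"
    proof -
      obtain \<Gamma> where \<Gamma>: "connected \<Gamma>" "\<Gamma> \<subseteq> model_plane \<kappa> - K" "v \<in> \<Gamma>" "- a \<in> \<Gamma>"
        by (rule escape_to_antipode[OF True vM v(2)])
      then show ?thesis using max[OF \<Gamma>(1,2)] v(1) by blast
    qed
    \<comment> \<open>All points off K are connected to the antipode of a without meeting K, so they
      belong to the same component.\<close>
    have all: "u \<in> C" if u: "u \<in> model_plane \<kappa>" "u \<notin> K" for u
    proof -
      obtain \<Gamma> where \<Gamma>: "connected \<Gamma>" "\<Gamma> \<subseteq> model_plane \<kappa> - K" "u \<in> \<Gamma>" "- a \<in> \<Gamma>"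
        by (rule escape_to_antipode[OF True u])
      then show ?thesis using max[OF \<Gamma>(1,2)] aC by blast
    qed
    \<comment> \<open>A direction orthogonal to the vector defining the half-space around K gives an
      antipodal pair off K, hence in C. No linear functional is positive on both.\<close>
    obtain u0 where u0: "u0 \<noteq> 0" "e \<bullet> u0 = 0"
    proof -
      have "2 \<le> DIM(real^3)" by simp
      from orthogonal_to_vector_exists[OF this, of e] show ?thesis using that
        by (auto simp: orthogonal_def)
    qed
    obtain k where k: "k *\<^sub>R u0 \<in> model_plane \<kappa>" using normalize_pos[OF True u0(1)] by auto
    let ?u = "k *\<^sub>R u0"
    have "?u \<notin> K" "- ?u \<notin> K" using K(1) u0 by (auto simp: half_plane_def)
    then have "?u \<in> C" "- ?u \<in> C" using all k antipode(1)[OF True k] by auto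
    moreover obtain e' where "\<forall>v\<in>C. e' \<bullet> v > 0" using enclosed True by auto
    ultimately have "e' \<bullet> ?u > 0" "e' \<bullet> (- ?u) > 0" by blast+
    then show False by simp
  next
    case False
    let ?L = "model_dist \<kappa> a v"
    have ne: "a \<noteq> v" using v K by auto
    have L: "0 < ?L" "short \<kappa> ?L" using model_dist_pos[OF a vM ne] False by (auto simp: short_def)
    have "geod \<kappa> a v ` {?L..} \<subseteq> C"
    proof (rule max)
      show "connected (geod \<kappa> a v ` {?L..})"
        by (intro connected_continuous_image continuous_geod) simp
      show "geod \<kappa> a v ` {?L..} \<subseteq> model_plane \<kappa> - K"
        using ray_outside[OF vM v(2)] False by (auto simp: fits_def)
      have "v \<in> geod \<kappa> a v ` {?L..}"
        by (rule image_eqI[where x = ?L and f = "geod \<kappa> a v", OF geod_end[OF a vM ne L(2), symmetric]]) simp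
      then show "geod \<kappa> a v ` {?L..} \<inter> C \<noteq> {}" using v by blast
    qed
    note sub = this
    have "bounded C" using enclosed False by simp
    then obtain B where B: "\<And>u. u \<in> C \<Longrightarrow> norm (a - u) \<le> B"
      using bounded_any_center[of C a] by (auto simp: dist_norm)
    define t where "t = max ?L (2 * B + 1)"
    have tC: "geod \<kappa> a v t \<in> C" using sub by (auto simp: t_def)
    then have "geod \<kappa> a v t \<in> model_plane \<kappa>" using CM by blast
    then have "model_dist \<kappa> a (geod \<kappa> a v t) \<le> 2 * B"
      using model_dist_le_norm[of \<kappa> a "geod \<kappa> a v t"] B[OF tC] False a by simp
    moreover have "model_dist \<kappa> a (geod \<kappa> a v t) = t"
      using geod_dist_left[OF a vM refl L, of t] False L by (simp add: fits_def t_def)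
    ultimately show False by (simp add: t_def)
  qed
qed

end

text \<open>The closed triangle in homogeneous coordinates, which makes membership a matter of
  signs.\<close>

definition cone3 :: "real \<Rightarrow> real^3 \<Rightarrow> real^3 \<Rightarrow> real^3 \<Rightarrow> (real^3) set" where
  "cone3 \<kappa> a b c = {v \<in> model_plane \<kappa>. \<exists>l m n. 0 \<le> l \<and> 0 \<le> m \<and> 0 \<le> n \<and>
     v = l *\<^sub>R a + m *\<^sub>R b + n *\<^sub>R c}"

lemma cone3I: "v \<in> model_plane \<kappa> \<Longrightarrow> v = l *\<^sub>R a + m *\<^sub>R b + n *\<^sub>R c \<Longrightarrow> 0 \<le> l \<Longrightarrow> 0 \<le> m \<Longrightarrow> 0 \<le> n \<Longrightarrow>
    v \<in> cone3 \<kappa> a b c"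
  unfolding cone3_def by blast

lemma cone3_hs:
  assumes "a \<in> half_plane \<kappa> e" "b \<in> half_plane \<kappa> e" "c \<in> half_plane \<kappa> e"
  shows "cone3 \<kappa> a b c \<subseteq> half_plane \<kappa> e"
proof
  fix v assume "v \<in> cone3 \<kappa> a b c"
  then obtain l m n where v: "v \<in> model_plane \<kappa>" "0 \<le> l" "0 \<le> m" "0 \<le> n"
    "v = l *\<^sub>R a + m *\<^sub>R b + n *\<^sub>R c" unfolding cone3_def by blast
  note p = assms[THEN hsD(2)]
  have nn: "0 \<le> l * (e \<bullet> a)" "0 \<le> m * (e \<bullet> b)" "0 \<le> n * (e \<bullet> c)" using v p by auto
  have "\<not> (l = 0 \<and> m = 0 \<and> n = 0)" using v zero_notin_model by auto
  then have "l * (e \<bullet> a) \<noteq> 0 \<or> m * (e \<bullet> b) \<noteq> 0 \<or> n * (e \<bullet> c) \<noteq> 0" using p by auto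
  then have "0 < l * (e \<bullet> a) + m * (e \<bullet> b) + n * (e \<bullet> c)" using nn by linarith
  then show "v \<in> half_plane \<kappa> e" using v by (simp add: half_plane_def inner_add_right)
qed

lemma bounded_cone3:
  assumes M: "a \<in> model_plane \<kappa>" "b \<in> model_plane \<kappa>" "c \<in> model_plane \<kappa>" and k: "\<kappa> \<le> 0"
  shows "bounded (cone3 \<kappa> a b c)"
  unfolding bounded_iff
proof (intro exI ballI)
  fix v assume "v \<in> cone3 \<kappa> a b c"
  then obtain l m n where v: "v \<in> model_plane \<kappa>" "0 \<le> l" "0 \<le> m" "0 \<le> n"
    "v = l *\<^sub>R a + m *\<^sub>R b + n *\<^sub>R c" unfolding cone3_def by blast
  \<comment> \<open>For \<kappa> = 0 the coefficients add up to 1. For \<kappa> < 0 the sum of their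
    squares is at most 1, because the mixed terms are nonnegative.\<close>
  have lmn: "l \<le> 1 \<and> m \<le> 1 \<and> n \<le> 1"
  proof (cases "\<kappa> = 0")
    case True
    then have "v$3 = 1" "a$3 = 1" "b$3 = 1" "c$3 = 1" using M v by (auto simp: model_plane_iff)
    then have "l + m + n = 1" using v(5) by simp
    then show ?thesis using v by simp
  next
    case False
    then have kn: "\<kappa> < 0" using k by simp
    have 1: "\<kappa> * mform \<kappa> u u = 1" if "u \<in> model_plane \<kappa>" for u using that False by (simp add: model_plane_iff)
    have "\<kappa> * mform \<kappa> v v = l\<^sup>2 * (\<kappa> * mform \<kappa> a a) + m\<^sup>2 * (\<kappa> * mform \<kappa> b b) + n\<^sup>2 * (\<kappa> * mform \<kappa> c c)
        + 2 * l * m * (\<kappa> * mform \<kappa> a b) + 2 * l * n * (\<kappa> * mform \<kappa> a c) + 2 * m * n * (\<kappa> * mform \<kappa> b c)"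
      unfolding v(5) mform_add mform_scale mform_sym[of \<kappa> b a] mform_sym[of \<kappa> c a] mform_sym[of \<kappa> c b]
      by algebra
    then have eq: "1 = l\<^sup>2 + m\<^sup>2 + n\<^sup>2
        + 2 * l * m * (\<kappa> * mform \<kappa> a b) + 2 * l * n * (\<kappa> * mform \<kappa> a c) + 2 * m * n * (\<kappa> * mform \<kappa> b c)"
      using M v 1 by simp
    have "0 \<le> 2 * l * m * (\<kappa> * mform \<kappa> a b)" "0 \<le> 2 * l * n * (\<kappa> * mform \<kappa> a c)" "0 \<le> 2 * m * n * (\<kappa> * mform \<kappa> b c)"
      using hyperbolic_form(1)[OF kn M(1,2)] hyperbolic_form(1)[OF kn M(1,3)] hyperbolic_form(1)[OF kn M(2,3)] v
      by (auto intro!: mult_nonneg_nonneg)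
    then have "l\<^sup>2 \<le> 1\<^sup>2" "m\<^sup>2 \<le> 1\<^sup>2" "n\<^sup>2 \<le> 1\<^sup>2"
      using eq zero_le_power2[of l] zero_le_power2[of m] zero_le_power2[of n] unfolding one_power2 by linarith+
    then show ?thesis by (auto intro: power2_le_imp_le)
  qed
  have "norm v \<le> l * norm a + m * norm b + n * norm c"
    unfolding v(5) using v(2-4) by (intro norm_triangle_le add_mono) auto
  also have "\<dots> \<le> norm a + norm b + norm c"
    using lmn v by (intro add_mono mult_left_le_one_le) auto
  finally show "norm v \<le> norm a + norm b + norm c" .
qed

lemma closed_model_plane: "closed (model_plane \<kappa>)"
proof -
  have "model_plane \<kappa> = (if \<kappa> = 0 then {v. v$3 = 1}
      else if \<kappa> < 0 then {v. \<kappa> * mform \<kappa> v v = 1} \<inter> {v. v$3 \<ge> 0} else {v. \<kappa> * mform \<kappa> v v = 1})"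
  proof -
    have "v$3 \<noteq> 0" if "\<kappa> < 0" "\<kappa> * mform \<kappa> v v = 1" for v
    proof
      assume "v$3 = 0"
      then have "mform \<kappa> v v \<ge> 0" by (simp add: mform_def)
      then show False using that by (smt (verit) mult_nonpos_nonneg)
    qed
    then show ?thesis by (auto simp: model_plane_iff less_le)
  qed
  moreover have "closed {v. \<kappa> * mform \<kappa> v v = 1}" "closed {v :: real^3. v$3 \<ge> 0}" "closed {v :: real^3. v$3 = 1}"
    unfolding mform_def by (intro closed_Collect_eq closed_Collect_le continuous_intros)+
  ultimately show ?thesis by auto
qed

lemma bounded_model_plane: "\<kappa> > 0 \<Longrightarrow> bounded (model_plane \<kappa>)"
  by (rule bounded_subset[of "cball 0 (1 / sqrt \<kappa>)"])
    (auto simp: model_plane_def norm_eq_sqrt_inner real_sqrt_divide)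

subsection \<open>Nondegenerate triangles\<close>

text \<open>The vectors p, q, r are the dual basis of a, b, c: they read off homogeneous barycentric
  coordinates, and their sum is positive at all vertices, which provides the common
  half-space.\<close>

locale dual3 =
  fixes a b c p q r :: "real^3"
  assumes expand: "\<And>v. v = (p \<bullet> v) *\<^sub>R a + (q \<bullet> v) *\<^sub>R b + (r \<bullet> v) *\<^sub>R c"
    and dual: "p \<bullet> a = 1" "p \<bullet> b = 0" "p \<bullet> c = 0" "q \<bullet> a = 0" "q \<bullet> b = 1" "q \<bullet> c = 0"
      "r \<bullet> a = 0" "r \<bullet> b = 0" "r \<bullet> c = 1"
begin

lemma coords: "p \<bullet> (l *\<^sub>R a + m *\<^sub>R b + n *\<^sub>R c) = l" "q \<bullet> (l *\<^sub>R a + m *\<^sub>R b + n *\<^sub>R c) = m"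
    "r \<bullet> (l *\<^sub>R a + m *\<^sub>R b + n *\<^sub>R c) = n"
  by (simp_all add: inner_add_right dual)

lemma cone3_iff: "v \<in> cone3 \<kappa> a b c \<longleftrightarrow> v \<in> model_plane \<kappa> \<and> 0 \<le> p \<bullet> v \<and> 0 \<le> q \<bullet> v \<and> 0 \<le> r \<bullet> v"
proof
  assume "v \<in> cone3 \<kappa> a b c"
  then show "v \<in> model_plane \<kappa> \<and> 0 \<le> p \<bullet> v \<and> 0 \<le> q \<bullet> v \<and> 0 \<le> r \<bullet> v"
    unfolding cone3_def using coords by auto
next
  assume "v \<in> model_plane \<kappa> \<and> 0 \<le> p \<bullet> v \<and> 0 \<le> q \<bullet> v \<and> 0 \<le> r \<bullet> v"
  then show "v \<in> cone3 \<kappa> a b c" using expand[of v] by (intro cone3I) auto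
qed

lemma hs3:
  assumes "a \<in> model_plane \<kappa>" "b \<in> model_plane \<kappa>" "c \<in> model_plane \<kappa>"
  shows "a \<in> half_plane \<kappa> (p + q + r)" "b \<in> half_plane \<kappa> (p + q + r)" "c \<in> half_plane \<kappa> (p + q + r)"
  using assms by (auto simp: half_plane_def inner_add_left dual)

lemma compact_cone3:
  assumes M: "a \<in> model_plane \<kappa>" "b \<in> model_plane \<kappa>" "c \<in> model_plane \<kappa>"
  shows "compact (cone3 \<kappa> a b c)"
proof -
  have "cone3 \<kappa> a b c = model_plane \<kappa> \<inter> {v. 0 \<le> p \<bullet> v} \<inter> {v. 0 \<le> q \<bullet> v} \<inter> {v. 0 \<le> r \<bullet> v}"
    using cone3_iff by auto
  then have "closed (cone3 \<kappa> a b c)"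
    by (auto intro!: closed_Int closed_model_plane closed_Collect_le continuous_intros)
  moreover have "bounded (cone3 \<kappa> a b c)"
  proof (cases "\<kappa> > 0")
    case True
    then show ?thesis by (rule bounded_subset[OF bounded_model_plane]) (auto simp: cone3_def)
  qed (use bounded_cone3[OF M] in auto)
  ultimately show ?thesis by (simp add: compact_eq_bounded_closed)
qed

lemma triangle_in_cone3:
  assumes M: "a \<in> model_plane \<kappa>" "b \<in> model_plane \<kappa>" "c \<in> model_plane \<kappa>"
  shows "geodesic_triangle \<kappa> a b c \<subseteq> cone3 \<kappa> a b c"
proof
  fix v assume v: "v \<in> geodesic_triangle \<kappa> a b c"
  then have vM: "v \<in> model_plane \<kappa>" by (auto simp: geodesic_triangle_def seg_iff)
  note h = hs3[OF M]
  have "\<exists>l m n. 0 \<le> l \<and> 0 \<le> m \<and> 0 \<le> n \<and> v = l *\<^sub>R a + m *\<^sub>R b + n *\<^sub>R c"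
    using v unfolding geodesic_triangle_def
  proof (elim UnE)
    assume "v \<in> seg \<kappa> a b"
    then obtain l m where "0 \<le> l" "0 \<le> m" "v = l *\<^sub>R a + m *\<^sub>R b" by (rule hs_coeffs[OF h(1,2)])
    then show ?thesis by (intro exI[of _ l] exI[of _ m] exI[of _ 0]) simp
  next
    assume "v \<in> seg \<kappa> b c"
    then obtain l m where "0 \<le> l" "0 \<le> m" "v = l *\<^sub>R b + m *\<^sub>R c" by (rule hs_coeffs[OF h(2,3)])
    then show ?thesis by (intro exI[of _ 0] exI[of _ l] exI[of _ m]) simp
  next
    assume "v \<in> seg \<kappa> c a"
    then obtain l m where "0 \<le> l" "0 \<le> m" "v = l *\<^sub>R c + m *\<^sub>R a" by (rule hs_coeffs[OF h(3,1)])
    then show ?thesis by (intro exI[of _ m] exI[of _ 0] exI[of _ l]) simp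
  qed
  then show "v \<in> cone3 \<kappa> a b c" using vM unfolding cone3_def by blast
qed

lemma cone3_boundary:
  assumes M: "a \<in> model_plane \<kappa>" "b \<in> model_plane \<kappa>" "c \<in> model_plane \<kappa>"
    and v: "v \<in> cone3 \<kappa> a b c" and 0: "p \<bullet> v = 0 \<or> q \<bullet> v = 0 \<or> r \<bullet> v = 0"
  shows "v \<in> geodesic_triangle \<kappa> a b c"
proof -
  note h = hs3[OF M]
  have v': "v \<in> model_plane \<kappa>" "0 \<le> p \<bullet> v" "0 \<le> q \<bullet> v" "0 \<le> r \<bullet> v" using v cone3_iff by auto
  from 0 show ?thesis
  proof (elim disjE)
    assume "p \<bullet> v = 0"
    then have "v = (q \<bullet> v) *\<^sub>R b + (r \<bullet> v) *\<^sub>R c" using expand[of v] by simp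
    then have "v \<in> seg \<kappa> b c" by (rule hs_seg[OF h(2,3) v'(1) _ v'(3,4)])
    then show ?thesis by (simp add: geodesic_triangle_def)
  next
    assume "q \<bullet> v = 0"
    then have "v = (r \<bullet> v) *\<^sub>R c + (p \<bullet> v) *\<^sub>R a" using expand[of v] by (simp add: add.commute)
    then have "v \<in> seg \<kappa> c a" by (rule hs_seg[OF h(3,1) v'(1) _ v'(4,2)])
    then show ?thesis by (simp add: geodesic_triangle_def)
  next
    assume "r \<bullet> v = 0"
    then have "v = (p \<bullet> v) *\<^sub>R a + (q \<bullet> v) *\<^sub>R b" using expand[of v] by simp
    then have "v \<in> seg \<kappa> a b" by (rule hs_seg[OF h(1,2) v'(1) _ v'(2,3)])
    then show ?thesis by (simp add: geodesic_triangle_def)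
  qed
qed

text \<open>The cone is star-shaped about a, so \<open>enclosed_subset\<close> gives one inclusion.
  Conversely, off the sides either all coordinates are positive or some coordinate is negative; both
  conditions are open, so the component of an interior point stays in the cone.\<close>

lemma triangular_region_cone3:
  assumes M: "a \<in> model_plane \<kappa>" "b \<in> model_plane \<kappa>" "c \<in> model_plane \<kappa>"
  shows "triangular_region \<kappa> a b c = cone3 \<kappa> a b c"
proof
  note h = hs3[OF M]
  let ?T = "geodesic_triangle \<kappa> a b c" and ?K = "cone3 \<kappa> a b c"
  have aK: "a \<in> ?K" using M by (intro cone3I[of a \<kappa> 1 a 0 b 0 c]) auto
  have star: "seg \<kappa> a s \<subseteq> ?K" if s: "s \<in> ?K" for s
  proof
    fix v assume v: "v \<in> seg \<kappa> a s"
    have "s \<in> half_plane \<kappa> (p + q + r)" using cone3_hs[OF h] s by auto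
    then obtain l m where lm: "0 \<le> l" "0 \<le> m" "v = l *\<^sub>R a + m *\<^sub>R s" by (rule hs_coeffs[OF h(1) _ v])
    then have "p \<bullet> v = l + m * (p \<bullet> s)" "q \<bullet> v = m * (q \<bullet> s)" "r \<bullet> v = m * (r \<bullet> s)"
      by (simp_all add: inner_add_right dual)
    then show "v \<in> ?K" using lm s v by (auto simp: cone3_iff seg_iff)
  qed
  show "triangular_region \<kappa> a b c \<subseteq> ?K"
    unfolding triangular_region_def
    using triangle_in_cone3[OF M] enclosed_subset[OF cone3_hs[OF h] aK star triangle_in_cone3[OF M]] by blast
  show "?K \<subseteq> triangular_region \<kappa> a b c"
  proof
    fix v assume v: "v \<in> ?K"
    show "v \<in> triangular_region \<kappa> a b c"
    proof (cases "v \<in> ?T")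
      case True
      then show ?thesis by (simp add: triangular_region_def)
    next
      case False
      let ?S = "model_plane \<kappa> - ?T"
      let ?C = "connected_component_set ?S v"
      have vS: "v \<in> ?S" using v False by (auto simp: cone3_def)
      have C: "?C \<in> components ?S" "v \<in> ?C" using vS by (auto simp: components_def)
      let ?U1 = "{u. 0 < p \<bullet> u} \<inter> {u. 0 < q \<bullet> u} \<inter> {u. 0 < r \<bullet> u}"
      let ?U2 = "{u. p \<bullet> u < 0} \<union> {u. q \<bullet> u < 0} \<union> {u. r \<bullet> u < 0}"
      have o: "open ?U1" "open ?U2"
        by (intro open_Int open_Un open_Collect_less continuous_intros)+
      have cover: "u \<in> ?U1 \<union> ?U2" if "u \<in> ?S" for u
        using that cone3_boundary[OF M, of u] by (force simp: cone3_iff)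
      have "v \<in> ?U1" using cover[OF vS] v by (auto simp: cone3_iff)
      moreover have "?C \<subseteq> ?U1 \<union> ?U2" using cover in_components_subset[OF C(1)] by blast
      moreover have "?U1 \<inter> ?U2 \<inter> ?C = {}" by auto
      ultimately have "?U2 \<inter> ?C = {}"
        using connectedD[OF in_components_connected[OF C(1)] o] C(2) by blast
      note disj = this
      have CK: "?C \<subseteq> ?K"
      proof
        fix u assume u: "u \<in> ?C"
        have "u \<in> ?S" using u in_components_subset[OF C(1)] by blast
        moreover have "u \<in> ?U1" using u disj cover[OF calculation] by blast
        ultimately show "u \<in> ?K" by (auto simp: cone3_iff)
      qed
      have "if \<kappa> > 0 then \<exists>e. \<forall>v\<in>?C. e \<bullet> v > 0 else bounded ?C"
      proof (cases "\<kappa> > 0")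
        case True
        then show ?thesis using CK cone3_hs[OF h] hsD(2) by (auto intro!: exI[of _ "p + q + r"])
      next
        case False
        then show ?thesis using bounded_subset[OF bounded_cone3[OF M] CK] by simp
      qed
      then show ?thesis using C unfolding triangular_region_def by blast
    qed
  qed
qed

end

subsection \<open>Degenerate triangles\<close>

lemma geodesic_triangle_rotate: "geodesic_triangle \<kappa> a b c = geodesic_triangle \<kappa> b c a"
  and geodesic_triangle_flip: "geodesic_triangle \<kappa> a b c = geodesic_triangle \<kappa> b a c"
  using seg_sym unfolding geodesic_triangle_def by blast+

lemma triangular_region_rotate: "triangular_region \<kappa> a b c = triangular_region \<kappa> b c a"
  unfolding triangular_region_def by (simp only: geodesic_triangle_rotate[of \<kappa> a b c])

lemma triangular_region_flip: "triangular_region \<kappa> a b c = triangular_region \<kappa> b a c"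
  unfolding triangular_region_def by (simp only: geodesic_triangle_flip[of \<kappa> a b c])

text \<open>For \<kappa> > 0 the sum a + b is nonzero because the points are not antipodal, and
  positive on both because their norms agree. Otherwise the third coordinate is positive on the
  whole surface.\<close>

lemma common_half_space:
  assumes "a \<in> model_plane \<kappa>" "b \<in> model_plane \<kappa>" "short \<kappa> (model_dist \<kappa> a b)"
  obtains e where "a \<in> half_plane \<kappa> e" "b \<in> half_plane \<kappa> e"
proof (cases "\<kappa> > 0")
  case True
  have "a + b \<noteq> 0"
  proof
    assume "a + b = 0"
    then have "b = - a" by (simp add: eq_neg_iff_add_eq_0 add.commute)
    then have "model_dist \<kappa> a b = dia \<kappa>" using antipode(2)[OF True assms(1,1)] assms(1) by simp
    then show False using assms(3) True by (simp add: short_def)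
  qed
  then have "0 < (a + b) \<bullet> (a + b)" by simp
  moreover have "a \<bullet> a = b \<bullet> b" using assms True by (simp add: model_plane_def)
  ultimately have "0 < (a + b) \<bullet> a" "0 < (a + b) \<bullet> b"
    by (simp_all add: inner_add_left inner_add_right inner_commute[of b a])
  then show ?thesis using that[of "a + b"] assms by (simp add: half_plane_def)
next
  case False
  have "axis 3 1 \<bullet> v = v$3" for v :: "real^3" by (simp add: inner_axis' )
  then show ?thesis using that[of "axis 3 1"] assms False
    by (auto simp: half_plane_def model_plane_iff split: if_splits)
qed

text \<open>The segment is star-shaped about a, so an enclosed component would be contained in the
  segment from which it is disjoint.\<close>

lemma triangular_region_degenerate:
  assumes M: "a \<in> model_plane \<kappa>" "b \<in> model_plane \<kappa>" "c \<in> seg \<kappa> a b"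
    and short: "short \<kappa> (model_dist \<kappa> a b)"
  shows "triangular_region \<kappa> a b c = seg \<kappa> a b"
proof -
  obtain e where e: "a \<in> half_plane \<kappa> e" "b \<in> half_plane \<kappa> e" by (rule common_half_space[OF M(1,2) short])
  have cM: "c \<in> model_plane \<kappa>" using M by (simp add: seg_iff)
  have sub: "seg \<kappa> a s \<subseteq> seg \<kappa> a b" if s: "s \<in> seg \<kappa> a b" for s
  proof
    fix v assume v: "v \<in> seg \<kappa> a s"
    have "v \<in> model_plane \<kappa>" "s \<in> model_plane \<kappa>" using v s by (auto simp: seg_iff)
    then show "v \<in> seg \<kappa> a b"
      using v s model_dist_triangle[of v \<kappa> s b] model_dist_triangle[of a \<kappa> v b] M by (auto simp: seg_iff)
  qed
  have sub2: "seg \<kappa> b c \<subseteq> seg \<kappa> a b"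
  proof
    fix v assume v: "v \<in> seg \<kappa> b c"
    have "v \<in> model_plane \<kappa>" using v by (auto simp: seg_iff)
    then show "v \<in> seg \<kappa> a b"
      using v M(3) model_dist_triangle[of a \<kappa> c v] model_dist_triangle[of a \<kappa> v b] M(1,2) cM
      by (auto simp: seg_iff model_dist_sym)
  qed
  have T: "geodesic_triangle \<kappa> a b c = seg \<kappa> a b"
    using sub[OF M(3)] sub2 by (auto simp: geodesic_triangle_def seg_sym[of \<kappa> c a])
  have K: "seg \<kappa> a b \<subseteq> half_plane \<kappa> e" using seg_hs[OF e] by auto
  have aK: "a \<in> seg \<kappa> a b" using M by (simp add: seg_iff)
  have "C \<subseteq> {}" if C: "C \<in> components (model_plane \<kappa> - seg \<kappa> a b)"
    "if \<kappa> > 0 then \<exists>e. \<forall>v\<in>C. e \<bullet> v > 0 else bounded C" for C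
    using enclosed_subset[OF K aK sub order.refl C] in_components_subset[OF C(1)] by blast
  then show ?thesis unfolding triangular_region_def T by blast
qed

lemma compact_seg:
  assumes M: "a \<in> model_plane \<kappa>" "b \<in> model_plane \<kappa>" "a \<noteq> b" and short: "short \<kappa> (model_dist \<kappa> a b)"
  shows "compact (seg \<kappa> a b)"
proof -
  let ?L = "model_dist \<kappa> a b"
  have L: "0 < ?L" by (rule model_dist_pos[OF M])
  have "seg \<kappa> a b = geod \<kappa> a b ` {0..?L}"
  proof
    show "geod \<kappa> a b ` {0..?L} \<subseteq> seg \<kappa> a b" using geod_seg(1)[OF M(1,2) refl L short] by auto
    show "seg \<kappa> a b \<subseteq> geod \<kappa> a b ` {0..?L}"
    proof
      fix u assume u: "u \<in> seg \<kappa> a b"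
      then have "u \<in> model_plane \<kappa>" "?L = model_dist \<kappa> a u + model_dist \<kappa> u b" by (auto simp: seg_iff)
      then have "model_dist \<kappa> a u \<in> {0..?L}"
        using model_dist_nonneg[of a \<kappa> u] model_dist_nonneg[of u \<kappa> b] M by auto
      then show "u \<in> geod \<kappa> a b ` {0..?L}" using seg_geod[OF M(1,2) refl L short u] by blast
    qed
  qed
  then show ?thesis by (simp add: compact_continuous_image continuous_geod)
qed

text \<open>Cramer's rule with the cofactors written as cross products.\<close>

lemma triple_expand:
  fixes a b c v :: "real^3"
  shows "(a \<bullet> cross3 b c) *\<^sub>R v = (cross3 b c \<bullet> v) *\<^sub>R a + (cross3 c a \<bullet> v) *\<^sub>R b + (cross3 a b \<bullet> v) *\<^sub>R c"
  by (simp add: vec_eq_iff forall_3 cross3_def inner_vec_def sum_3) algebra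

lemma dual3_exists:
  fixes a b c :: "real^3"
  assumes "a \<bullet> cross3 b c \<noteq> 0"
  obtains p q r where "dual3 a b c p q r"
proof -
  let ?D = "a \<bullet> cross3 b c"
  have sym: "cross3 b c \<bullet> a = ?D" "cross3 c a \<bullet> b = ?D" "cross3 a b \<bullet> c = ?D"
    by (simp_all add: cross3_def inner_vec_def sum_3 algebra_simps)
  have zero: "cross3 b c \<bullet> b = 0" "cross3 b c \<bullet> c = 0" "cross3 c a \<bullet> a = 0" "cross3 c a \<bullet> c = 0"
    "cross3 a b \<bullet> a = 0" "cross3 a b \<bullet> b = 0"
    by (simp_all add: cross3_def inner_vec_def sum_3 algebra_simps)
  have "dual3 a b c (cross3 b c /\<^sub>R ?D) (cross3 c a /\<^sub>R ?D) (cross3 a b /\<^sub>R ?D)"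
  proof
    show "v = ((cross3 b c /\<^sub>R ?D) \<bullet> v) *\<^sub>R a + ((cross3 c a /\<^sub>R ?D) \<bullet> v) *\<^sub>R b + ((cross3 a b /\<^sub>R ?D) \<bullet> v) *\<^sub>R c" for v
    proof -
      have "v = inverse ?D *\<^sub>R (?D *\<^sub>R v)" using assms by simp
      also have "\<dots> = ((cross3 b c /\<^sub>R ?D) \<bullet> v) *\<^sub>R a + ((cross3 c a /\<^sub>R ?D) \<bullet> v) *\<^sub>R b + ((cross3 a b /\<^sub>R ?D) \<bullet> v) *\<^sub>R c"
        unfolding triple_expand by (simp add: scaleR_add_right)
      finally show ?thesis .
    qed
  qed (use assms sym zero in auto)
  then show ?thesis by (rule that)
qed

lemma model_plane_collinear:
  assumes M: "a \<in> model_plane \<kappa>" "r *\<^sub>R a \<in> model_plane \<kappa>" and na: "\<kappa> > 0 \<Longrightarrow> r *\<^sub>R a \<noteq> - a"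
  shows "r = 1"
proof -
  have "0 < r"
  proof (rule ccontr)
    assume "\<not> 0 < r"
    moreover have "r \<noteq> 0" using M zero_notin_model by fastforce
    ultimately have r: "r < 0" by simp
    show False
    proof (cases "\<kappa> > 0")
      case True
      have "(- r) *\<^sub>R (- a) \<in> model_plane \<kappa>" "- a \<in> model_plane \<kappa>" using M antipode(1)[OF True] by auto
      then have "- r = 1" using model_plane_proportional[of "- a" \<kappa> "- r"] r by simp
      then have "r = - 1" by simp
      then show False using na[OF True] by simp
    next
      case False
      then have "0 < a$3" "0 < (r *\<^sub>R a)$3" using M by (auto simp: model_plane_iff split: if_splits)
      then show False using r by (simp add: zero_less_mult_iff)
    qed
  qed
  then show ?thesis using model_plane_proportional[OF M] by simp
qed

text \<open>If the determinant vanishes, c is a combination of a and b, and the signs of its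
  coefficients tell which vertex is in the middle. Two negative signs would give a full great
  circle, of perimeter 2 * \<open>dia\<close> \<kappa>, if \<kappa> > 0, and contradict the positive
  third coordinate otherwise.\<close>

lemma triangle_cases:
  assumes M: "a \<in> model_plane \<kappa>" "b \<in> model_plane \<kappa>" "c \<in> model_plane \<kappa>"
    and ne: "a \<noteq> b"
    and small: "small \<kappa> (model_dist \<kappa> a b + model_dist \<kappa> b c + model_dist \<kappa> c a)"
  obtains (nondegenerate) p q r where "dual3 a b c p q r"
  | (c) "c \<in> seg \<kappa> a b" | (b) "b \<in> seg \<kappa> a c" | (a) "a \<in> seg \<kappa> b c"
proof (cases "a \<bullet> cross3 b c = 0")
  case False
  then show ?thesis using dual3_exists nondegenerate by blast
next
  case True
  have sh: "short \<kappa> (model_dist \<kappa> a b)" "short \<kappa> (model_dist \<kappa> a c)" "short \<kappa> (model_dist \<kappa> b c)"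
    using small_short[OF small] model_dist_triangle[OF M(1,3,2)] model_dist_triangle[OF M(2,1,3)]
      model_dist_triangle[OF M(1,2,3)] by (auto simp: model_dist_sym)
  have na: "v \<noteq> - u" if "u \<in> model_plane \<kappa>" "short \<kappa> (model_dist \<kappa> u v)" "\<kappa> > 0" for u v
    using that antipode(2)[OF that(3,1,1)] by (auto simp: short_def)
  \<comment> \<open>The normal completes a, b to a basis in which c has no third component.\<close>
  let ?n = "cross3 a b"
  have "?n \<noteq> 0"
  proof
    assume "?n = 0"
    then have "collinear {0, a, b}" by (simp add: cross_eq_0)
    moreover have "a \<noteq> 0" "b \<noteq> 0" using M zero_notin_model by auto
    ultimately obtain r where r: "b = r *\<^sub>R a" by (auto simp: collinear_lemma)
    then have "r = 1" using model_plane_collinear[of a \<kappa> r] M na[OF M(1) sh(1)] by auto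
    then show False using r ne by simp
  qed
  then have nn: "a \<bullet> cross3 b ?n \<noteq> 0"
  proof -
    have "a \<bullet> cross3 b ?n = ?n \<bullet> ?n" by (simp add: cross3_def inner_vec_def sum_3 algebra_simps)
    then show ?thesis using \<open>?n \<noteq> 0\<close> by simp
  qed
  have "?n \<bullet> c = 0" using True by (simp add: cross3_def inner_vec_def sum_3 algebra_simps)
  then have "(a \<bullet> cross3 b ?n) *\<^sub>R c = (cross3 b ?n \<bullet> c) *\<^sub>R a + (cross3 ?n a \<bullet> c) *\<^sub>R b"
    using triple_expand[of a b ?n c] by simp
  then have "inverse (a \<bullet> cross3 b ?n) *\<^sub>R ((a \<bullet> cross3 b ?n) *\<^sub>R c) =
      inverse (a \<bullet> cross3 b ?n) *\<^sub>R ((cross3 b ?n \<bullet> c) *\<^sub>R a + (cross3 ?n a \<bullet> c) *\<^sub>R b)" by (rule arg_cong)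
  then obtain l m where c: "c = l *\<^sub>R a + m *\<^sub>R b" using nn by (auto simp: scaleR_add_right)
  consider "0 \<le> l" "0 \<le> m" | "l < 0" "0 < m" | "0 < l" "m < 0" | "l < 0" "m < 0" | "l < 0" "m = 0" | "l = 0" "m < 0"
    by linarith
  then show ?thesis
  proof cases
    case 1
    then show ?thesis using coeffs_seg[OF M(1,2) sh(1) M(3) c] that by blast
  next
    case 2
    have "m *\<^sub>R b = (- l) *\<^sub>R a + 1 *\<^sub>R c" using c by simp
    then have "(1 / m) *\<^sub>R (m *\<^sub>R b) = (1 / m) *\<^sub>R ((- l) *\<^sub>R a + 1 *\<^sub>R c)" by (rule arg_cong)
    then have "b = (- l / m) *\<^sub>R a + (1 / m) *\<^sub>R c" using 2 by (simp add: scaleR_diff_right)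
    then have "b \<in> seg \<kappa> a c" by (rule coeffs_seg[OF M(1,3) sh(2) M(2)]) (use 2 in \<open>auto simp: divide_le_0_iff\<close>)
    then show ?thesis by (rule that)
  next
    case 3
    have "l *\<^sub>R a = (- m) *\<^sub>R b + 1 *\<^sub>R c" using c by simp
    then have "(1 / l) *\<^sub>R (l *\<^sub>R a) = (1 / l) *\<^sub>R ((- m) *\<^sub>R b + 1 *\<^sub>R c)" by (rule arg_cong)
    then have "a = (- m / l) *\<^sub>R b + (1 / l) *\<^sub>R c" using 3 by (simp add: scaleR_diff_right)
    then have "a \<in> seg \<kappa> b c" by (rule coeffs_seg[OF M(2,3) sh(3) M(1)]) (use 3 in \<open>auto simp: divide_le_0_iff\<close>)
    then show ?thesis by (rule that)
  next
    case 4
    have False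
    proof (cases "\<kappa> > 0")
      case True
      have "- c = (- l) *\<^sub>R a + (- m) *\<^sub>R b" using c by simp
      then have "- c \<in> seg \<kappa> a b"
        by (rule coeffs_seg[OF M(1,2) sh(1) antipode(1)[OF True M(3)]]) (use 4 in auto)
      then have "model_dist \<kappa> a b = (dia \<kappa> - model_dist \<kappa> a c) + (dia \<kappa> - model_dist \<kappa> b c)"
        using antipode(2)[OF True M(3)] M by (simp add: seg_iff model_dist_sym[of \<kappa> "- c"])
      then show False using small True by (simp add: small_def model_dist_sym[of \<kappa> c a])
    next
      case False
      then have p: "0 < a$3" "0 < b$3" "0 < c$3" using M by (auto simp: model_plane_iff split: if_splits)
      have "c$3 = l * a$3 + m * b$3" using c by simp
      moreover have "l * a$3 < 0" "m * b$3 < 0" using 4 p by (auto simp: mult_less_0_iff)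
      ultimately show False using p by linarith
    qed
    then show ?thesis ..
  next
    case 5
    then have "l = 1" using model_plane_collinear[of a \<kappa> l] M c na[OF M(1) sh(2)] by auto
    then show ?thesis using 5 by simp
  next
    case 6
    then have "m = 1" using model_plane_collinear[of b \<kappa> m] M c na[OF M(2) sh(3)] by auto
    then show ?thesis using 6 by simp
  qed
qed

text \<open>One backward reading at p would compare w and v, but its perimeter need not be small.
  Instead p advances towards v in short steps; each new point is again between x and w and
  equidistant from w and v.\<close>

lemma (in stewart_space) beyond_unique:
  assumes Y: "x \<in> Y" "w \<in> Y" "v \<in> Y"
    and M: "A \<in> model_plane \<kappa>" "B \<in> model_plane \<kappa>" "model_dist \<kappa> A B = d x w"
    and short: "short \<kappa> (d x w)" and xv: "d x v = d x w"
    and p: "p \<in> Y" "d x w = d x p + d p w" "d p v = d p w" "0 < d x p"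
  shows "d w v = 0"
proof -
  let ?L = "d x w"
  \<comment> \<open>Half of the gap to the diameter: a step of length r \<le> \<eta> gives r + d(p,
    w) < \<open>dia\<close> \<kappa>, and the fixed size makes finitely many steps suffice.\<close>
  define \<eta> where "\<eta> = (if \<kappa> > 0 then (dia \<kappa> - ?L) / 2 else 1)"
  have \<eta>: "0 < \<eta>" using short by (auto simp: \<eta>_def short_def)
  have step: "d w v = 0"
    if "p \<in> Y" "?L = d x p + d p w" "d p v = d p w" "0 < d x p" "d p w \<le> real n * \<eta>" for n p
    using that
  proof (induction n arbitrary: p)
    case 0
    then have "d p w = 0" using d_nonneg Y by (simp add: order_antisym)
    then show ?case using 0 d_triangle[of w p v] d_nonneg[of w v] Y by (simp add: d_sym)
  next
    case (Suc n)
    note p = Suc.prems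
    show ?case
    proof (cases "d p w = 0")
      case True
      then show ?thesis using p d_triangle[of w p v] d_nonneg[of w v] Y by (simp add: d_sym)
    next
      case False
      have pw: "0 < d p w" using False d_nonneg[of p w] p Y by simp
      define r where "r = min (d p w) \<eta>"
      have r: "0 < r" "r \<le> d p w" "r \<le> \<eta>" using pw \<eta> by (auto simp: r_def)
      obtain a where a: "a \<in> Y" "d p a = r" "d a v = d p w - r"
        using geodesic[OF p(1) Y(3), of r] r p(3) by auto
      have xa: "d x a = d x p + r"
        using d_triangle[OF Y(1) p(1) a(1)] d_triangle[OF Y(1) a(1) Y(3)] xv p(2) a by simp
      have L: "0 < ?L" using p pw by simp
      note P = M(1,2) M(3)[symmetric] L short
      let ?G = "geod \<kappa> A B"
      have GM: "?G t \<in> model_plane \<kappa>" for t by (rule geod_in[OF P])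
      have ts: "0 \<le> d x p" "d x p \<le> ?L" "0 \<le> d x p + r" "d x p + r \<le> ?L" using p r by auto
      have G: "model_dist \<kappa> (?G (d x p + r)) (?G (d x p)) = r"
        "model_dist \<kappa> A (?G (d x p)) = d x p" "model_dist \<kappa> A (?G (d x p + r)) = d x p + r"
        "model_dist \<kappa> (?G (d x p)) B = ?L - d x p" "model_dist \<kappa> (?G (d x p + r)) B = ?L - (d x p + r)"
        using geod_dist[OF P ts(1,2) ts(3,4)] geod_seg(2,3)[OF P ts(1,2)] geod_seg(2,3)[OF P ts(3,4)] r by auto
      have aw: "d a w \<le> model_dist \<kappa> (?G (d x p + r)) B"
      proof (rule upper_bound[OF a(1) Y(1,2) p(1) GM M(1,2)])
        show "?G (d x p) \<in> seg \<kappa> (?G (d x p + r)) A" using G GM by (simp add: seg_iff model_dist_sym)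
        have "2 * (r + d p w) < 2 * dia \<kappa>" if "\<kappa> > 0"
          using r(3) that p(2,4) short by (simp add: \<eta>_def short_def field_simps)
        moreover have "d a w \<le> r + d p w" using d_triangle[OF a(1) p(1) Y(2)] a by (simp add: d_sym)
        ultimately show "small \<kappa> (d p a + d a w + d w p)" using a by (auto simp: small_def d_sym)
        have "2 * ?L < 2 * dia \<kappa>" if "\<kappa> > 0" using short that by (simp add: short_def)
        then show "small \<kappa> (d p x + d x w + d w p)" using p by (auto simp: small_def d_sym)
      qed (use a r p G xa M shortD[OF short ts(4)] in \<open>auto simp: d_sym model_dist_sym\<close>)
      then have eq: "d a w = ?L - d x a"
        using G xa d_triangle[OF Y(1) a(1) Y(2)] by simp
      show ?thesis
      proof (rule Suc.IH[OF a(1)])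
        show "?L = d x a + d a w" "d a v = d a w" using eq xa a p by auto
        show "0 < d x a" using xa p r by simp
        show "d a w \<le> real n * \<eta>"
        proof (cases "r = \<eta>")
          case True
          then show ?thesis using eq xa p by (simp add: algebra_simps)
        next
          case False
          then have "r = d p w" by (auto simp: r_def min_def split: if_splits)
          then show ?thesis using eq xa p \<eta> by simp
        qed
      qed
    qed
  qed
  obtain n where "d p w \<le> real n * \<eta>"
    using reals_Archimedean3[OF \<eta>, rule_format, of "d p w"] less_imp_le by blast
  then show ?thesis by (rule step[OF p])
qed

lemma alexandrov_between_unique:
  assumes "alexandrov_space \<kappa> X" and "a \<in> X" "b \<in> X" "m \<in> X" "u \<in> X" "u' \<in> X"
    and "A \<in> model_plane \<kappa>" "B \<in> model_plane \<kappa>" "model_dist \<kappa> A B = dist a b"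
    and "dist a b = dist a m + dist m b" "0 < dist m b" "short \<kappa> (dist a b)"
    and "dist a u + dist u m = dist a m" "dist a u' = dist a u" "dist u' m = dist u m"
  shows "u' = u"
proof -
  have "ultra_dist (\<lambda>_. u) (\<lambda>_. u') = 0"
    by (rule stewart_space.between_unique[OF alexandrov_stewart[OF assms(1)],
        of "\<lambda>_. a" "\<lambda>_. b" "\<lambda>_. m" _ _ A B]) (use assms in auto)
  then show ?thesis by simp
qed

section \<open>Geodesic segments\<close>

text \<open>Since c prolongs both halves, \<open>path_exists\<close> applies and
  \<open>between_unique\<close> pins every point. The last two conclusions, closure under passing to
  points between an end and a point of the image, later capture p.\<close>

lemma alexandrov_segment:
  fixes X :: "'a::metric_space set"
  assumes X: "alexandrov_space \<kappa> X" and mem: "a \<in> X" "b \<in> X" "c \<in> X"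
    and M: "A \<in> model_plane \<kappa>" "B \<in> model_plane \<kappa>" "C \<in> seg \<kappa> A B"
    and d: "model_dist \<kappa> A B = dist a b" "model_dist \<kappa> A C = dist a c" "model_dist \<kappa> C B = dist c b"
    and ne: "c \<noteq> a" "c \<noteq> b" and short: "short \<kappa> (dist a b)"
  obtains f where "\<And>U. U \<in> seg \<kappa> A B \<Longrightarrow> f U \<in> X"
    "\<And>U V. U \<in> seg \<kappa> A B \<Longrightarrow> V \<in> seg \<kappa> A B \<Longrightarrow> dist (f U) (f V) = model_dist \<kappa> U V"
    "f A = a" "f B = b" "f C = c" "closed (f ` seg \<kappa> A B)"
    "\<And>g U. (\<And>U. U \<in> seg \<kappa> A B \<Longrightarrow> g U \<in> X) \<Longrightarrow>
       (\<And>U V. U \<in> seg \<kappa> A B \<Longrightarrow> V \<in> seg \<kappa> A B \<Longrightarrow> dist (g U) (g V) = model_dist \<kappa> U V) \<Longrightarrow>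
       g A = a \<Longrightarrow> g B = b \<Longrightarrow> g C = c \<Longrightarrow> U \<in> seg \<kappa> A B \<Longrightarrow> g U = f U"
    "\<And>m q. m \<in> f ` seg \<kappa> A B \<Longrightarrow> q \<in> X \<Longrightarrow> m \<noteq> b \<Longrightarrow> dist a q + dist q m = dist a m \<Longrightarrow> q \<in> f ` seg \<kappa> A B"
    "\<And>m q. m \<in> f ` seg \<kappa> A B \<Longrightarrow> q \<in> X \<Longrightarrow> m \<noteq> a \<Longrightarrow> dist b q + dist q m = dist b m \<Longrightarrow> q \<in> f ` seg \<kappa> A B"
proof -
  interpret stewart_space \<kappa> "ultrapower X" ultra_dist "(\<lambda>a _. a) ` X" by (rule alexandrov_stewart[OF X])
  let ?L = "dist a b"
  have CM: "C \<in> model_plane \<kappa>" and sum: "?L = dist a c + dist c b" using M d by (auto simp: seg_iff)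
  have pos: "0 < dist a c" "0 < dist c b" using ne by auto
  have L: "0 < ?L" using sum pos by linarith
  have AB: "A \<noteq> B" using L d M by auto
  note P = M(1,2) d(1)[symmetric] L short
  obtain F where F: "\<And>t. 0 \<le> t \<Longrightarrow> t \<le> ?L \<Longrightarrow> F t \<in> (\<lambda>a _. a) ` X"
    "\<And>s t. 0 \<le> s \<Longrightarrow> s \<le> ?L \<Longrightarrow> 0 \<le> t \<Longrightarrow> t \<le> ?L \<Longrightarrow> ultra_dist (F s) (F t) = \<bar>s - t\<bar>"
    "F 0 = (\<lambda>_. a)" "F (dist a c) = (\<lambda>_. c)" "F ?L = (\<lambda>_. b)"
    using path_exists[of "\<lambda>_. a" "\<lambda>_. b" "\<lambda>_. c" A B] mem M d sum pos short by auto
  define f where "f U = F (model_dist \<kappa> A U) 0" for U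
  have t: "0 \<le> model_dist \<kappa> A U" "model_dist \<kappa> A U \<le> ?L" "U \<in> model_plane \<kappa>"
      "U = geod \<kappa> A B (model_dist \<kappa> A U)" "model_dist \<kappa> U B = ?L - model_dist \<kappa> A U"
    if U: "U \<in> seg \<kappa> A B" for U
  proof -
    show UM: "U \<in> model_plane \<kappa>" using U by (simp add: seg_iff)
    show "0 \<le> model_dist \<kappa> A U" by (rule model_dist_nonneg[OF M(1) UM])
    show "model_dist \<kappa> A U \<le> ?L" "model_dist \<kappa> U B = ?L - model_dist \<kappa> A U"
      using U model_dist_nonneg[OF UM M(2)] d by (auto simp: seg_iff)
    show "U = geod \<kappa> A B (model_dist \<kappa> A U)" by (rule seg_geod[OF P U])
  qed
  have fF: "f U \<in> X" "F (model_dist \<kappa> A U) = (\<lambda>_. f U)" if U: "U \<in> seg \<kappa> A B" for U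
    using F(1)[OF t(1,2)[OF U]] by (auto simp: f_def)
  have iso: "dist (f U) (f V) = model_dist \<kappa> U V" if UV: "U \<in> seg \<kappa> A B" "V \<in> seg \<kappa> A B" for U V
  proof -
    have "dist (f U) (f V) = \<bar>model_dist \<kappa> A U - model_dist \<kappa> A V\<bar>"
      using F(2)[OF t(1,2)[OF UV(1)] t(1,2)[OF UV(2)]] fF(2)[OF UV(1)] fF(2)[OF UV(2)] by simp
    also have "\<dots> = model_dist \<kappa> U V"
      using geod_dist[OF P t(1,2)[OF UV(2)] t(1,2)[OF UV(1)]] t(4)[OF UV(1)] t(4)[OF UV(2)] by simp
    finally show ?thesis .
  qed
  have ends: "f A = a" "f B = b" "f C = c" using F(3-5) M d by (simp_all add: f_def)
  have in_seg: "A \<in> seg \<kappa> A B" "B \<in> seg \<kappa> A B" using M by (auto simp: seg_iff)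
  have fa: "dist a (f U) = model_dist \<kappa> A U" "dist b (f U) = model_dist \<kappa> B U" if "U \<in> seg \<kappa> A B" for U
    using iso[OF in_seg(1) that] iso[OF in_seg(2) that] ends by auto
  have BA: "model_dist \<kappa> B A = dist b a" using d(1) by (simp add: dist_commute model_dist_sym)
  have shortBA: "short \<kappa> (dist b a)" using short by (simp add: dist_commute)
  have left: "q = f U" if m: "m \<in> X" "m \<noteq> b" "dist a b = dist a m + dist m b" and q: "q \<in> X"
    "dist a q + dist q m = dist a m" and U: "U \<in> seg \<kappa> A B" "dist a (f U) = dist a q" "dist (f U) m = dist q m" for m q U
  proof -
    have "f U = q"
      by (rule alexandrov_between_unique[OF X mem(1,2) m(1) q(1) fF(1)[OF U(1)] M(1,2) d(1)])
        (use m q U short in auto)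
    then show ?thesis by simp
  qed
  have right: "q = f U" if m: "m \<in> X" "m \<noteq> a" "dist a b = dist a m + dist m b" and q: "q \<in> X"
    "dist b q + dist q m = dist b m" and U: "U \<in> seg \<kappa> A B" "dist b (f U) = dist b q" "dist (f U) m = dist q m" for m q U
  proof -
    have "f U = q"
      by (rule alexandrov_between_unique[OF X mem(2,1) m(1) q(1) fF(1)[OF U(1)] M(2,1) BA _ _ shortBA])
        (use m q U in \<open>auto simp: dist_commute\<close>)
    then show ?thesis by simp
  qed
  show ?thesis
  proof (rule that[of f, OF fF(1) iso ends])
    show "closed (f ` seg \<kappa> A B)"
    proof (intro compact_imp_closed compact_continuous_image)
      show "continuous_on (seg \<kappa> A B) f" by (rule isometry_continuous[OF _ iso]) (auto simp: seg_iff)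
      show "compact (seg \<kappa> A B)" by (rule compact_seg[OF M(1,2) AB]) (simp add: d short)
    qed
  next
    fix g U assume g: "\<And>U. U \<in> seg \<kappa> A B \<Longrightarrow> g U \<in> X"
      "\<And>U V. U \<in> seg \<kappa> A B \<Longrightarrow> V \<in> seg \<kappa> A B \<Longrightarrow> dist (g U) (g V) = model_dist \<kappa> U V"
      "g A = a" "g B = b" "g C = c" and U: "U \<in> seg \<kappa> A B"
    have gd: "dist a (g U) = model_dist \<kappa> A U" "dist b (g U) = model_dist \<kappa> B U" "dist (g U) c = model_dist \<kappa> U C"
      using g(2)[OF in_seg(1) U] g(2)[OF in_seg(2) U] g(2)[OF U M(3)] g by auto
    have fc: "dist (f U) c = model_dist \<kappa> U C" using iso[OF U M(3)] ends by simp
    have UC: "model_dist \<kappa> U C = \<bar>model_dist \<kappa> A U - dist a c\<bar>"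
      using geod_dist[OF P t(1,2)[OF M(3)] t(1,2)[OF U]] t(4)[OF M(3)] t(4)[OF U] d by simp
    show "g U = f U"
    \<comment> \<open>Before c the comparison takes place in [a, c], which b prolongs; after c in
      [c, b], which a prolongs.\<close>
    proof (cases "model_dist \<kappa> A U \<le> dist a c")
      case True
      show ?thesis
        by (rule left[OF mem(3) ne(2) sum g(1)[OF U] _ U]) (use True gd fc fa[OF U] UC in auto)
    next
      case False
      show ?thesis
        by (rule right[OF mem(3) ne(1) sum g(1)[OF U] _ U])
          (use False gd fc fa[OF U] UC t(5)[OF U] sum in \<open>auto simp: model_dist_sym[of \<kappa> B] dist_commute\<close>)
    qed
  next
    fix m q assume m: "m \<in> f ` seg \<kappa> A B" and q: "q \<in> X" "m \<noteq> b" "dist a q + dist q m = dist a m"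
    obtain V where V: "V \<in> seg \<kappa> A B" "m = f V" using m by blast
    have "dist a m = model_dist \<kappa> A V" using fa(1)[OF V(1)] V(2) by simp
    then have le: "dist a q \<le> model_dist \<kappa> A V" using q(3) zero_le_dist[of q m] by linarith
    then have le': "0 \<le> dist a q" "dist a q \<le> ?L" using t(2)[OF V(1)] by auto
    let ?U = "geod \<kappa> A B (dist a q)"
    have U: "?U \<in> seg \<kappa> A B" "model_dist \<kappa> A ?U = dist a q" using geod_seg[OF P le'] by auto
    have "dist (f ?U) m = dist q m"
      using iso[OF U(1) V(1)] geod_dist[OF P t(1,2)[OF V(1)] le'] t(4)[OF V(1)] V(2) le fa[OF V(1)] q(3) by simp
    then have "q = f ?U"
      by (intro left[OF _ q(2) _ q(1,3) U(1)])
        (use V fF(1) fa[OF V(1)] fa[OF U(1)] U t(5)[OF V(1)] in \<open>auto simp: dist_commute model_dist_sym[of \<kappa> B]\<close>)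
    then show "q \<in> f ` seg \<kappa> A B" using U(1) by blast
  next
    fix m q assume m: "m \<in> f ` seg \<kappa> A B" and q: "q \<in> X" "m \<noteq> a" "dist b q + dist q m = dist b m"
    obtain V where V: "V \<in> seg \<kappa> A B" "m = f V" using m by blast
    have bV: "dist b m = ?L - model_dist \<kappa> A V" using fa[OF V(1)] V(2) t(5)[OF V(1)] by (simp add: model_dist_sym)
    let ?t = "?L - dist b q"
    have le: "model_dist \<kappa> A V \<le> ?t" using q(3) bV zero_le_dist[of q m] by linarith
    then have le': "0 \<le> ?t" "?t \<le> ?L" using t(1)[OF V(1)] by auto
    let ?U = "geod \<kappa> A B ?t"
    have U: "?U \<in> seg \<kappa> A B" "model_dist \<kappa> ?U B = dist b q" using geod_seg[OF P le'] by auto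
    have "dist (f ?U) m = dist q m"
      using iso[OF U(1) V(1)] geod_dist[OF P t(1,2)[OF V(1)] le'] t(4)[OF V(1)] V(2) le bV q(3) by simp
    then have "q = f ?U"
      by (intro right[OF _ q(2) _ q(1,3) U(1)])
        (use V fF(1) fa[OF V(1)] fa[OF U(1)] U t(5)[OF V(1)] in \<open>auto simp: dist_commute model_dist_sym[of \<kappa> B]\<close>)
    then show "q \<in> f ` seg \<kappa> A B" using U(1) by blast
  qed
qed

lemma spans_region_iff:
  "D \<subseteq> X \<and> p \<in> D \<and> spans_region \<kappa> x y z a b c D \<longleftrightarrow>
    closed D \<and> p \<in> D \<and> (\<exists>f. (\<forall>U\<in>triangular_region \<kappa> a b c. f U \<in> X) \<and>
      (\<forall>U\<in>triangular_region \<kappa> a b c. \<forall>V\<in>triangular_region \<kappa> a b c. dist (f U) (f V) = model_dist \<kappa> U V) \<and>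
      D = f ` triangular_region \<kappa> a b c \<and> f a = x \<and> f b = y \<and> f c = z)"
  unfolding spans_region_def isometric_embedding_def by blast

text \<open>The hypothesis on p abstracts its position: it is reached from c by passing to points
  between an end and a point already reached, other than the opposite end. The constructed segment
  is closed under such steps.\<close>

lemma degenerate_spans:
  fixes X :: "'a::metric_space set"
  assumes X: "alexandrov_space \<kappa> X" and mem: "a \<in> X" "b \<in> X" "c \<in> X"
    and M: "A \<in> model_plane \<kappa>" "B \<in> model_plane \<kappa>" "C \<in> seg \<kappa> A B"
    and d: "model_dist \<kappa> A B = dist a b" "model_dist \<kappa> A C = dist a c" "model_dist \<kappa> C B = dist c b"
    and ne: "c \<noteq> a" "c \<noteq> b" and short: "short \<kappa> (dist a b)"
    and p: "\<And>D. c \<in> D \<Longrightarrow>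
      (\<And>m q. m \<in> D \<Longrightarrow> q \<in> X \<Longrightarrow> m \<noteq> b \<Longrightarrow> dist a q + dist q m = dist a m \<Longrightarrow> q \<in> D) \<Longrightarrow>
      (\<And>m q. m \<in> D \<Longrightarrow> q \<in> X \<Longrightarrow> m \<noteq> a \<Longrightarrow> dist b q + dist q m = dist b m \<Longrightarrow> q \<in> D) \<Longrightarrow> p \<in> D"
  shows "\<exists>!D. D \<subseteq> X \<and> p \<in> D \<and> spans_region \<kappa> a b c A B C D"
proof -
  let ?S = "seg \<kappa> A B"
  have R: "triangular_region \<kappa> A B C = ?S" by (rule triangular_region_degenerate[OF M]) (simp add: d short)
  show ?thesis
  proof (rule alexandrov_segment[OF X mem M d ne short])
    fix f assume f: "\<And>U. U \<in> ?S \<Longrightarrow> f U \<in> X"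
      "\<And>U V. U \<in> ?S \<Longrightarrow> V \<in> ?S \<Longrightarrow> dist (f U) (f V) = model_dist \<kappa> U V"
      "f A = a" "f B = b" "f C = c" "closed (f ` ?S)"
      and uniq: "\<And>g U. (\<And>U. U \<in> ?S \<Longrightarrow> g U \<in> X) \<Longrightarrow>
         (\<And>U V. U \<in> ?S \<Longrightarrow> V \<in> ?S \<Longrightarrow> dist (g U) (g V) = model_dist \<kappa> U V) \<Longrightarrow>
         g A = a \<Longrightarrow> g B = b \<Longrightarrow> g C = c \<Longrightarrow> U \<in> ?S \<Longrightarrow> g U = f U"
      and cover: "\<And>m q. m \<in> f ` ?S \<Longrightarrow> q \<in> X \<Longrightarrow> m \<noteq> b \<Longrightarrow> dist a q + dist q m = dist a m \<Longrightarrow> q \<in> f ` ?S"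
      "\<And>m q. m \<in> f ` ?S \<Longrightarrow> q \<in> X \<Longrightarrow> m \<noteq> a \<Longrightarrow> dist b q + dist q m = dist b m \<Longrightarrow> q \<in> f ` ?S"
    have c: "c \<in> f ` ?S" using M(3) f(5) by blast
    have pf: "p \<in> f ` ?S" by (rule p[OF c]) (fact cover)+
    show ?thesis
      unfolding spans_region_iff R
    proof (rule ex1I[of _ "f ` ?S"])
      show "closed (f ` ?S) \<and> p \<in> f ` ?S \<and> (\<exists>g. (\<forall>U\<in>?S. g U \<in> X) \<and>
          (\<forall>U\<in>?S. \<forall>V\<in>?S. dist (g U) (g V) = model_dist \<kappa> U V) \<and> f ` ?S = g ` ?S \<and> g A = a \<and> g B = b \<and> g C = c)"
        using f pf by blast
    next
      fix D assume "closed D \<and> p \<in> D \<and> (\<exists>g. (\<forall>U\<in>?S. g U \<in> X) \<and>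
          (\<forall>U\<in>?S. \<forall>V\<in>?S. dist (g U) (g V) = model_dist \<kappa> U V) \<and> D = g ` ?S \<and> g A = a \<and> g B = b \<and> g C = c)"
      then obtain g where g: "\<And>U. U \<in> ?S \<Longrightarrow> g U \<in> X"
        "\<And>U V. U \<in> ?S \<Longrightarrow> V \<in> ?S \<Longrightarrow> dist (g U) (g V) = model_dist \<kappa> U V" "D = g ` ?S" "g A = a" "g B = b" "g C = c"
        by blast
      then show "D = f ` ?S" using uniq[OF g(1,2,4-6)] by (auto intro!: image_cong)
    qed
  qed
qed

section \<open>Existence and uniqueness of the region for a nondegenerate triangle\<close>

context cevian begin

text \<open>A small move from Q towards a fixed interior point, taken on [x', w'], makes all three
  coefficients positive.\<close>

lemma inter_dense:
  assumes Q: "Q \<in> cone3 \<kappa> x' y' z'" and \<epsilon>: "0 < \<epsilon>"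
  shows "\<exists>R\<in>inter. model_dist \<kappa> Q R < \<epsilon>"
proof -
  obtain l m n where q: "Q \<in> model_plane \<kappa>" "0 \<le> l" "0 \<le> m" "0 \<le> n"
    "Q = l *\<^sub>R x' + m *\<^sub>R y' + n *\<^sub>R z'" using Q unfolding cone3_def by blast
  have t: "0 < L / 2" "L / 2 < L" using L_pos by auto
  obtain a b where ab: "0 < a" "0 < b" "G (L / 2) = a *\<^sub>R x' + b *\<^sub>R w'" by (rule G_coeffs[OF t])
  obtain \<beta> \<gamma> where bc: "0 < \<beta>" "0 < \<gamma>" "w' = \<beta> *\<^sub>R y' + \<gamma> *\<^sub>R z'" by (rule w_coeffs)
  let ?m = "G (L / 2)"
  have m: "?m = a *\<^sub>R x' + (b * \<beta>) *\<^sub>R y' + (b * \<gamma>) *\<^sub>R z'"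
  proof -
    have "b *\<^sub>R w' = (b * \<beta>) *\<^sub>R y' + (b * \<gamma>) *\<^sub>R z'"
      by (subst bc(3)) (simp add: scaleR_add_right)
    then show ?thesis using ab(3) by (simp add: add.assoc)
  qed
  have mi: "?m \<in> inter"
    unfolding inter_def using G_M m ab(1,2) bc(1,2) mult_pos_pos by blast
  show ?thesis
  proof (cases "Q = ?m")
    case True
    then show ?thesis using mi \<epsilon> q by (intro bexI[of _ ?m]) auto
  next
    case False
    have Qh: "Q \<in> half_plane \<kappa> e" using cone3_hs[OF hs(1,2,3)] Q by blast
    have mh: "?m \<in> half_plane \<kappa> e" using G_hs t by simp
    note D = model_dist_pos[OF q(1) G_M False]
    note D' = q(1) G_M[of "L / 2"] refl D hs_short[OF Qh mh]
    define \<tau> where "\<tau> = min (\<epsilon> / 2) (model_dist \<kappa> Q ?m / 2)"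
    have \<tau>: "0 < \<tau>" "\<tau> < \<epsilon>" "\<tau> < model_dist \<kappa> Q ?m" using \<epsilon> D by (auto simp: \<tau>_def)
    define R where "R = geod \<kappa> Q ?m \<tau>"
    have R: "R \<in> seg \<kappa> Q ?m" "model_dist \<kappa> Q R = \<tau>" "model_dist \<kappa> R ?m = model_dist \<kappa> Q ?m - \<tau>"
      unfolding R_def using geod_seg[OF D', of \<tau>] \<tau> by auto
    have RM: "R \<in> model_plane \<kappa>" using R by (simp add: seg_iff)
    have "R \<noteq> Q" "R \<noteq> ?m" using R \<tau> q(1) G_M by auto
    then obtain s u where su: "0 < s" "0 < u" "R = s *\<^sub>R Q + u *\<^sub>R ?m"
      using hs_coeffs[OF Qh mh R(1)] by metis
    have "R = (s * l + u * a) *\<^sub>R x' + (s * m + u * (b * \<beta>)) *\<^sub>R y' + (s * n + u * (b * \<gamma>)) *\<^sub>R z'"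
      unfolding su(3) m q(5) by (simp add: algebra_simps)
    moreover have "0 < s * l + u * a" "0 < s * m + u * (b * \<beta>)" "0 < s * n + u * (b * \<gamma>)"
      using su ab bc q by (auto intro!: add_nonneg_pos)
    ultimately have "R \<in> inter" unfolding inter_def using RM by blast
    then show ?thesis using R \<tau> by (intro bexI[of _ R]) auto
  qed
qed

lemma inter_cone3: "inter \<subseteq> cone3 \<kappa> x' y' z'"
  unfolding inter_def cone3_def by (auto intro: less_imp_le)

end

text \<open>A competing region agrees with the constructed one first on \<open>[x, w]\<close>, because it contains
  \<open>p\<close>, and then on the interior, whose points are determined by their distances to \<open>y\<close>, \<open>z\<close> and
  \<open>[x, w]\<close>.\<close>

lemma nondegenerate_spans:
  fixes X :: "'a::metric_space set"
  assumes X: "alexandrov_space \<kappa> X" and mem: "x \<in> X" "y \<in> X" "z \<in> X" "w \<in> X" "p \<in> X"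
    and M: "x' \<in> model_plane \<kappa>" "y' \<in> model_plane \<kappa>" "z' \<in> model_plane \<kappa>"
    and dual: "dual3 x' y' z' a b c"
    and w': "w' \<in> seg \<kappa> y' z'" "w' \<noteq> y'" "w' \<noteq> z'" "x' \<noteq> w'"
    and d: "model_dist \<kappa> x' y' = dist x y" "model_dist \<kappa> x' z' = dist x z" "model_dist \<kappa> x' w' = dist x w"
      "model_dist \<kappa> y' z' = dist y z" "model_dist \<kappa> y' w' = dist y w" "model_dist \<kappa> z' w' = dist z w"
    and p: "dist x w = dist x p + dist p w" "p \<noteq> x" "p \<noteq> w"
  shows "\<exists>!D. D \<subseteq> X \<and> p \<in> D \<and> spans_region \<kappa> x y z x' y' z' D"
proof -
  let ?N = "(\<lambda>a _. a) ` X" and ?K = "cone3 \<kappa> x' y' z'" and ?e = "a + b + c"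
  have K: "triangular_region \<kappa> x' y' z' = ?K" by (rule dual3.triangular_region_cone3[OF dual M])
  note h = dual3.hs3[OF dual M]
  have wh: "w' \<in> half_plane \<kappa> ?e" by (rule seg_hs[OF h(2,3) w'(1)])
  have wM: "w' \<in> model_plane \<kappa>" by (rule hsD(1)[OF wh])
  interpret S: stewart_space \<kappa> "ultrapower X" ultra_dist ?N by (rule alexandrov_stewart[OF X])
  define L where "L = dist x w"
  have short: "short \<kappa> L" using hs_short[OF h(1) wh] d by (simp add: L_def)
  have ppos: "0 < dist x p" "0 < dist p w" using p by auto
  obtain F where F: "\<And>t. 0 \<le> t \<Longrightarrow> t \<le> L \<Longrightarrow> F t \<in> ?N"
    "\<And>s t. 0 \<le> s \<Longrightarrow> s \<le> L \<Longrightarrow> 0 \<le> t \<Longrightarrow> t \<le> L \<Longrightarrow> ultra_dist (F s) (F t) = \<bar>s - t\<bar>"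
    "F 0 = (\<lambda>_. x)" "F (dist x p) = (\<lambda>_. p)" "F L = (\<lambda>_. w)"
    using S.path_exists[of "\<lambda>_. x" "\<lambda>_. w" "\<lambda>_. p" x' w'] mem M wM d p(1) ppos short
    unfolding L_def by auto
  interpret cevian \<kappa> "ultrapower X" ultra_dist ?N ?e "\<lambda>_. x" "\<lambda>_. y" "\<lambda>_. z" "\<lambda>_. w" x' y' z' w' F L
    by unfold_locales (use h wh mem w' d F in \<open>auto simp: L_def\<close>)
  define t0 where "t0 = dist x p"
  have t0: "0 < t0" "t0 < L" "0 \<le> t0" "t0 \<le> L" "F t0 = (\<lambda>_. p)"
    using ppos p(1) F(4) by (auto simp: t0_def L_def)
  obtain f0 where f0: "\<And>Q. Q \<in> inter \<Longrightarrow> f0 Q \<in> ?N" "\<And>Q. Q \<in> inter \<Longrightarrow> ok (f0 Q) Q"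
    "\<And>Q c C. Q \<in> inter \<Longrightarrow> ok c C \<Longrightarrow> ultra_dist (f0 Q) c = model_dist \<kappa> Q C" by (rule interior_map) blast
  define g where "g Q = f0 Q 0" for Q
  have g: "g Q \<in> X" "f0 Q = (\<lambda>_. g Q)" if "Q \<in> inter" for Q using f0(1)[OF that] by (auto simp: g_def)
  have okg: "ok (\<lambda>_. g Q) Q" if "Q \<in> inter" for Q using f0(2)[OF that] g(2)[OF that] by simp
  have g_ok: "dist (g Q) u = model_dist \<kappa> Q U" if "Q \<in> inter" "ok (\<lambda>_. u) U" for Q u U
    using f0(3)[OF that] g(2)[OF that(1)] by simp
  have KM: "?K \<subseteq> model_plane \<kappa>" by (auto simp: cone3_def)
  have Xc: "complete X" using X by (simp add: alexandrov_space_def)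
  have giso: "dist (g Q) (g R) = model_dist \<kappa> Q R" if "Q \<in> inter" "R \<in> inter" for Q R
    by (rule g_ok[OF that(1) okg[OF that(2)]])
  from extend_isometry[OF Xc KM inter_cone3 inter_dense g(1) giso]
  obtain f where "(\<forall>Q\<in>?K. f Q \<in> X) \<and> (\<forall>Q\<in>?K. \<forall>R\<in>inter. dist (f Q) (g R) = model_dist \<kappa> Q R) \<and>
    (\<forall>Q\<in>?K. \<forall>R\<in>?K. dist (f Q) (f R) = model_dist \<kappa> Q R)" ..
  then have f: "\<And>Q. Q \<in> ?K \<Longrightarrow> f Q \<in> X"
    "\<And>Q R. Q \<in> ?K \<Longrightarrow> R \<in> inter \<Longrightarrow> dist (f Q) (g R) = model_dist \<kappa> Q R"
    "\<And>Q R. Q \<in> ?K \<Longrightarrow> R \<in> ?K \<Longrightarrow> dist (f Q) (f R) = model_dist \<kappa> Q R" by blast+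
  \<comment> \<open>Distances to a dense subset of the region determine the point.\<close>
  have f_eq: "f Q = u" if Q: "Q \<in> ?K" and u: "\<And>R. R \<in> inter \<Longrightarrow> dist u (g R) = model_dist \<kappa> Q R" for Q u
  proof -
    have "dist (f Q) u \<le> \<epsilon>" if pe: "0 < \<epsilon>" for \<epsilon>
    proof -
      obtain R where R: "R \<in> inter" "model_dist \<kappa> Q R < \<epsilon> / 2" using inter_dense[OF Q half_gt_zero[OF pe]] by blast
      show ?thesis using dist_triangle2[of "f Q" u "g R"] f(2)[OF Q R(1)] u[OF R(1)] R(2) by simp
    qed
    then show ?thesis using field_le_epsilon[of "dist (f Q) u" 0] by simp
  qed
  have f_ok: "f Q = u" if "Q \<in> ?K" "ok (\<lambda>_. u) Q" for Q u
    by (rule f_eq[OF that(1)]) (use g_ok[OF _ that(2)] in \<open>simp add: dist_commute model_dist_sym\<close>)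
  have vK: "x' \<in> ?K" "y' \<in> ?K" "z' \<in> ?K"
    using M by (auto intro: cone3I[of x' \<kappa> 1 x' 0 y' 0 z'] cone3I[of y' \<kappa> 0 x' 1 y' 0 z'] cone3I[of z' \<kappa> 0 x' 0 y' 1 z'])
  have okx: "ok (\<lambda>_. x) x'" using ok_F[of 0] L_pos F(3) G_ends by simp
  have okp: "ok (\<lambda>_. p) (G t0)" using ok_F[OF t0(3,4)] t0(5) by simp
  have GK: "G s \<in> ?K" if s: "0 \<le> s" "s \<le> L" for s
  proof -
    obtain l m where "0 \<le> l" "0 \<le> m" "G s = l *\<^sub>R x' + m *\<^sub>R w'"
      by (rule hs_coeffs[OF h(1) wh G_seg[OF s]])
    moreover obtain i j where "0 < i" "0 < j" "w' = i *\<^sub>R y' + j *\<^sub>R z'" by (rule w_coeffs)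
    ultimately show ?thesis
      by (intro cone3I[OF G_M, of _ l _ "m * i" _ "m * j"]) (auto simp: scaleR_add_right)
  qed
  have wK: "w' \<in> ?K" using GK[of L] G_ends L_pos by simp
  have fx: "f x' = x" "f y' = y" "f z' = z" "f (G t0) = p"
    using f_ok[OF vK(1) okx] f_ok[OF vK(2) ok_y] f_ok[OF vK(3) ok_z] f_ok[OF GK[OF t0(3,4)] okp] by auto
  show ?thesis
    unfolding spans_region_iff K
  proof (rule ex1I[of _ "f ` ?K"])
    have "closed (f ` ?K)"
      by (intro compact_imp_closed compact_continuous_image isometry_continuous[OF KM f(3)]
          dual3.compact_cone3[OF dual M])
    moreover have "p \<in> f ` ?K" using GK[OF t0(3,4)] fx(4) by blast
    ultimately show "closed (f ` ?K) \<and> p \<in> f ` ?K \<and> (\<exists>g. (\<forall>U\<in>?K. g U \<in> X) \<and>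
        (\<forall>U\<in>?K. \<forall>V\<in>?K. dist (g U) (g V) = model_dist \<kappa> U V) \<and> f ` ?K = g ` ?K \<and> g x' = x \<and> g y' = y \<and> g z' = z)"
      using f fx by blast
  next
    fix D assume "closed D \<and> p \<in> D \<and> (\<exists>g. (\<forall>U\<in>?K. g U \<in> X) \<and>
        (\<forall>U\<in>?K. \<forall>V\<in>?K. dist (g U) (g V) = model_dist \<kappa> U V) \<and> D = g ` ?K \<and> g x' = x \<and> g y' = y \<and> g z' = z)"
    then obtain k where pD: "p \<in> D" and k: "\<And>U. U \<in> ?K \<Longrightarrow> k U \<in> X"
      "\<And>U V. U \<in> ?K \<Longrightarrow> V \<in> ?K \<Longrightarrow> dist (k U) (k V) = model_dist \<kappa> U V" "D = k ` ?K"
      "k x' = x" "k y' = y" "k z' = z" by blast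
    \<comment> \<open>P is the position of p in the competing region. Its distances to the vertices
      are those of G t0; Stewart's equality on [y', z'] adds the distance to w', and this forces P
      onto [x', w'].\<close>
    obtain P where P: "P \<in> ?K" "k P = p" using pD k(3) by auto
    have PM: "P \<in> model_plane \<kappa>" using P KM by auto
    have Pd: "model_dist \<kappa> x' P = dist x p" "model_dist \<kappa> y' P = dist y p" "model_dist \<kappa> z' P = dist z p"
      using k(2)[OF vK(1) P(1)] k(2)[OF vK(2) P(1)] k(2)[OF vK(3) P(1)] P k(4-6) by auto
    have Gd: "model_dist \<kappa> x' (G t0) = dist x p" "model_dist \<kappa> y' (G t0) = dist y p"
      "model_dist \<kappa> z' (G t0) = dist z p"
      using f(3)[OF vK(1) GK[OF t0(3,4)]] f(3)[OF vK(2) GK[OF t0(3,4)]] f(3)[OF vK(3) GK[OF t0(3,4)]] fx by auto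
    have yz: "0 < model_dist \<kappa> y' z'" "short \<kappa> (model_dist \<kappa> y' z')"
      using model_dist_pos[OF M(2) wM] model_dist_nonneg[OF wM M(3)] w' hs_short[OF h(2,3)] by (auto simp: seg_iff)
    have "snk \<kappa> (model_dist \<kappa> y' z') * sig \<kappa> (model_dist \<kappa> w' P) =
        snk \<kappa> (model_dist \<kappa> y' z') * sig \<kappa> (model_dist \<kappa> w' (G t0))"
      using model_stewart[OF M(2,3) PM yz w'(1)] model_stewart[OF M(2,3) G_M yz w'(1), of t0] Pd Gd by simp
    then have "sig \<kappa> (model_dist \<kappa> w' P) = sig \<kappa> (model_dist \<kappa> w' (G t0))" using snk_pos[OF yz] by simp
    then have Pw: "model_dist \<kappa> w' P = model_dist \<kappa> w' (G t0)"
      using sig_eq_iff[OF model_dist_nonneg[OF wM PM] model_dist_nonneg[OF wM G_M]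
          model_dist_fits[OF wM PM] model_dist_fits[OF wM G_M]] by simp
    have "P \<in> seg \<kappa> x' w'"
      using G_seg[OF t0(3,4)] Pd Gd Pw PM by (simp add: seg_iff model_dist_sym[of \<kappa> w'])
    then have "P = geod \<kappa> x' w' (model_dist \<kappa> x' P)" by (rule seg_geod[OF LL])
    then have PG: "P = G t0" unfolding G_def Pd(1) t0_def .
    have pw: "dist p w = L - t0" using p(1) by (simp add: L_def t0_def)
    have Gw: "model_dist \<kappa> (G t0) w' = L - t0" using G_dist[of t0 L] t0 G_ends by simp
    \<comment> \<open>The competitor is only known to share the vertices and p. That it sends w' to
      w follows from the unique continuation of [x, p] beyond p.\<close>
    have kw: "k w' = w"
    proof -
      have "dist p (k w') = dist p w" using k(2)[OF P(1) wK] P(2) PG Gw pw by simp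
      moreover have "dist x (k w') = dist x w" using k(2)[OF vK(1) wK] k(4) d by simp
      ultimately have "ultra_dist (\<lambda>_. w) (\<lambda>_. k w') = 0"
        using mem k(1)[OF wK] M wM d p ppos short
        by (intro S.beyond_unique[of "\<lambda>_. x" _ _ x' w' "\<lambda>_. p"]) (auto simp: L_def)
      then show ?thesis by simp
    qed
    have xw: "model_dist \<kappa> x' w' = dist x w" "model_dist \<kappa> w' x' = dist w x"
      using d by (auto simp: dist_commute model_dist_sym)
    \<comment> \<open>Each part of [x, w] is unique because the part on the other side of p prolongs
      it.\<close>
    have kF: "F s = (\<lambda>_. k (G s))" if s: "0 \<le> s" "s \<le> L" for s
    proof -
      obtain u where u: "u \<in> X" "F s = (\<lambda>_. u)" using F(1)[OF s] by auto
      have us: "dist x u = s" "dist u w = L - s" "dist u p = \<bar>s - t0\<bar>"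
        using F(2)[of 0 s] F(2)[of s L] F(2)[of s t0] s t0 u F(3,5) L_pos by auto
      have ks: "dist x (k (G s)) = s" "dist (k (G s)) w = L - s" "dist (k (G s)) p = \<bar>s - t0\<bar>"
        using k(2)[OF vK(1) GK[OF s]] k(2)[OF GK[OF s] wK] k(2)[OF GK[OF s] P(1)] k(4) kw P(2) PG
          G_dist[of 0 s] G_dist[of s L] G_dist[of s t0] s t0 L_pos G_ends by auto
      have "k (G s) = u"
      proof (cases "s \<le> t0")
        case True
        show ?thesis
          by (rule alexandrov_between_unique[OF X mem(1,4,5) u(1) k(1)[OF GK[OF s]] M(1) wM xw(1) p(1) ppos(2)])
            (use True us ks short in \<open>auto simp: L_def t0_def\<close>)
      next
        case False
        show ?thesis
          by (rule alexandrov_between_unique[OF X mem(4,1,5) u(1) k(1)[OF GK[OF s]] wM M(1) xw(2)])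
            (use False us ks short p(1) ppos pw in \<open>auto simp: L_def t0_def dist_commute\<close>)
      qed
      then show ?thesis using u by simp
    qed
    have k_inter: "k Q = g Q" if Q: "Q \<in> inter" for Q
    proof -
      have QK: "Q \<in> ?K" using Q inter_cone3 by blast
      have "ok (\<lambda>_. k Q) Q"
        unfolding ok_def
      proof (intro conjI allI impI)
        show "(\<lambda>_. k Q) \<in> ultrapower X" "Q \<in> half_plane \<kappa> ?e" using k(1)[OF QK] cone3_hs[OF h] QK by auto
        show "ultra_dist (\<lambda>_. k Q) (\<lambda>_. y) = model_dist \<kappa> Q y'" "ultra_dist (\<lambda>_. k Q) (\<lambda>_. z) = model_dist \<kappa> Q z'"
          using k(2)[OF QK vK(2)] k(2)[OF QK vK(3)] k(5,6) by auto
        show "ultra_dist (\<lambda>_. k Q) (F s) = model_dist \<kappa> Q (G s)" if "0 \<le> s" "s \<le> L" for s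
          using kF[OF that] k(2)[OF QK GK[OF that]] by simp
      qed
      then have "ultra_dist (\<lambda>_. k Q) (\<lambda>_. g Q) = 0" by (rule ok_unique[OF Q _ okg[OF Q]])
      then show ?thesis by simp
    qed
    have "f Q = k Q" if Q: "Q \<in> ?K" for Q
    proof (rule f_eq[OF Q])
      fix R assume R: "R \<in> inter"
      then have "R \<in> ?K" using inter_cone3 by blast
      then show "dist (k Q) (g R) = model_dist \<kappa> Q R" using k(2)[OF Q, of R] k_inter[OF R] by simp
    qed
    then show "D = f ` ?K" unfolding k(3) by (intro image_cong) auto
  qed
qed

section \<open>Relabelling of vertices and collinear configurations\<close>

lemma spans_region_rotate: "spans_region \<kappa> x y z a b c = spans_region \<kappa> y z x b c a"
  unfolding spans_region_def triangular_region_rotate[of \<kappa> a b c] by (intro ext) blast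

lemma spans_region_swap: "spans_region \<kappa> x y z a b c = spans_region \<kappa> x z y a c b"
proof -
  have "triangular_region \<kappa> a b c = triangular_region \<kappa> a c b"
    by (rule trans[OF triangular_region_rotate
          trans[OF triangular_region_flip triangular_region_rotate[symmetric]]])
  then show ?thesis unfolding spans_region_def by (intro ext) auto
qed

text \<open>If \<open>w \<in> (y, z)\<close> and \<open>p \<in> (x, w)\<close> with \<open>y\<close> between \<open>x\<close> and \<open>z\<close>, then \<open>w\<close>, and hence \<open>p\<close>,
  lies on the geodesic from \<open>x\<close> to \<open>z\<close> through \<open>y\<close>.\<close>

lemma collinear_end_case:
  fixes X :: "'a::metric_space set"
  assumes X: "alexandrov_space \<kappa> X" and mem: "x \<in> X" "y \<in> X" "z \<in> X" "w \<in> X" "p \<in> X"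
    and M: "x' \<in> model_plane \<kappa>" "z' \<in> model_plane \<kappa>" "y' \<in> seg \<kappa> x' z'"
    and d: "model_dist \<kappa> x' z' = dist x z" "model_dist \<kappa> x' y' = dist x y" "model_dist \<kappa> y' z' = dist y z"
    and ne: "distinct [x, y, z, w]" and short: "short \<kappa> (dist x z)"
    and w: "dist y z = dist y w + dist w z" and p: "dist x w = dist x p + dist p w"
  shows "\<exists>!D. D \<subseteq> X \<and> p \<in> D \<and> spans_region \<kappa> x z y x' z' y' D"
proof (rule degenerate_spans[OF X mem(1,3,2) M d])
  fix D assume D: "y \<in> D"
    "\<And>m q. m \<in> D \<Longrightarrow> q \<in> X \<Longrightarrow> m \<noteq> z \<Longrightarrow> dist x q + dist q m = dist x m \<Longrightarrow> q \<in> D"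
    "\<And>m q. m \<in> D \<Longrightarrow> q \<in> X \<Longrightarrow> m \<noteq> x \<Longrightarrow> dist z q + dist q m = dist z m \<Longrightarrow> q \<in> D"
  have "w \<in> D" by (rule D(3)[OF D(1) mem(4)]) (use ne w in \<open>auto simp: dist_commute\<close>)
  then show "p \<in> D" by (rule D(2)[OF _ mem(5)]) (use ne p in auto)
qed (use ne short in auto)

theorem corollary4:
  fixes \<kappa> :: real and X :: "'a::metric_space set" and x y z w p :: 'a
    and h :: "'a \<Rightarrow> real^3"
  assumes "alexandrov_space \<kappa> X"
    and "{x, y, z, w} \<subseteq> X" and "distinct [x, y, z, w]"
    and "w \<in> between_open X dist y z"
    and "\<kappa> > 0 \<Longrightarrow> peri x y z < 2 * pi / sqrt \<kappa>"
    and "isometric_embedding {x, y, z, w} dist (model_plane \<kappa>) (model_dist \<kappa>) h"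
    and "p \<in> between_open X dist x w"
  shows "\<exists>!D. D \<subseteq> X \<and> p \<in> D \<and> spans_region \<kappa> x y z (h x) (h y) (h z) D"
proof -
  note X = assms(1)
  have mem: "x \<in> X" "y \<in> X" "z \<in> X" "w \<in> X" "p \<in> X"
    using assms(2,7) by (auto simp: between_open_def between_closed_def)
  have w: "dist y z = dist y w + dist w z" and p: "dist x w = dist x p + dist p w" "p \<noteq> x" "p \<noteq> w"
    using assms(4,7) by (auto simp: between_open_def between_closed_def)
  have M: "h x \<in> model_plane \<kappa>" "h y \<in> model_plane \<kappa>" "h z \<in> model_plane \<kappa>" "h w \<in> model_plane \<kappa>"
    and d: "\<And>a b. a \<in> {x, y, z, w} \<Longrightarrow> b \<in> {x, y, z, w} \<Longrightarrow> model_dist \<kappa> (h a) (h b) = dist a b"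
    using assms(6) by (auto simp: isometric_embedding_def)
  have h_ne: "h a \<noteq> h b" if "a \<in> {x, y, z, w}" "b \<in> {x, y, z, w}" "a \<noteq> b" for a b
  proof
    assume eq: "h a = h b"
    have "h b \<in> model_plane \<kappa>" using that M by auto
    then show False using d[OF that(1,2)] eq that(3) by simp
  qed
  have "2 * pi / sqrt \<kappa> = 2 * dia \<kappa>" by (simp add: dia_def)
  then have small: "small \<kappa> (dist x y + dist y z + dist z x)"
    using assms(5) by (simp add: small_def peri_def)
  have sh: "short \<kappa> (dist x y)" "short \<kappa> (dist x z)" "short \<kappa> (dist y z)"
    by (rule small_short[OF small],
        use dist_triangle[of x y z] dist_triangle[of x z y] dist_triangle[of y z x]
        in \<open>simp add: dist_commute\<close>)+
  have sm: "small \<kappa> (model_dist \<kappa> (h x) (h y) + model_dist \<kappa> (h y) (h z) + model_dist \<kappa> (h z) (h x))"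
    using small d by simp
  have ne: "h x \<noteq> h y" using h_ne assms(3) by simp
  show ?thesis
  \<comment> \<open>In the collinear cases the middle vertex takes the role of the point c of
    \<open>degenerate_spans\<close>.\<close>
  proof (cases rule: triangle_cases[OF M(1-3) ne sm])
    case nd: (1 a b c)
    have "h w \<in> seg \<kappa> (h y) (h z)" using M d w by (simp add: seg_iff)
    then show ?thesis
      using h_ne assms(3) d p
      by (intro nondegenerate_spans[OF X mem M(1-3) nd]) auto
  next
    \<comment> \<open>Here z is in the middle, so y and z exchange their roles in
      \<open>collinear_end_case\<close>.\<close>
    case c: 2
    have "\<exists>!D. D \<subseteq> X \<and> p \<in> D \<and> spans_region \<kappa> x y z (h x) (h y) (h z) D"
      by (rule collinear_end_case[OF X mem(1,3,2,4,5) M(1,2) c])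
        (use d assms(3) sh w p in \<open>auto simp: dist_commute\<close>)
    then show ?thesis .
  next
    case b: 3
    have "\<exists>!D. D \<subseteq> X \<and> p \<in> D \<and> spans_region \<kappa> x z y (h x) (h z) (h y) D"
      by (rule collinear_end_case[OF X mem M(1,3) b]) (use d assms(3) sh w p in auto)
    then show ?thesis by (subst spans_region_swap)
  next
    case a: 4
    have xyz: "dist y z = dist y x + dist x z" using a d by (auto simp: seg_iff)
    have yz: "0 < model_dist \<kappa> (h y) (h z)" "short \<kappa> (model_dist \<kappa> (h y) (h z))" using d assms(3) sh by auto
    \<comment> \<open>Both x and w lie on the model geodesic from y to z, so their distance is the
      difference of their parameters. This places p between x and y or between x and z.\<close>
    have xw: "dist x w = \<bar>dist y w - dist y x\<bar>"
    proof -
      have hw: "h w \<in> seg \<kappa> (h y) (h z)" using M d w by (simp add: seg_iff)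
      have "h w = geod \<kappa> (h y) (h z) (dist y w)" "h x = geod \<kappa> (h y) (h z) (dist y x)"
        using seg_geod[OF M(2,3) refl yz hw] seg_geod[OF M(2,3) refl yz a] d by auto
      moreover have "model_dist \<kappa> (h y) (h z) = dist y z" using d by simp
      then have "dist y w \<le> model_dist \<kappa> (h y) (h z)" "dist y x \<le> model_dist \<kappa> (h y) (h z)"
        using w xyz zero_le_dist[of w z] zero_le_dist[of x z] by linarith+
      moreover have "0 \<le> dist y w" "0 \<le> dist y x" by auto
      ultimately show ?thesis
        using geod_dist[OF M(2,3) refl yz, of "dist y x" "dist y w"] d[of w x] by (simp add: dist_commute)
    qed
    have "\<exists>!D. D \<subseteq> X \<and> p \<in> D \<and> spans_region \<kappa> y z x (h y) (h z) (h x) D"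
    proof (rule degenerate_spans[OF X mem(2,3,1) M(2,3) a])
      fix D assume D: "x \<in> D"
        "\<And>m q. m \<in> D \<Longrightarrow> q \<in> X \<Longrightarrow> m \<noteq> z \<Longrightarrow> dist y q + dist q m = dist y m \<Longrightarrow> q \<in> D"
        "\<And>m q. m \<in> D \<Longrightarrow> q \<in> X \<Longrightarrow> m \<noteq> y \<Longrightarrow> dist z q + dist q m = dist z m \<Longrightarrow> q \<in> D"
      show "p \<in> D"
      proof (cases "dist y w \<le> dist y x")
        case True
        show ?thesis
        proof (rule D(2)[OF D(1) mem(5)])
          show "x \<noteq> z" using assms(3) by auto
          show "dist y p + dist p x = dist y x"
            using True xw p dist_triangle[of y p w] dist_triangle[of y x p] by (simp add: dist_commute)
        qed
      next
        case False
        show ?thesis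
        proof (rule D(3)[OF D(1) mem(5)])
          show "x \<noteq> y" using assms(3) by auto
          show "dist z p + dist p x = dist z x"
            using False xw p w xyz dist_triangle[of z p w] dist_triangle[of z x p] by (simp add: dist_commute)
        qed
      qed
    qed (use d assms(3) sh in auto)
    then show ?thesis by (subst spans_region_rotate)
  qed
qed

end
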